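(* Suppose that $\mathcal W=\mathrm{Range}\,\mathcal Q$. Let $(\bar x,\bar u,\bar s,\bar y,\bar z,\bar v)\in\mathbb S^p\times\mathbb S^p\times\mathbb S^p\times\mathbb R^m\times\mathbb S^p\times\mathbb S^p$ be such that $G_P(\bar x,\bar u,\bar s,\bar y,\bar z,\bar v)=0$ and let $\bar w$ be the unique point in $\mathcal W$ such that $\mathcal Q\bar x=\mathcal Q\bar w$. Consider the conditions (SOSC-P) $\langle\mathcal Qd_x,d_x\rangle+2\langle\bar s,d_x\bar x^\dagger d_x\rangle>0$ for all $0\ne(d_x,d_u)\in\mathcal C(\bar x,\bar u)$; (SOSC-D) $\langle\mathcal Qd_w,d_w\rangle+2\langle\bar x,d_s\bar s^\dagger d_s\rangle>0$ for all $0\ne(d_s,d_y,d_w,d_z)\in\mathcal C(\bar s,\bar y,\bar w,\bar z)$; (SRCQ-P) $\begin{pmatrix}\mathcal A\\ \mathcal I\end{pmatrix}\big(T_{\mathbb S^p_+}(\bar x)\cap\bar s^\perp\big)-\{0\}\times\big(T_{\mathcal P}(\bar x)\cap\bar z^\perp\big)=\mathbb R^m\times\mathbb S^p$; (SRCQ-D) $T_{\mathbb S^p_+}(\bar s)\cap\bar x^\perp+S_{\bar x,\bar z}+\mathcal A^*\mathbb R^m-\mathcal Q\mathcal W=\mathbb S^p$. Then the following statements are equivalent to each other: (i) (SOSC-P) and (SOSC-D) hold. (ii) (SRCQ-P) and (SRCQ-D) hold. (iii) $(G_P)^{-1}$ is isolated calm at the origin with respect to $(\bar x,\bar u,\bar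 s,\bar y,\bar z,\bar v)$. (iv) $(G_D)^{-1}$ is isolated calm at the origin with respect to $(\bar s,\bar y,\bar w,(\bar z,\theta(\bar z)),\bar x,\bar u,(-\bar x,-1))$. (v) $(F_P)^{-1}$ is isolated calm at the origin with respect to $(\bar x,\bar u,\bar y,\bar z)$. (vi) $(F_D)^{-1}$ is isolated calm at the origin with respect to $(\bar s,\bar y,\bar w,\bar z,\bar x)$. (vii) (SOSC-P) and (SRCQ-P) hold. (viii) (SOSC-D) and (SRCQ-D) hold.
   Context: $\mathbb S^p$: $p\times p$ real symmetric matrices with trace inner product; $\mathbb S^p_+$ the positive semi-definite cone, $\mathbb S^p_-=-\mathbb S^p_+$. $\mathcal Q:\mathbb S^p\to\mathbb S^p$ is self-adjoint positive semi-definite linear, $\mathcal A:\mathbb S^p\to\mathbb R^m$ linear, $c\in\mathbb S^p$, $b\in\mathbb R^m$, $\mathcal P\subset\mathbb S^p$ a nonempty convex polyhedral set, $\mathcal I$ the identity on $\mathbb S^p$. $T$, $N$ denote tangent and normal cones of convex analysis, $\Pi$ metric projection, $v^\perp=\{d:\langle d,v\rangle=0\}$, $\dagger$ Moore–Penrose pseudo-inverse, $\delta^*_{\mathcal P}$ the support function of $\mathcal P$, $\theta(z):=\delta^*_{\mathcal P}(-z)$ with epigraph $\mathrm{epi}\,\theta$, $\mathrm{Pr}_\theta$ the proximal mapping of $\theta$, $\theta'(z;u)$ directional derivative. Primal problem: $\min\ \frac12\langle x,\mathcal Qx\rangle+\langle c,x\rangle$ s.t. $\mathcal Ax=b,\ x-u=0,\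 x\in\mathbb S^p_+,\ u\in\mathcal P$. Dual problem: $\max\ \langle b,y\rangle-\frac12\langle w,\mathcal Qw\rangle-\delta^*_{\mathcal P}(-z)$ s.t. $s+\mathcal A^*y-\mathcal Qw+z=c$, $s\in\mathbb S^p_+$, $w\in\mathcal W$. Mappings (for $x,u,s,z,v\in\mathbb S^p$, $y\in\mathbb R^m$, $w\in\mathcal W$, $t,\zeta\in\mathbb R$): $G_P(x,u,s,y,z,v)=\big(\mathcal Qx-\mathcal A^*y-z-s+c,\ z+v,\ x+\Pi_{\mathbb S^p_-}(-x+s),\ \mathcal Ax-b,\ x-u,\ -u+\Pi_{\mathcal P}(u+v)\big)$; $F_P(x,u,y,z)=\big(x+\Pi_{\mathbb S^p_-}(-x+\mathcal Qx-\mathcal A^*y-z+c),\ -u+\Pi_{\mathcal P}(u-z),\ \mathcal Ax-b,\ x-u\big)$; $F_D(s,y,w,z,x)=\big(\mathcal Ax-b,\ \mathcal Qw-\mathcal Qx,\ -s-\mathcal A^*y+\mathcal Qw-z+c,\ s+\Pi_{\mathbb S^p_-}(-s+x),\ -z+\mathrm{Pr}_\theta(z-x)\big)$; $G_D(s,y,w,(z,t),x,u,(v,\zeta))=\big(x-u,\ \mathcal Ax-b,\ \mathcal Qw-\mathcal Qx,\ (x,1)+(v,\zeta),\ -s-\mathcal A^*y+\mathcal Qw-z+c,\ s+\Pi_{\mathbb S^p_-}(-s+u),\ -(z,t)+\Pi_{\mathrm{epi}\,\theta}((z,t)+(v,\zeta))\big)$. $S_{x,z}:=\{u\in\mathbb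 S^p:\langle u,x\rangle+\theta'(z;u)=0\}$. Primal critical cone: $\mathcal C(\bar x,\bar u)=\{(d_x,d_u)\in\mathbb S^p\times\mathbb S^p:\mathcal Ad_x=0,\ d_u-d_x=0,\ d_x\in T_{\mathbb S^p_+}(\bar x),\ d_u\in T_{\mathcal P}(\bar u),\ \langle\mathcal Q\bar x+c,d_x\rangle=0\}$. Dual critical cone: $\mathcal C(\bar s,\bar y,\bar w,\bar z)$ is the set of $(d_s,d_y,d_w,d_z)\in\mathbb S^p\times\mathbb R^m\times\mathcal W\times\mathbb S^p$ with $d_s+\mathcal A^*d_y-\mathcal Qd_w+d_z=0$, $d_s\in T_{\mathbb S^p_+}(\bar s)\cap\bar x^\perp$, $d_z\in S_{\bar x,\bar z}$. (SOSC-P), (SOSC-D) are the second-order sufficient optimality conditions of the primal at $(\bar x,\bar u)$ and of the dual at $(\bar s,\bar y,\bar w,\bar z)$; (SRCQ-P), (SRCQ-D) are the strict Robinson constraint qualifications of the primal at $\bar x$ with respect to $(\bar s,\bar y,\bar w,\bar z)$ and of the dual at $(\bar s,\bar y,\bar z,\bar v)$ with respect to $(\bar x,\bar u)$. A set-valued mapping $F$ is isolated calm at $a$ with respect to $b\in F(a)$ if there are $\kappa_0>0$ and neighborhoods $V$ of $a$, $W$ of $b$ such that $F(a')\cap W\subseteq\{b'':\|b''-b\|\le\kappa_0\|a'-a\|\}$ for all $a'\in V$. *)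

theory Defs
  imports "HOL-Analysis.Analysis"
begin

section \<open>The Euclidean space of real symmetric matrices\<close>

typedef 'n symmat = "{A :: real^'n^'n. transpose A = A}"
  morphisms mat_of_sym sym_of_mat
  by (rule exI[of _ 0]) (simp add: transpose_def zero_vec_def)

setup_lifting type_definition_symmat

lemma transpose_mat_of_sym [simp]: "transpose (mat_of_sym A) = mat_of_sym A"
  using mat_of_sym[of A] by simp

instantiation symmat :: (finite) real_vector
begin

lift_definition zero_symmat :: "'a symmat" is 0
  by (simp add: transpose_def zero_vec_def)

lift_definition plus_symmat :: "'a symmat \<Rightarrow> 'a symmat \<Rightarrow> 'a symmat" is "(+)"
  by (simp add: transpose_def vec_eq_iff)

lift_definition minus_symmat :: "'a symmat \<Rightarrow> 'a symmat \<Rightarrow> 'a symmat" is "(-)"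
  by (simp add: transpose_def vec_eq_iff)

lift_definition uminus_symmat :: "'a symmat \<Rightarrow> 'a symmat" is uminus
  by (simp add: transpose_def vec_eq_iff)

lift_definition scaleR_symmat :: "real \<Rightarrow> 'a symmat \<Rightarrow> 'a symmat" is "scaleR"
  by (simp add: transpose_def vec_eq_iff)

instance
  by standard (transfer; simp add: algebra_simps)+

end

lemma trace_matrix_mult_transpose:
  fixes A B :: "real^'n^'n"
  shows "trace (transpose A ** B) = inner A B"
  unfolding trace_def matrix_matrix_mult_def transpose_def inner_vec_def
  by (simp, rule sum.swap)

instantiation symmat :: (finite) real_inner
begin

definition inner_symmat :: "'a symmat \<Rightarrow> 'a symmat \<Rightarrow> real" where
  "inner_symmat A B = trace (mat_of_sym A ** mat_of_sym B)"

definition norm_symmat :: "'a symmat \<Rightarrow> real" where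
  "norm_symmat A = sqrt (inner A A)"

definition sgn_symmat :: "'a symmat \<Rightarrow> 'a symmat" where
  "sgn_symmat A = A /\<^sub>R norm A"

definition dist_symmat :: "'a symmat \<Rightarrow> 'a symmat \<Rightarrow> real" where
  "dist_symmat A B = norm (A - B)"

definition uniformity_symmat :: "('a symmat \<times> 'a symmat) filter" where
  "uniformity_symmat = (INF e\<in>{0<..}. principal {(x, y). dist x y < e})"

definition open_symmat :: "'a symmat set \<Rightarrow> bool" where
  "open_symmat U \<longleftrightarrow> (\<forall>x\<in>U. \<forall>\<^sub>F (x', y) in uniformity. x' = x \<longrightarrow> y \<in> U)"

lemma inner_symmat_eq: "inner A B = inner (mat_of_sym A) (mat_of_sym B)"
  using trace_matrix_mult_transpose[of "mat_of_sym A" "mat_of_sym B"]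
  by (simp add: inner_symmat_def)

instance
proof
  fix x y z :: "'a symmat" and r :: real
  show "inner x y = inner y x"
    by (simp add: inner_symmat_eq inner_commute)
  show "inner (x + y) z = inner x z + inner y z"
    by (simp add: inner_symmat_eq plus_symmat.rep_eq inner_add_left)
  show "inner (r *\<^sub>R x) y = r * inner x y"
    by (simp add: inner_symmat_eq scaleR_symmat.rep_eq)
  show "0 \<le> inner x x"
    by (simp add: inner_symmat_eq)
  show "inner x x = 0 \<longleftrightarrow> x = 0"
    by (simp add: inner_symmat_eq zero_symmat.rep_eq[symmetric] mat_of_sym_inject)
qed (simp_all add: norm_symmat_def sgn_symmat_def dist_symmat_def uniformity_symmat_def
      open_symmat_def)

end

lemma subspace_symmetric: "subspace {A :: real^'n^'n. transpose A = A}"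
  by (auto simp: subspace_def transpose_def vec_eq_iff)

lemma ex_orthonormal_basis_symmat:
  "\<exists>B :: 'n::finite symmat set. B \<noteq> {} \<and> finite B \<and>
     (\<forall>u\<in>B. \<forall>v\<in>B. inner u v = (if u = v then 1 else 0)) \<and>
     (\<forall>x. (\<forall>u\<in>B. inner x u = 0) \<longleftrightarrow> x = 0)"
proof -
  let ?S = "{A :: real^'n^'n. transpose A = A}"
  obtain B where B: "B \<subseteq> ?S" "pairwise orthogonal B" "\<And>x. x \<in> B \<Longrightarrow> norm x = 1"
      "independent B" "card B = dim ?S" "span B = ?S"
    by (rule orthonormal_basis_subspace[OF subspace_symmetric]) (rule that)
  let ?C = "sym_of_mat ` B"
  have rep: "mat_of_sym (sym_of_mat b) = b" if "b \<in> B" for b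
    using that B(1) by (auto intro!: sym_of_mat_inverse)
  have fin: "finite B"
    using B(4) independent_imp_finite by blast
  have mat1: "(mat 1 :: real^'n^'n) \<in> ?S"
    by simp
  have ne: "B \<noteq> {}"
  proof
    assume "B = {}"
    then have "?S = {0}" using B(6) by simp
    then have "(mat 1 :: real^'n^'n) = 0" using mat1 by blast
    then have "(mat 1 :: real^'n^'n) $ undefined $ undefined = 0" by simp
    then show False by (simp add: mat_def)
  qed
  have orth: "inner u v = (if u = v then 1 else 0)" if "u \<in> ?C" "v \<in> ?C" for u v
  proof -
    from that obtain a b where ab: "a \<in> B" "b \<in> B" "u = sym_of_mat a" "v = sym_of_mat b"
      by auto
    have "inner u v = inner a b"
      using ab rep by (simp add: inner_symmat_eq)
    moreover have "u = v \<longleftrightarrow> a = b"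
      using ab rep by metis
    moreover have "inner a a = 1"
      using B(3)[OF ab(1)] by (simp add: norm_eq_1)
    moreover have "a \<noteq> b \<Longrightarrow> inner a b = 0"
      using B(2) ab by (auto simp: pairwise_def orthogonal_def)
    ultimately show ?thesis using \<open>inner u v = inner a b\<close> by (cases "a = b") simp_all
  qed
  have zero: "(\<forall>u\<in>?C. inner x u = 0) \<longleftrightarrow> x = 0" for x
  proof
    assume a: "\<forall>u\<in>?C. inner x u = 0"
    have "orthogonal (mat_of_sym x) b" if "b \<in> B" for b
      using a that rep[OF that] by (force simp: inner_symmat_eq orthogonal_def)
    moreover have "mat_of_sym x \<in> span B"
      using B(6) by simp
    ultimately have "orthogonal (mat_of_sym x) (mat_of_sym x)"
      using orthogonal_to_span by blast
    then show "x = 0"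
      by (simp add: orthogonal_def zero_symmat.rep_eq[symmetric] mat_of_sym_inject)
  qed simp
  show ?thesis
    using ne fin orth zero by (intro exI[of _ ?C] conjI ballI allI) simp_all
qed

instantiation symmat :: (finite) euclidean_space
begin

definition Basis_symmat :: "'a symmat set" where
  "Basis_symmat = (SOME B. B \<noteq> {} \<and> finite B \<and>
     (\<forall>u\<in>B. \<forall>v\<in>B. inner u v = (if u = v then 1 else 0)) \<and>
     (\<forall>x. (\<forall>u\<in>B. inner x u = 0) \<longleftrightarrow> x = 0))"

instance
proof
  note * = someI_ex[OF ex_orthonormal_basis_symmat[where 'n='a], folded Basis_symmat_def]
  show "(Basis :: 'a symmat set) \<noteq> {}" "finite (Basis :: 'a symmat set)"
    using * by blast+
  show "inner u v = (if u = v then 1 else 0)" if "u \<in> Basis" "v \<in> Basis" for u v :: "'a symmat"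
    using * that by blast
  show "(\<forall>u\<in>Basis. inner x u = 0) \<longleftrightarrow> x = 0" for x :: "'a symmat"
    using * by blast
qed

end

definition psd_cone :: "'n::finite symmat set" where
  "psd_cone = {X. \<forall>v. 0 \<le> inner v (mat_of_sym X *v v)}"

abbreviation nsd_cone :: "'n::finite symmat set" where
  "nsd_cone \<equiv> uminus ` psd_cone"

text \<open>The Moore-Penrose pseudo-inverse, through the four Penrose conditions.\<close>
definition pinv :: "real^'n^'m \<Rightarrow> real^'m^'n" where
  "pinv A = (THE X. A ** X ** A = A \<and> X ** A ** X = X \<and>
     transpose (A ** X) = A ** X \<and> transpose (X ** A) = X ** A)"

text \<open>The number \<open>\<langle>s, d x\<^sup>\<dagger> d\<rangle>\<close>, in the trace inner product.\<close>
definition curv_form :: "'n::finite symmat \<Rightarrow> 'n symmat \<Rightarrow> 'n symmat \<Rightarrow> real" where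
  "curv_form s x d =
     trace (mat_of_sym s ** (mat_of_sym d ** pinv (mat_of_sym x) ** mat_of_sym d))"


section \<open>Convex analysis\<close>

definition tangent_cone :: "'a::real_normed_vector set \<Rightarrow> 'a \<Rightarrow> 'a set" where
  "tangent_cone C x = (if x \<in> C then closure (conic hull ((\<lambda>y. y - x) ` C)) else {})"

definition perp :: "'a::real_inner \<Rightarrow> 'a set" where
  "perp v = {d. inner d v = 0}"

definition support_fun :: "'a::real_inner set \<Rightarrow> 'a \<Rightarrow> ereal" where
  "support_fun P y = (SUP u\<in>P. ereal (inner u y))"

definition theta :: "'a::real_inner set \<Rightarrow> 'a \<Rightarrow> ereal" where
  "theta P z = support_fun P (- z)"

definition epi :: "('a \<Rightarrow> ereal) \<Rightarrow> ('a \<times> real) set" where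
  "epi f = {(z, t). f z \<le> ereal t}"

definition prox :: "('a::real_normed_vector \<Rightarrow> ereal) \<Rightarrow> 'a \<Rightarrow> 'a" where
  "prox f a = (ARG_MIN (\<lambda>z. f z + ereal ((norm (z - a))\<^sup>2 / 2)) z. True)"

text \<open>One-sided, with values in the extended reals; meaningful where \<open>f z\<close> is finite.\<close>
definition dir_deriv :: "('a::real_vector \<Rightarrow> ereal) \<Rightarrow> 'a \<Rightarrow> 'a \<Rightarrow> ereal" where
  "dir_deriv f z u = Lim (at_right 0) (\<lambda>t. (f (z + t *\<^sub>R u) - f z) / ereal t)"

definition S_set :: "'a::real_inner set \<Rightarrow> 'a \<Rightarrow> 'a \<Rightarrow> 'a set" where
  "S_set P x z = {u. ereal (inner u x) + dir_deriv (theta P) z u = 0}"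

definition isolated_calm ::
    "('a::real_normed_vector \<Rightarrow> 'b::real_normed_vector set) \<Rightarrow> 'a \<Rightarrow> 'b \<Rightarrow> bool" where
  "isolated_calm F a b \<longleftrightarrow> b \<in> F a \<and>
     (\<exists>\<kappa>>0. \<exists>V W. open V \<and> a \<in> V \<and> open W \<and> b \<in> W \<and>
        (\<forall>a'\<in>V. F a' \<inter> W \<subseteq> {b''. norm (b'' - b) \<le> \<kappa> * norm (a' - a)}))"

text \<open>The set-valued inverse of the restriction of \<open>F\<close> to the domain \<open>D\<close>.\<close>
definition inverse_map :: "'b set \<Rightarrow> ('b \<Rightarrow> 'a) \<Rightarrow> 'a \<Rightarrow> 'b set" where
  "inverse_map D F a = {b \<in> D. F b = a}"


section \<open>The mappings, critical cones, and regularity conditions\<close>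

type_synonym 'p lin_op = "'p symmat \<Rightarrow> 'p symmat"
type_synonym ('p, 'm) lin_map = "'p symmat \<Rightarrow> real^'m"

definition G_P :: "'p::finite lin_op \<Rightarrow> ('p, 'm::finite) lin_map \<Rightarrow> 'p symmat \<Rightarrow> real^'m \<Rightarrow>
    'p symmat set \<Rightarrow>
    'p symmat \<times> 'p symmat \<times> 'p symmat \<times> (real^'m) \<times> 'p symmat \<times> 'p symmat \<Rightarrow>
    'p symmat \<times> 'p symmat \<times> 'p symmat \<times> (real^'m) \<times> 'p symmat \<times> 'p symmat" where
  "G_P Q A c b P = (\<lambda>(x, u, s, y, z, v).
     (Q x - adjoint A y - z - s + c,
      z + v,
      x + closest_point nsd_cone (- x + s),
      A x - b,
      x - u,
      - u + closest_point P (u + v)))"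

definition F_P :: "'p::finite lin_op \<Rightarrow> ('p, 'm::finite) lin_map \<Rightarrow> 'p symmat \<Rightarrow> real^'m \<Rightarrow>
    'p symmat set \<Rightarrow>
    'p symmat \<times> 'p symmat \<times> (real^'m) \<times> 'p symmat \<Rightarrow>
    'p symmat \<times> 'p symmat \<times> (real^'m) \<times> 'p symmat" where
  "F_P Q A c b P = (\<lambda>(x, u, y, z).
     (x + closest_point nsd_cone (- x + Q x - adjoint A y - z + c),
      - u + closest_point P (u - z),
      A x - b,
      x - u))"

definition F_D :: "'p::finite lin_op \<Rightarrow> ('p, 'm::finite) lin_map \<Rightarrow> 'p symmat \<Rightarrow> real^'m \<Rightarrow>
    'p symmat set \<Rightarrow>
    'p symmat \<times> (real^'m) \<times> 'p symmat \<times> 'p symmat \<times> 'p symmat \<Rightarrow>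
    (real^'m) \<times> 'p symmat \<times> 'p symmat \<times> 'p symmat \<times> 'p symmat" where
  "F_D Q A c b P = (\<lambda>(s, y, w, z, x).
     (A x - b,
      Q w - Q x,
      - s - adjoint A y + Q w - z + c,
      s + closest_point nsd_cone (- s + x),
      - z + prox (theta P) (z - x)))"

definition G_D :: "'p::finite lin_op \<Rightarrow> ('p, 'm::finite) lin_map \<Rightarrow> 'p symmat \<Rightarrow> real^'m \<Rightarrow>
    'p symmat set \<Rightarrow>
    'p symmat \<times> (real^'m) \<times> 'p symmat \<times> ('p symmat \<times> real) \<times> 'p symmat \<times> 'p symmat \<times>
      ('p symmat \<times> real) \<Rightarrow>
    'p symmat \<times> (real^'m) \<times> 'p symmat \<times> ('p symmat \<times> real) \<times> 'p symmat \<times> 'p symmat \<times>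
      ('p symmat \<times> real)" where
  "G_D Q A c b P = (\<lambda>(s, y, w, (z, t), x, u, (v, \<zeta>)).
     (x - u,
      A x - b,
      Q w - Q x,
      (x, 1) + (v, \<zeta>),
      - s - adjoint A y + Q w - z + c,
      s + closest_point nsd_cone (- s + u),
      - (z, t) + closest_point (epi (theta P)) ((z, t) + (v, \<zeta>))))"

text \<open>The variable \<open>w\<close> of the two dual mappings ranges over \<open>W\<close> only.\<close>

definition dom_F_D :: "'p::finite symmat set \<Rightarrow>
    ('p symmat \<times> (real^'m::finite) \<times> 'p symmat \<times> 'p symmat \<times> 'p symmat) set" where
  "dom_F_D W = {(s, y, w, z, x). w \<in> W}"

definition dom_G_D :: "'p::finite symmat set \<Rightarrow>
    ('p symmat \<times> (real^'m::finite) \<times> 'p symmat \<times> ('p symmat \<times> real) \<times> 'p symmat \<times>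
      'p symmat \<times> ('p symmat \<times> real)) set" where
  "dom_G_D W = {(s, y, w, zt, x, u, v\<zeta>). w \<in> W}"

definition crit_P :: "'p::finite lin_op \<Rightarrow> ('p, 'm::finite) lin_map \<Rightarrow> 'p symmat \<Rightarrow>
    'p symmat set \<Rightarrow> 'p symmat \<Rightarrow> 'p symmat \<Rightarrow> ('p symmat \<times> 'p symmat) set" where
  "crit_P Q A c P x u =
     {(dx, du). A dx = 0 \<and> du - dx = 0 \<and> dx \<in> tangent_cone psd_cone x \<and>
        du \<in> tangent_cone P u \<and> inner (Q x + c) dx = 0}"

text \<open>The dual critical cone does not depend on \<open>y\<close> and \<open>w\<close>, but on the primal point \<open>x\<close>.\<close>

definition crit_D :: "'p::finite lin_op \<Rightarrow> ('p, 'm::finite) lin_map \<Rightarrow> 'p symmat set \<Rightarrow>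
    'p symmat set \<Rightarrow> 'p symmat \<Rightarrow> 'p symmat \<Rightarrow> 'p symmat \<Rightarrow>
    ('p symmat \<times> (real^'m) \<times> 'p symmat \<times> 'p symmat) set" where
  "crit_D Q A P W x s z =
     {(ds, dy, dw, dz). dw \<in> W \<and> ds + adjoint A dy - Q dw + dz = 0 \<and>
        ds \<in> tangent_cone psd_cone s \<inter> perp x \<and> dz \<in> S_set P x z}"

definition SOSC_P :: "'p::finite lin_op \<Rightarrow> ('p, 'm::finite) lin_map \<Rightarrow> 'p symmat \<Rightarrow>
    'p symmat set \<Rightarrow> 'p symmat \<Rightarrow> 'p symmat \<Rightarrow> 'p symmat \<Rightarrow> bool" where
  "SOSC_P Q A c P x u s \<longleftrightarrow>
     (\<forall>(dx, du) \<in> crit_P Q A c P x u. (dx, du) \<noteq> 0 \<longrightarrow>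
        inner (Q dx) dx + 2 * curv_form s x dx > 0)"

definition SOSC_D :: "'p::finite lin_op \<Rightarrow> ('p, 'm::finite) lin_map \<Rightarrow> 'p symmat set \<Rightarrow>
    'p symmat set \<Rightarrow> 'p symmat \<Rightarrow> 'p symmat \<Rightarrow> 'p symmat \<Rightarrow> bool" where
  "SOSC_D Q A P W x s z \<longleftrightarrow>
     (\<forall>(ds, dy, dw, dz) \<in> crit_D Q A P W x s z. (ds, dy, dw, dz) \<noteq> 0 \<longrightarrow>
        inner (Q dw) dw + 2 * curv_form x s ds > 0)"

definition SRCQ_P :: "('p::finite, 'm::finite) lin_map \<Rightarrow> 'p symmat set \<Rightarrow>
    'p symmat \<Rightarrow> 'p symmat \<Rightarrow> 'p symmat \<Rightarrow> bool" where
  "SRCQ_P A P x s z \<longleftrightarrow>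
     {(A d, d) - (0, e) | d e.
        d \<in> tangent_cone psd_cone x \<inter> perp s \<and> e \<in> tangent_cone P x \<inter> perp z} = UNIV"

definition SRCQ_D :: "'p::finite lin_op \<Rightarrow> ('p, 'm::finite) lin_map \<Rightarrow> 'p symmat set \<Rightarrow>
    'p symmat set \<Rightarrow> 'p symmat \<Rightarrow> 'p symmat \<Rightarrow> 'p symmat \<Rightarrow> bool" where
  "SRCQ_D Q A P W x s z \<longleftrightarrow>
     {ds + dz + adjoint A y - Q w | ds dz y w.
        ds \<in> tangent_cone psd_cone s \<inter> perp x \<and> dz \<in> S_set P x z \<and> w \<in> W} = UNIV"

end

theory Submission
  imports Defs
begin

text \<open>Write \<open>x\<close>, \<open>s\<close>, \<open>z\<close> for the primal point and the two multipliers, \<open>C\<^sub>x\<close> and \<open>C\<^sub>s\<close> for the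
  critical cones of the semidefinite cone at \<open>x\<close> with respect to \<open>s\<close> and conversely, and \<open>K\<close> for
  the critical cone of the polyhedron at \<open>x\<close>. The set \<open>S_set\<close> of the dual problem is the dual cone
  \<open>K\<^sup>*\<close> (\<open>S_set_eq_dual_cone\<close>).

  Because \<open>Q\<close> is positive semidefinite and the curvature term is nonnegative, a second-order
  condition can only fail along a direction on which both terms vanish. For the primal condition
  such a direction is a nonzero \<open>d\<close> in \<open>K\<close> with \<open>A d = 0\<close>, \<open>Q d = 0\<close> and \<open>d \<in> C\<^sub>s\<^sup>*\<close>: on \<open>C\<^sub>x\<close>, zero
  curvature means exactly membership in the dual of the opposite critical cone
  (\<open>curv_form_zero_iff\<close>, \<open>tangent_pair_zero_iff\<close>). By separation, the same \<open>d\<close> is a normal that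
  witnesses the failure of the dual strict Robinson condition. So the primal second-order condition
  is equivalent to the dual constraint qualification, and symmetrically the dual second-order
  condition to the primal constraint qualification. The four conditions thus amount to two
  conditions, \<open>primal_nondegenerate\<close> and \<open>dual_nondegenerate\<close>, and each of the pairs (i), (ii), (vii)
  and (viii) contains one of each kind.

  For the four mappings, isolated calmness of the inverse is equivalent to the triviality of the
  kernel of the directional derivative (\<open>isolated_calm_inverse_map_iff\<close>), which requires the
  derivatives of the projections. For the polyhedron and for the epigraph of its support function
  the projection is locally a translate of the projection onto the critical cone, the essential
  point being that a normal to a finitely generated cone is stable under small perturbations
  (\<open>dual_cone_perturbation\<close>). For the semidefinite cone the derivative is found without eigenvalue
  perturbation theory: accumulation points of the difference quotients satisfy a linearised
  complementarity system (\<open>lin_compl_limit\<close>), and this system has at most one solution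
  (\<open>lin_compl_unique\<close>). All four kernels reduce to the same system, whose triviality is
  \<open>trivial_kernel\<close>. Pairing its first equation with \<open>dx\<close> gives
  \<open>\<langle>Q dx, dx\<rangle> = - 2 \<cdot> curvature\<close> (\<open>tangent_pair_inner\<close>), so both sides vanish and the system
  decouples into the primal and the dual nondegeneracy condition (\<open>trivial_kernel_iff\<close>).\<close>

section \<open>Closed convex cones and their duals\<close>

definition closed_convex_cone :: "'a::euclidean_space set \<Rightarrow> bool" where
  "closed_convex_cone K \<longleftrightarrow> closed K \<and> convex K \<and> conic K \<and> K \<noteq> {}"

definition dual_cone :: "'a::real_inner set \<Rightarrow> 'a set" where
  "dual_cone K = {h. \<forall>k\<in>K. 0 \<le> inner h k}"

lemma dual_coneI: "(\<And>k. k \<in> K \<Longrightarrow> 0 \<le> inner h k) \<Longrightarrow> h \<in> dual_cone K"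
  by (simp add: dual_cone_def)

lemma dual_coneD: "h \<in> dual_cone K \<Longrightarrow> k \<in> K \<Longrightarrow> 0 \<le> inner h k"
  by (simp add: dual_cone_def)

lemma closed_convex_cone_zero: "closed_convex_cone K \<Longrightarrow> 0 \<in> K"
  unfolding closed_convex_cone_def using conic_contains_0 by blast

lemma closed_convex_cone_scale:
  "closed_convex_cone K \<Longrightarrow> k \<in> K \<Longrightarrow> 0 \<le> r \<Longrightarrow> r *\<^sub>R k \<in> K"
  unfolding closed_convex_cone_def conic_def by blast

lemma closed_convex_cone_add:
  assumes K: "closed_convex_cone K" and "k \<in> K" "l \<in> K"
  shows "k + l \<in> K"
proof -
  have "(1/2) *\<^sub>R k + (1/2) *\<^sub>R l \<in> K"
    using assms convexD[of K k l "1/2" "1/2"] unfolding closed_convex_cone_def by simp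
  from closed_convex_cone_scale[OF K this, of 2] show ?thesis
    by (simp add: scaleR_add_right)
qed

lemma closed_convex_coneI:
  assumes "closed K" "0 \<in> K" "\<And>k l. k \<in> K \<Longrightarrow> l \<in> K \<Longrightarrow> k + l \<in> K"
    "\<And>r k. 0 \<le> r \<Longrightarrow> k \<in> K \<Longrightarrow> r *\<^sub>R k \<in> K"
  shows "closed_convex_cone K"
  unfolding closed_convex_cone_def conic_def convex_def using assms by blast

lemma closed_convex_cone_Int:
  assumes "closed_convex_cone K" "closed_convex_cone L"
  shows "closed_convex_cone (K \<inter> L)"
  using assms
  by (intro closed_convex_coneI)
    (auto intro: closed_convex_cone_add closed_convex_cone_scale closed_convex_cone_zero
      simp: closed_convex_cone_def)

lemma closed_convex_cone_perp: "closed_convex_cone (perp v)"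
proof (rule closed_convex_coneI)
  have "perp v = {d. inner v d = 0}"
    by (auto simp: perp_def inner_commute)
  then show "closed (perp v)"
    by (simp add: closed_hyperplane)
qed (auto simp: perp_def inner_add_left)

lemma closed_convex_cone_dual_cone: "closed_convex_cone (dual_cone K)"
proof (rule closed_convex_coneI)
  have "dual_cone K = (\<Inter>k\<in>K. {h. inner k h \<ge> 0})"
    by (auto simp: dual_cone_def inner_commute)
  then show "closed (dual_cone K)"
    by (auto intro!: closed_INT closed_halfspace_ge)
qed (auto simp: dual_cone_def inner_add_left)

text \<open>The variational inequality that characterises the metric projection.\<close>

lemma closest_point_add_eq_iff:
  fixes a b :: "'a::euclidean_space"
  assumes "closed C" "convex C" "C \<noteq> {}"
  shows "closest_point C (a + b) = a \<longleftrightarrow> a \<in> C \<and> (\<forall>p\<in>C. inner b (p - a) \<le> 0)"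
proof
  assume eq: "closest_point C (a + b) = a"
  then have "a \<in> C"
    using closest_point_in_set[OF assms(1,3), of "a + b"] by simp
  moreover have "inner b (p - a) \<le> 0" if "p \<in> C" for p
    using closest_point_dot[OF assms(2,1) that, of "a + b"] eq by simp
  ultimately show "a \<in> C \<and> (\<forall>p\<in>C. inner b (p - a) \<le> 0)"
    by blast
next
  assume *: "a \<in> C \<and> (\<forall>p\<in>C. inner b (p - a) \<le> 0)"
  have "dist (a + b) a \<le> dist (a + b) p" if "p \<in> C" for p
  proof -
    have "inner b (p - a) \<le> 0"
      using * that by blast
    then have "(norm b)\<^sup>2 \<le> (norm (b - (p - a)))\<^sup>2"
      by (simp add: power2_norm_eq_inner inner_diff_left inner_diff_right inner_commute
          add_increasing2)
        (smt (verit) inner_ge_zero inner_diff_left inner_diff_right inner_commute)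
    then have "norm b \<le> norm (b - (p - a))"
      by (rule power2_le_imp_le) simp
    then show ?thesis
      by (simp add: dist_norm algebra_simps)
  qed
  then show "closest_point C (a + b) = a"
    using closest_point_unique[OF assms(2,1)] * by metis
qed

text \<open>On a cone the variational inequality becomes a complementarity condition: rescaling the
  test point splits it into polarity and orthogonality.\<close>

lemma closest_point_cone_iff:
  assumes K: "closed_convex_cone K"
  shows "closest_point K (a + b) = a \<longleftrightarrow> a \<in> K \<and> - b \<in> dual_cone K \<and> inner a b = 0"
proof -
  have "(\<forall>p\<in>K. inner b (p - a) \<le> 0) \<longleftrightarrow> - b \<in> dual_cone K \<and> inner a b = 0" if a: "a \<in> K"
  proof
    assume *: "\<forall>p\<in>K. inner b (p - a) \<le> 0"
    have "inner b (0 - a) \<le> 0" "inner b (2 *\<^sub>R a - a) \<le> 0"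
      using * closed_convex_cone_zero[OF K] closed_convex_cone_scale[OF K a, of 2]
      by (simp_all del: diff_0)
    moreover have "2 *\<^sub>R a - a = a"
      by (simp add: scaleR_2)
    ultimately have ab: "inner a b = 0"
      by (simp add: inner_diff_right inner_commute)
    have "inner b p \<le> 0" if "p \<in> K" for p
      using *[rule_format, OF that] ab by (simp add: inner_diff_right inner_commute)
    then show "- b \<in> dual_cone K \<and> inner a b = 0"
      using ab by (auto simp: dual_cone_def)
  next
    assume "- b \<in> dual_cone K \<and> inner a b = 0"
    then show "\<forall>p\<in>K. inner b (p - a) \<le> 0"
      by (auto simp: dual_cone_def inner_diff_right inner_commute)
  qed
  then show ?thesis
    using K closest_point_add_eq_iff[of K a b] unfolding closed_convex_cone_def by blast
qed

lemma closest_point_cone: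
  assumes K: "closed_convex_cone K"
  shows "closest_point K h \<in> K" "closest_point K h - h \<in> dual_cone K"
    "inner (closest_point K h) (h - closest_point K h) = 0"
proof -
  have "closest_point K (closest_point K h + (h - closest_point K h)) = closest_point K h"
    by simp
  then show "closest_point K h \<in> K" "closest_point K h - h \<in> dual_cone K"
    "inner (closest_point K h) (h - closest_point K h) = 0"
    unfolding closest_point_cone_iff[OF K] by simp_all
qed

lemma closest_point_cone_norm:
  assumes K: "closed_convex_cone K"
  shows "norm (closest_point K h) \<le> norm h" "norm (h - closest_point K h) \<le> norm h"
proof -
  define k where "k = closest_point K h"
  have "inner k (h - k) = 0"
    using closest_point_cone[OF K, of h] k_def by blast
  then have "(norm h)\<^sup>2 = (norm k)\<^sup>2 + (norm (h - k))\<^sup>2"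
    by (simp add: power2_norm_eq_inner inner_diff_left inner_diff_right inner_commute)
  then have "(norm k)\<^sup>2 \<le> (norm h)\<^sup>2" "(norm (h - k))\<^sup>2 \<le> (norm h)\<^sup>2"
    by simp_all
  then show "norm (closest_point K h) \<le> norm h" "norm (h - closest_point K h) \<le> norm h"
    unfolding k_def using power2_le_imp_le norm_ge_zero by blast+
qed

lemma closest_point_cone_scale:
  assumes K: "closed_convex_cone K" and r: "0 \<le> r"
  shows "closest_point K (r *\<^sub>R h) = r *\<^sub>R closest_point K h"
proof -
  define k where "k = closest_point K h"
  have k: "k \<in> K" "k - h \<in> dual_cone K" "inner k (h - k) = 0"
    using closest_point_cone[OF K, of h] k_def by blast+
  have "- (r *\<^sub>R (h - k)) = r *\<^sub>R (k - h)"
    by (simp add: algebra_simps)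
  then have "closest_point K (r *\<^sub>R k + r *\<^sub>R (h - k)) = r *\<^sub>R k"
    unfolding closest_point_cone_iff[OF K]
    using k closed_convex_cone_scale[OF K k(1) r]
      closed_convex_cone_scale[OF closed_convex_cone_dual_cone k(2) r]
    by simp
  then show ?thesis
    by (simp add: k_def scaleR_diff_right)
qed

text \<open>The residual of the projection of \<open>h\<close> onto the cone is, up to sign, an element of the dual cone;
  tested against it, a bidual \<open>h\<close> has residual zero.\<close>

lemma bipolar:
  assumes K: "closed_convex_cone K"
  shows "dual_cone (dual_cone K) = K"
proof
  show "K \<subseteq> dual_cone (dual_cone K)"
    by (auto simp: dual_cone_def inner_commute)
  show "dual_cone (dual_cone K) \<subseteq> K"
  proof
    fix h assume h: "h \<in> dual_cone (dual_cone K)"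
    define k where "k = closest_point K h"
    have k: "k \<in> K" "k - h \<in> dual_cone K" "inner k (h - k) = 0"
      using closest_point_cone[OF K, of h] k_def by blast+
    have "0 \<le> inner h (k - h)"
      using dual_coneD[OF h k(2)] .
    then have "inner (h - k) (h - k) \<le> 0"
      using k(3) by (simp add: inner_diff_left inner_diff_right inner_commute)
    then have "h - k = 0"
      using inner_ge_zero[of "h - k"] inner_eq_zero_iff[of "h - k"] by linarith
    then show "h \<in> K"
      using k(1) by simp
  qed
qed

text \<open>A convex cone that misses a point is separated from it; this turns both strict Robinson
  conditions into statements about the kernel of a dual system.\<close>

lemma convex_cone_UNIV_iff:
  fixes M :: "'a::euclidean_space set"
  assumes "0 \<in> M" "\<And>m n. m \<in> M \<Longrightarrow> n \<in> M \<Longrightarrow> m + n \<in> M"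
    and scale: "\<And>r m. 0 \<le> r \<Longrightarrow> m \<in> M \<Longrightarrow> r *\<^sub>R m \<in> M"
  shows "M = UNIV \<longleftrightarrow> (\<forall>h\<in>dual_cone M. h = 0)"
proof
  assume M: "M = UNIV"
  show "\<forall>h\<in>dual_cone M. h = 0"
  proof
    fix h assume "h \<in> dual_cone M"
    then have "0 \<le> inner h (- h)"
      by (rule dual_coneD) (simp add: M)
    then have "inner h h \<le> 0"
      by simp
    then show "h = 0"
      using inner_ge_zero[of h] inner_eq_zero_iff[of h] by linarith
  qed
next
  assume *: "\<forall>h\<in>dual_cone M. h = 0"
  show "M = UNIV"
  proof (rule ccontr)
    assume "M \<noteq> UNIV"
    then obtain p where "p \<notin> M" by blast
    moreover have "convex M" "M \<noteq> {}"
      unfolding convex_def using assms by blast+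
    ultimately obtain h \<beta> where h: "h \<noteq> 0" "inner h p \<le> \<beta>" "\<And>m. m \<in> M \<Longrightarrow> \<beta> \<le> inner h m"
      using separating_hyperplane_sets[of "{p}" M] by auto
    have "0 \<le> inner h m" if "m \<in> M" for m
    proof (rule ccontr)
      assume neg: "\<not> 0 \<le> inner h m"
      \<comment> \<open>Far enough along the ray through \<^term>\<open>m\<close> the lower bound \<^term>\<open>\<beta>\<close> fails.\<close>
      define r where "r = (\<bar>\<beta>\<bar> + 1) / - inner h m"
      have "r \<ge> 0"
        unfolding r_def using neg by (intro divide_nonneg_pos) auto
      then have "r *\<^sub>R m \<in> M"
        using scale that by blast
      then have "\<beta> \<le> inner h (r *\<^sub>R m)"
        by (rule h(3))
      moreover have "inner h (r *\<^sub>R m) = - (\<bar>\<beta>\<bar> + 1)"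
        using neg by (simp add: r_def field_simps)
      ultimately show False by linarith
    qed
    then show False
      using * h(1) by (auto simp: dual_cone_def)
  qed
qed

section \<open>Directional differentiability and isolated calmness\<close>

text \<open>In finite dimensions a Lipschitz map with one-sided directional derivatives is
  differentiable in the sense of Bouligand; the derivative need not be linear.\<close>

definition B_differentiable ::
  "('a::real_normed_vector \<Rightarrow> 'b::real_normed_vector) \<Rightarrow> ('a \<Rightarrow> 'b) \<Rightarrow> 'a \<Rightarrow> bool" where
  "B_differentiable f f' a \<longleftrightarrow>
     (\<exists>L\<ge>0. \<forall>p q. norm (f p - f q) \<le> L * norm (p - q)) \<and>
     (\<forall>h. ((\<lambda>t. (f (a + t *\<^sub>R h) - f a) /\<^sub>R t) \<longlongrightarrow> f' h) (at_right 0))"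

lemma B_differentiable_lipschitz:
  assumes "B_differentiable f f' a"
  obtains L where "L \<ge> 0" "\<And>p q. norm (f p - f q) \<le> L * norm (p - q)"
  using assms unfolding B_differentiable_def by blast

lemma B_differentiable_tendsto:
  "B_differentiable f f' a \<Longrightarrow> ((\<lambda>t. (f (a + t *\<^sub>R h) - f a) /\<^sub>R t) \<longlongrightarrow> f' h) (at_right 0)"
  unfolding B_differentiable_def by blast

lemma B_differentiable_const: "B_differentiable (\<lambda>_. k) (\<lambda>_. 0) a"
  unfolding B_differentiable_def by (auto intro!: exI[of _ 0])

lemma B_differentiable_bounded_linear:
  assumes "bounded_linear g"
  shows "B_differentiable g g a"
proof -
  interpret bounded_linear g by fact
  obtain L where "L \<ge> 0" "\<And>p. norm (g p) \<le> norm p * L"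
    using nonneg_bounded by blast
  then have "norm (g p - g q) \<le> L * norm (p - q)" for p q
    by (metis diff mult.commute)
  moreover have "((\<lambda>t. (g (a + t *\<^sub>R h) - g a) /\<^sub>R t) \<longlongrightarrow> g h) (at_right 0)" for h
    by (rule tendsto_eventually, rule eventually_at_right_less[THEN eventually_mono])
      (simp add: add scaleR)
  ultimately show ?thesis
    unfolding B_differentiable_def using \<open>L \<ge> 0\<close> by blast
qed

lemma B_differentiable_add:
  assumes f: "B_differentiable f f' a" and g: "B_differentiable g g' a"
  shows "B_differentiable (\<lambda>p. f p + g p) (\<lambda>h. f' h + g' h) a"
proof -
  obtain L where L: "L \<ge> 0" "\<And>p q. norm (f p - f q) \<le> L * norm (p - q)"
    using B_differentiable_lipschitz[OF f] by blast
  obtain M where M: "M \<ge> 0" "\<And>p q. norm (g p - g q) \<le> M * norm (p - q)"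
    using B_differentiable_lipschitz[OF g] by blast
  have "norm (f p + g p - (f q + g q)) \<le> (L + M) * norm (p - q)" for p q
  proof -
    have "norm (f p + g p - (f q + g q)) \<le> norm (f p - f q) + norm (g p - g q)"
      by (metis add_diff_add norm_triangle_ineq)
    also have "\<dots> \<le> (L + M) * norm (p - q)"
      using L(2)[of p q] M(2)[of p q] by (simp add: distrib_right)
    finally show ?thesis .
  qed
  moreover have "((\<lambda>t. (f (a + t *\<^sub>R h) + g (a + t *\<^sub>R h) - (f a + g a)) /\<^sub>R t) \<longlongrightarrow> f' h + g' h)
      (at_right 0)" for h
    using tendsto_add[OF B_differentiable_tendsto[OF f, of h] B_differentiable_tendsto[OF g, of h]]
    by (simp add: scaleR_add_right scaleR_diff_right algebra_simps)
  ultimately show ?thesis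
    unfolding B_differentiable_def using L(1) M(1) by (intro conjI exI[of _ "L + M"]) auto
qed

lemma B_differentiable_Pair:
  assumes f: "B_differentiable f f' a" and g: "B_differentiable g g' a"
  shows "B_differentiable (\<lambda>p. (f p, g p)) (\<lambda>h. (f' h, g' h)) a"
proof -
  obtain L where L: "L \<ge> 0" "\<And>p q. norm (f p - f q) \<le> L * norm (p - q)"
    using B_differentiable_lipschitz[OF f] by blast
  obtain M where M: "M \<ge> 0" "\<And>p q. norm (g p - g q) \<le> M * norm (p - q)"
    using B_differentiable_lipschitz[OF g] by blast
  have "norm ((f p, g p) - (f q, g q)) \<le> (L + M) * norm (p - q)" for p q
  proof -
    have "norm ((f p, g p) - (f q, g q)) \<le> norm (f p - f q) + norm (g p - g q)"
      by (simp add: norm_Pair_le)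
    also have "\<dots> \<le> (L + M) * norm (p - q)"
      using L(2)[of p q] M(2)[of p q] by (simp add: distrib_right)
    finally show ?thesis .
  qed
  moreover have "((\<lambda>t. ((f (a + t *\<^sub>R h), g (a + t *\<^sub>R h)) - (f a, g a)) /\<^sub>R t) \<longlongrightarrow> (f' h, g' h))
      (at_right 0)" for h
    using tendsto_Pair[OF B_differentiable_tendsto[OF f, of h] B_differentiable_tendsto[OF g, of h]]
    by simp
  ultimately show ?thesis
    unfolding B_differentiable_def using L(1) M(1) by (intro conjI exI[of _ "L + M"]) auto
qed

text \<open>The inner map may be replaced by its first-order model along a ray, because the outer map
  is Lipschitz.\<close>

lemma B_differentiable_compose:
  assumes f: "B_differentiable f f' (g a)" and g: "B_differentiable g g' a"
  shows "B_differentiable (\<lambda>p. f (g p)) (\<lambda>h. f' (g' h)) a"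
proof -
  obtain L where L: "L \<ge> 0" "\<And>p q. norm (f p - f q) \<le> L * norm (p - q)"
    using B_differentiable_lipschitz[OF f] by blast
  obtain M where M: "M \<ge> 0" "\<And>p q. norm (g p - g q) \<le> M * norm (p - q)"
    using B_differentiable_lipschitz[OF g] by blast
  have "norm (f (g p) - f (g q)) \<le> (L * M) * norm (p - q)" for p q
    using L(2)[of "g p" "g q"] mult_left_mono[OF M(2)[of p q] L(1)] by simp
  moreover have "((\<lambda>t. (f (g (a + t *\<^sub>R h)) - f (g a)) /\<^sub>R t) \<longlongrightarrow> f' (g' h)) (at_right 0)" for h
  proof -
    let ?r = "\<lambda>t. (f (g (a + t *\<^sub>R h)) - f (g a + t *\<^sub>R g' h)) /\<^sub>R t"
    have "((\<lambda>t. L * norm ((g (a + t *\<^sub>R h) - g a) /\<^sub>R t - g' h)) \<longlongrightarrow> L * norm (g' h - g' h))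
        (at_right 0)"
      by (intro tendsto_intros B_differentiable_tendsto[OF g])
    then have bound: "((\<lambda>t. L * norm ((g (a + t *\<^sub>R h) - g a) /\<^sub>R t - g' h)) \<longlongrightarrow> 0) (at_right 0)"
      by simp
    have "(?r \<longlongrightarrow> 0) (at_right 0)"
    proof (rule Lim_null_comparison[OF _ bound], rule eventually_at_right_less[THEN eventually_mono])
      fix t :: real assume t: "0 < t"
      have "norm (?r t) \<le> (L * norm (g (a + t *\<^sub>R h) - (g a + t *\<^sub>R g' h))) / t"
        using L(2)[of "g (a + t *\<^sub>R h)" "g a + t *\<^sub>R g' h"] t
        by (simp add: divide_simps mult.commute)
      also have "g (a + t *\<^sub>R h) - (g a + t *\<^sub>R g' h) = t *\<^sub>R ((g (a + t *\<^sub>R h) - g a) /\<^sub>R t - g' h)"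
        using t by (simp add: scaleR_diff_right)
      finally show "norm (?r t) \<le> L * norm ((g (a + t *\<^sub>R h) - g a) /\<^sub>R t - g' h)"
        using t by simp
    qed
    from tendsto_add[OF this B_differentiable_tendsto[OF f, of "g' h"]] show ?thesis
      by (simp add: scaleR_diff_right algebra_simps)
  qed
  ultimately show ?thesis
    unfolding B_differentiable_def using L(1) M(1) by (intro conjI exI[of _ "L * M"]) auto
qed

lemma B_differentiable_minus:
  assumes "B_differentiable f f' a"
  shows "B_differentiable (\<lambda>p. - f p) (\<lambda>h. - f' h) a"
  by (rule B_differentiable_compose[OF B_differentiable_bounded_linear assms])
    (rule bounded_linear_minus[OF bounded_linear_ident])

lemma B_differentiable_diff:
  assumes "B_differentiable f f' a" "B_differentiable g g' a"
  shows "B_differentiable (\<lambda>p. f p - g p) (\<lambda>h. f' h - g' h) a"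
  using B_differentiable_add[OF assms(1) B_differentiable_minus[OF assms(2)]] by simp

lemma B_differentiable_linear:
  fixes l :: "'b::euclidean_space \<Rightarrow> 'c::real_normed_vector"
  assumes "linear l" "B_differentiable f f' a"
  shows "B_differentiable (\<lambda>p. l (f p)) (\<lambda>h. l (f' h)) a"
  by (rule B_differentiable_compose[OF B_differentiable_bounded_linear assms(2)])
    (rule linear_conv_bounded_linear[THEN iffD1, OF assms(1)])

lemma B_differentiable_id: "B_differentiable (\<lambda>p. p) (\<lambda>h. h) a"
  by (rule B_differentiable_bounded_linear[OF bounded_linear_ident])

lemma B_differentiable_fst:
  "B_differentiable f f' a \<Longrightarrow> B_differentiable (\<lambda>p. fst (f p)) (\<lambda>h. fst (f' h)) a"
  by (rule B_differentiable_compose[OF B_differentiable_bounded_linear[OF bounded_linear_fst]])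

lemma B_differentiable_snd:
  "B_differentiable f f' a \<Longrightarrow> B_differentiable (\<lambda>p. snd (f p)) (\<lambda>h. snd (f' h)) a"
  by (rule B_differentiable_compose[OF B_differentiable_bounded_linear[OF bounded_linear_snd]])

lemma closest_point_lipschitz_norm:
  fixes C :: "'a::euclidean_space set"
  assumes "closed C" "convex C" "C \<noteq> {}"
  shows "norm (closest_point C p - closest_point C q) \<le> 1 * norm (p - q)"
  using closest_point_lipschitz[OF assms(2,1,3), of p q] by (simp add: dist_norm)

text \<open>The projection onto a cone is positively homogeneous, so the difference quotients are constant
  for small steps.\<close>

lemma B_differentiable_closest_point_conical:
  fixes C :: "'a::euclidean_space set"
  assumes C: "closed C" "convex C" "C \<noteq> {}" and K: "closed_convex_cone K"
    and \<epsilon>: "\<epsilon> > 0"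
    and loc: "\<And>h. norm h < \<epsilon> \<Longrightarrow> closest_point C (a + h) = closest_point C a + closest_point K h"
  shows "B_differentiable (closest_point C) (closest_point K) a"
proof -
  have "((\<lambda>t. (closest_point C (a + t *\<^sub>R h) - closest_point C a) /\<^sub>R t) \<longlongrightarrow> closest_point K h)
      (at_right 0)" for h
  proof (rule tendsto_eventually)
    have "((\<lambda>t. norm (t *\<^sub>R h)) \<longlongrightarrow> norm (0 *\<^sub>R h)) (at_right (0::real))"
      by (intro tendsto_intros)
    then have "\<forall>\<^sub>F t in at_right 0. norm (t *\<^sub>R h) < \<epsilon>"
      by (rule order_tendstoD(2)) (simp add: \<epsilon>)
    then show "\<forall>\<^sub>F t in at_right 0.
        (closest_point C (a + t *\<^sub>R h) - closest_point C a) /\<^sub>R t = closest_point K h"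
      using eventually_at_right_less
      by (rule eventually_elim2) (simp add: loc closest_point_cone_scale[OF K])
  qed
  then show ?thesis
    unfolding B_differentiable_def using closest_point_lipschitz_norm[OF C]
    by (intro conjI exI[of _ "1::real"]) auto
qed

text \<open>Isolated calmness of an inverse is equivalent to the triviality of the kernel of the
  derivative. A kernel direction is a curve on which \<^term>\<open>F\<close> is of smaller order than the
  argument; conversely, a failure of calmness gives points whose normalised displacements
  accumulate, by compactness of the sphere, at a kernel direction. Restricting the domain to a
  subspace restricts the directions to that subspace.\<close>

lemma isolated_calm_inverse_map_iff:
  fixes F :: "'a::euclidean_space \<Rightarrow> 'b::real_normed_vector"
  assumes F: "B_differentiable F F' a" and D: "subspace D" and aD: "a \<in> D" and Fa: "F a = 0"
  shows "isolated_calm (inverse_map D F) 0 a \<longleftrightarrow> (\<forall>h\<in>D. F' h = 0 \<longrightarrow> h = 0)"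
proof
  assume "isolated_calm (inverse_map D F) 0 a"
  then obtain \<kappa> V W where kVW: "\<kappa> > 0" "open V" "0 \<in> V" "open W" "a \<in> W"
    and sub: "\<forall>p\<in>V. inverse_map D F p \<inter> W \<subseteq> {q. norm (q - a) \<le> \<kappa> * norm (p - 0)}"
    unfolding isolated_calm_def by blast
  have calm: "norm (q - a) \<le> \<kappa> * norm (F q)" if "F q \<in> V" "q \<in> W" "q \<in> D" for q
  proof -
    have "q \<in> inverse_map D F (F q) \<inter> W"
      using that by (simp add: inverse_map_def)
    then show ?thesis
      using subsetD[OF bspec[OF sub that(1)]] by simp
  qed
  show "\<forall>h\<in>D. F' h = 0 \<longrightarrow> h = 0"
  proof (intro ballI impI)
    fix h assume h: "h \<in> D" "F' h = 0"
    have lim: "((\<lambda>t. F (a + t *\<^sub>R h) /\<^sub>R t) \<longlongrightarrow> 0) (at_right 0)"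
      using B_differentiable_tendsto[OF F, of h] Fa h(2) by simp
    have "((\<lambda>t. t *\<^sub>R (F (a + t *\<^sub>R h) /\<^sub>R t)) \<longlongrightarrow> 0 *\<^sub>R 0) (at_right 0)"
      by (intro tendsto_intros lim)
    then have "((\<lambda>t. t *\<^sub>R (F (a + t *\<^sub>R h) /\<^sub>R t)) \<longlongrightarrow> 0) (at_right 0)"
      by simp
    from topological_tendstoD[OF this kVW(2,3)] have
      evV: "\<forall>\<^sub>F t in at_right 0. t *\<^sub>R (F (a + t *\<^sub>R h) /\<^sub>R t) \<in> V" .
    have "((\<lambda>t. a + t *\<^sub>R h) \<longlongrightarrow> a + 0 *\<^sub>R h) (at_right 0)"
      by (intro tendsto_intros)
    then have evW: "\<forall>\<^sub>F t in at_right 0. a + t *\<^sub>R h \<in> W"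
      using kVW(4,5) by (auto dest: topological_tendstoD)
    have "\<forall>\<^sub>F t in at_right 0. norm h \<le> \<kappa> * norm (F (a + t *\<^sub>R h) /\<^sub>R t)"
      using evV evW eventually_at_right_less[of "0::real"]
    proof eventually_elim
      case (elim t)
      have "a + t *\<^sub>R h \<in> D"
        using D aD h(1) by (simp add: subspace_add subspace_scale)
      then have "norm (t *\<^sub>R h) \<le> \<kappa> * norm (F (a + t *\<^sub>R h))"
        using calm[of "a + t *\<^sub>R h"] elim by simp
      then show ?case
        using elim by (simp add: field_simps)
    qed
    moreover have "((\<lambda>t. \<kappa> * norm (F (a + t *\<^sub>R h) /\<^sub>R t)) \<longlongrightarrow> \<kappa> * norm (0::'b)) (at_right 0)"
      by (intro tendsto_intros lim)
    ultimately have "norm h \<le> \<kappa> * norm (0::'b)"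
      by (intro tendsto_lowerbound[of _ _ "at_right (0::real)"]) auto
    then show "h = 0"
      by simp
  qed
next
  assume ker: "\<forall>h\<in>D. F' h = 0 \<longrightarrow> h = 0"
  obtain L where L: "L \<ge> 0" "\<And>p q. norm (F p - F q) \<le> L * norm (p - q)"
    using B_differentiable_lipschitz[OF F] by blast
  have "\<exists>\<kappa>>0. \<exists>\<delta>>0. \<forall>q\<in>D. norm (q - a) < \<delta> \<longrightarrow> norm (q - a) \<le> \<kappa> * norm (F q)"
  proof (rule ccontr)
    assume contra: "\<not> ?thesis"
    have "\<exists>q\<in>D. norm (q - a) < 1 / (real n + 1) \<and> real (n + 1) * norm (F q) < norm (q - a)" for n
    proof -
      have "\<not> (\<forall>q\<in>D. norm (q - a) < 1 / (real n + 1) \<longrightarrow> norm (q - a) \<le> real (n + 1) * norm (F q))"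
        using contra by (metis of_nat_0_less_iff zero_less_Suc Suc_eq_plus1 of_nat_Suc
            add.commute zero_less_divide_1_iff)
      then show ?thesis
        by (auto simp: not_le)
    qed
    then obtain q where q: "\<And>n. q n \<in> D" "\<And>n. norm (q n - a) < 1 / (real n + 1)"
      "\<And>n. real (n + 1) * norm (F (q n)) < norm (q n - a)"
      by metis
    define t where "t n = norm (q n - a)" for n
    define d where "d n = (q n - a) /\<^sub>R t n" for n
    have tpos: "t n > 0" for n
      using q(3)[of n] unfolding t_def
      by (smt (verit) mult_nonneg_nonneg norm_ge_zero of_nat_0_le_iff)
    have qn: "q n = a + t n *\<^sub>R d n" for n
      using tpos[of n] by (simp add: d_def)
    have "d n \<in> sphere 0 1" for n
      using tpos[of n] by (simp add: d_def t_def)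
    then obtain e r where e: "e \<in> sphere 0 1" "strict_mono r" "(d \<circ> r) \<longlonglongrightarrow> e"
      using compact_sphere[of "0::'a" 1] unfolding compact_def by metis
    have "d n \<in> D" for n
      using q(1)[of n] aD D by (simp add: d_def subspace_diff subspace_scale)
    then have eD: "e \<in> D"
      using closed_sequentially[OF closed_subspace[OF D], of "d \<circ> r" e] e(3) by simp
    have "(\<lambda>n. 1 / (real n + 1)) \<longlonglongrightarrow> 0"
      using LIMSEQ_inverse_real_of_nat by (simp add: inverse_eq_divide add.commute)
    then have t0: "t \<longlonglongrightarrow> 0"
      by (rule tendsto_sandwich[OF _ _ tendsto_const, rotated 2])
        (use q(2) tpos in \<open>auto intro!: always_eventually simp: t_def less_imp_le\<close>)
    have F0: "(\<lambda>n. F (q n) /\<^sub>R t n) \<longlonglongrightarrow> 0"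
    proof (rule Lim_null_comparison[OF _ \<open>(\<lambda>n. 1 / (real n + 1)) \<longlonglongrightarrow> 0\<close>],
        rule always_eventually, rule allI)
      fix n
      show "norm (F (q n) /\<^sub>R t n) \<le> 1 / (real n + 1)"
        using q(3)[of n] tpos[of n] by (simp add: t_def field_simps)
    qed
    have "t (r n) \<noteq> 0" for n
      using tpos[of "r n"] by simp
    then have tr: "filterlim (t \<circ> r) (at_right 0) sequentially"
      unfolding filterlim_at using LIMSEQ_subseq_LIMSEQ[OF t0 e(2)] tpos by simp
    have A: "(\<lambda>n. (F (a + t (r n) *\<^sub>R e) - F a) /\<^sub>R t (r n)) \<longlonglongrightarrow> F' e"
      using filterlim_compose[OF B_differentiable_tendsto[OF F, of e] tr] by simp
    have B: "(\<lambda>n. (F (a + t (r n) *\<^sub>R e) - F (q (r n))) /\<^sub>R t (r n)) \<longlonglongrightarrow> 0"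
    proof (rule Lim_null_comparison)
      have "(\<lambda>n. L * norm (e - (d \<circ> r) n)) \<longlonglongrightarrow> L * norm (e - e)"
        by (intro tendsto_intros e(3))
      then show "(\<lambda>n. L * norm (e - d (r n))) \<longlonglongrightarrow> 0"
        by simp
      show "\<forall>\<^sub>F n in sequentially.
          norm ((F (a + t (r n) *\<^sub>R e) - F (q (r n))) /\<^sub>R t (r n)) \<le> L * norm (e - d (r n))"
      proof (rule always_eventually, rule allI)
        fix n
        have "norm (F (a + t (r n) *\<^sub>R e) - F (q (r n))) \<le> L * norm (t (r n) *\<^sub>R (e - d (r n)))"
          using L(2)[of "a + t (r n) *\<^sub>R e" "q (r n)"] by (simp add: qn scaleR_diff_right)
        then have "norm (F (a + t (r n) *\<^sub>R e) - F (q (r n))) \<le> t (r n) * (L * norm (e - d (r n)))"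
          using tpos[of "r n"] by (simp only: norm_scaleR) (simp add: mult.left_commute)
        then show "norm ((F (a + t (r n) *\<^sub>R e) - F (q (r n))) /\<^sub>R t (r n)) \<le> L * norm (e - d (r n))"
          using tpos[of "r n"] by (simp only: norm_scaleR) (simp add: divide_simps mult.commute)
      qed
    qed
    have "(\<lambda>n. F (q (r n)) /\<^sub>R t (r n)) \<longlonglongrightarrow> F' e"
      using tendsto_diff[OF A B] Fa by (simp add: scaleR_diff_right)
    moreover have "(\<lambda>n. F (q (r n)) /\<^sub>R t (r n)) \<longlonglongrightarrow> 0"
      using LIMSEQ_subseq_LIMSEQ[OF F0 e(2)] by (simp add: o_def)
    ultimately have "F' e = 0"
      by (rule LIMSEQ_unique)
    then show False
      using ker eD e(1) by auto
  qed
  then obtain \<kappa> \<delta> where "\<kappa> > 0" "\<delta> > 0"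
    "\<And>q. q \<in> D \<Longrightarrow> norm (q - a) < \<delta> \<Longrightarrow> norm (q - a) \<le> \<kappa> * norm (F q)"
    by blast
  then show "isolated_calm (inverse_map D F) 0 a"
    unfolding isolated_calm_def inverse_map_def using aD Fa
    by (auto intro!: exI[of _ \<kappa>] exI[of _ UNIV] exI[of _ "ball a \<delta>"] simp: dist_norm norm_minus_commute)
qed

section \<open>Polyhedra and their support functions\<close>

lemma closed_convex_cone_tangent_cone:
  fixes C :: "'a::euclidean_space set"
  assumes "convex C" "x \<in> C"
  shows "closed_convex_cone (tangent_cone C x)"
proof -
  let ?S = "(\<lambda>y. y - x) ` C"
  have "convex ?S"
    using convex_translation[OF assms(1), of "- x"] by simp
  then have "convex (closure (conic hull ?S))"
    by (intro convex_closure convex_conic_hull)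
  moreover have "conic (closure (conic hull ?S))"
    by (intro conic_closure conic_conic_hull)
  ultimately show ?thesis
    using assms(2) by (auto simp: closed_convex_cone_def tangent_cone_def conic_hull_eq_empty)
qed

lemma tangent_cone_feasible_direction:
  assumes "x \<in> C" "x + d \<in> C" "0 \<le> r"
  shows "r *\<^sub>R d \<in> tangent_cone C x"
proof -
  have "d \<in> (\<lambda>y. y - x) ` C"
    using assms(2) by (auto intro!: image_eqI[of _ _ "x + d"])
  then have "r *\<^sub>R d \<in> conic hull ((\<lambda>y. y - x) ` C)"
    using assms(3) unfolding conic_hull_explicit by blast
  then show ?thesis
    unfolding tangent_cone_def using assms(1) closure_subset by auto
qed

lemma tangent_cone_subsetI:
  assumes "\<And>p. p \<in> C \<Longrightarrow> p - x \<in> K" "conic K" "closed K"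
  shows "tangent_cone C x \<subseteq> K"
proof -
  have "conic hull ((\<lambda>y. y - x) ` C) \<subseteq> K"
    using assms(1,2) by (intro hull_minimal) auto
  then show ?thesis
    unfolding tangent_cone_def using closure_minimal[OF _ assms(3)] by auto
qed

lemma dual_cone_tangent_cone_iff:
  fixes C :: "'a::euclidean_space set"
  assumes "x \<in> C"
  shows "z \<in> dual_cone (tangent_cone C x) \<longleftrightarrow> (\<forall>p\<in>C. 0 \<le> inner z (p - x))"
proof
  assume z: "z \<in> dual_cone (tangent_cone C x)"
  show "\<forall>p\<in>C. 0 \<le> inner z (p - x)"
    using dual_coneD[OF z] tangent_cone_feasible_direction[OF assms, where r = 1] by auto
next
  assume *: "\<forall>p\<in>C. 0 \<le> inner z (p - x)"
  have "tangent_cone C x \<subseteq> dual_cone {z}"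
    using * closed_convex_cone_dual_cone[of "{z}"]
    by (intro tangent_cone_subsetI) (auto simp: closed_convex_cone_def dual_cone_def inner_commute)
  then show "z \<in> dual_cone (tangent_cone C x)"
    by (auto simp: dual_cone_def inner_commute)
qed

text \<open>Near one of its points a polyhedron coincides with the cone cut out by the active
  constraints, the inactive ones being strict in a neighbourhood. Hence the tangent cone is that
  cone, and no closure is involved.\<close>

lemma polyhedron_tangent_cone:
  fixes P :: "'a::euclidean_space set"
  assumes P: "polyhedron P" and x: "x \<in> P"
  obtains \<epsilon> where "\<epsilon> > 0" "polyhedron (tangent_cone P x)"
    "\<And>d. d \<in> tangent_cone P x \<Longrightarrow> norm d < \<epsilon> \<Longrightarrow> x + d \<in> P"
proof -
  obtain F where F: "finite F" "P = \<Inter>F" "\<forall>h\<in>F. \<exists>a b. a \<noteq> 0 \<and> h = {x. inner a x \<le> b}"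
    using P unfolding polyhedron_def by blast
  then obtain a b where ab: "\<And>h. h \<in> F \<Longrightarrow> h = {x. inner (a h) x \<le> b h}"
    by metis
  define I where "I = {h \<in> F. inner (a h) x = b h}"
  define T where "T = (\<Inter>h\<in>I. {d. inner (a h) d \<le> 0})"
  have polyT: "polyhedron T"
    unfolding T_def I_def using F(1) by (intro polyhedron_Inter) (auto simp: polyhedron_halfspace_le)
  have "conic T"
    by (auto simp: T_def conic_def mult_nonneg_nonpos)
  moreover have xb: "inner (a h) p \<le> b h" if "h \<in> F" "p \<in> P" for h p
    using F(2) ab that by blast
  moreover have "p - x \<in> T" if "p \<in> P" for p
    using xb[OF _ that] by (auto simp: T_def I_def inner_diff_right)
  ultimately have sub: "tangent_cone P x \<subseteq> T"
    by (intro tangent_cone_subsetI) (auto intro: polyhedron_imp_closed polyT)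
  have "\<forall>\<^sub>F d in nhds 0. inner (a h) (x + d) < b h" if h: "h \<in> F - I" for h
  proof (rule order_tendstoD(2))
    show "((\<lambda>d. inner (a h) (x + d)) \<longlongrightarrow> inner (a h) (x + 0)) (nhds 0)"
      by (intro tendsto_intros) (simp add: filterlim_ident)
    show "inner (a h) (x + 0) < b h"
      using h xb[OF _ x, of h] by (auto simp: I_def)
  qed
  then have "\<forall>\<^sub>F d in nhds 0. \<forall>h\<in>F - I. inner (a h) (x + d) < b h"
    using F(1) by (intro eventually_ball_finite) auto
  then obtain \<epsilon> where \<epsilon>: "\<epsilon> > 0"
    "\<And>d h. norm d < \<epsilon> \<Longrightarrow> h \<in> F - I \<Longrightarrow> inner (a h) (x + d) < b h"
    unfolding eventually_nhds_metric by (auto simp: dist_norm)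
  have loc: "x + d \<in> P" if d: "d \<in> T" "norm d < \<epsilon>" for d
  proof -
    have "inner (a h) (x + d) \<le> b h" if "h \<in> F" for h
    proof (cases "h \<in> I")
      case True
      then show ?thesis
        using d(1) by (auto simp: T_def I_def inner_add_right)
    qed (use \<epsilon>(2)[OF d(2)] that in \<open>auto intro: less_imp_le\<close>)
    then show ?thesis
      using F(2) ab by blast
  qed
  have "T \<subseteq> tangent_cone P x"
  proof
    fix d assume d: "d \<in> T"
    define r where "r = \<epsilon> / (2 * (norm d + 1))"
    have r: "r > 0"
      using \<epsilon>(1) by (simp add: r_def add_nonneg_pos)
    have "norm (r *\<^sub>R d) < \<epsilon>"
    proof -
      have "norm (r *\<^sub>R d) = \<epsilon> * (norm d / (2 * (norm d + 1)))"
        using r \<epsilon>(1) unfolding r_def by (simp add: abs_of_pos)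
      also have "\<dots> < \<epsilon> * 1"
        using \<epsilon>(1) norm_ge_zero[of d]
        by (intro mult_strict_left_mono) (simp_all add: divide_simps add_nonneg_pos)
      finally show ?thesis by simp
    qed
    then have "x + r *\<^sub>R d \<in> P"
      using d r \<open>conic T\<close> by (intro loc) (auto simp: conic_def)
    from tangent_cone_feasible_direction[OF x this, of "1 / r"] show "d \<in> tangent_cone P x"
      using r by simp
  qed
  then have "tangent_cone P x = T"
    using sub by blast
  then show thesis
    using that[of \<epsilon>] \<epsilon>(1) polyT loc by simp
qed

text \<open>The intersection with a cube is a polytope, and its finitely many vertices generate the
  cone.\<close>

lemma polyhedral_cone_generators:
  fixes T :: "'a::euclidean_space set"
  assumes "polyhedron T" "conic T"
  obtains V where "finite V" "V \<subseteq> T" "\<And>t. t \<in> T \<Longrightarrow> \<exists>r>0. r *\<^sub>R t \<in> convex hull V"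
proof -
  have "polytope (T \<inter> cbox (- One) One)"
    unfolding polytope_eq_bounded_polyhedron
    using assms(1) by (auto intro: polyhedron_Int polytope_imp_polyhedron polytope_interval
        bounded_Int bounded_cbox)
  then obtain V where V: "finite V" "T \<inter> cbox (- One) One = convex hull V"
    unfolding polytope_def by blast
  have "V \<subseteq> T"
    using V(2) hull_subset[of V convex] by blast
  moreover have "\<exists>r>0. r *\<^sub>R t \<in> convex hull V" if t: "t \<in> T" for t
  proof (intro exI[of _ "1 / (norm t + 1)"] conjI)
    have pos: "norm t + 1 > 0"
      by (simp add: add_nonneg_pos)
    then show "0 < 1 / (norm t + 1)"
      by simp
    have "- 1 \<le> inner t i / (norm t + 1) \<and> inner t i / (norm t + 1) \<le> 1" if "i \<in> Basis" for i
      using Basis_le_norm[OF that, of t] pos by (simp add: divide_simps abs_le_iff)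
    then have "(1 / (norm t + 1)) *\<^sub>R t \<in> cbox (- One) One"
      by (simp add: mem_box)
    moreover have "(1 / (norm t + 1)) *\<^sub>R t \<in> T"
      using assms(2) t pos by (simp add: conic_def)
    ultimately show "(1 / (norm t + 1)) *\<^sub>R t \<in> convex hull V"
      using V(2) by blast
  qed
  ultimately show thesis
    using that V(1) by blast
qed

text \<open>A normal \<^term>\<open>z\<close> of a polyhedral cone stays normal under every small perturbation that is
  normal to the face exposed by \<^term>\<open>z\<close>: on the generators outside that face
  \<^term>\<open>z\<close> is strictly positive. Polyhedrality enters below only through this stability and
  through the local conicity of the feasible set.\<close>

lemma dual_cone_perturbation:
  fixes T :: "'a::euclidean_space set"
  assumes T: "polyhedron T" "conic T" and z: "z \<in> dual_cone T"
  obtains \<epsilon> where "\<epsilon> > 0"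
    "\<And>w. norm w < \<epsilon> \<Longrightarrow> w \<in> dual_cone (T \<inter> perp z) \<Longrightarrow> z + w \<in> dual_cone T"
proof -
  obtain V where V: "finite V" "V \<subseteq> T" "\<And>t. t \<in> T \<Longrightarrow> \<exists>r>0. r *\<^sub>R t \<in> convex hull V"
    using polyhedral_cone_generators[OF T] by blast
  let ?U = "{r \<in> V. inner z r > 0}"
  have "\<forall>\<^sub>F w in nhds 0. 0 < inner (z + w) r" if r: "r \<in> ?U" for r
  proof (rule order_tendstoD(1))
    show "((\<lambda>w. inner (z + w) r) \<longlongrightarrow> inner (z + 0) r) (nhds 0)"
      by (intro tendsto_intros) (simp add: filterlim_ident)
  qed (use r in simp)
  then have "\<forall>\<^sub>F w in nhds 0. \<forall>r\<in>?U. 0 < inner (z + w) r"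
    using V(1) by (intro eventually_ball_finite) auto
  then obtain \<epsilon> where \<epsilon>: "\<epsilon> > 0" "\<And>w r. norm w < \<epsilon> \<Longrightarrow> r \<in> ?U \<Longrightarrow> 0 < inner (z + w) r"
    unfolding eventually_nhds_metric by (auto simp: dist_norm)
  have "z + w \<in> dual_cone T" if w: "norm w < \<epsilon>" "w \<in> dual_cone (T \<inter> perp z)" for w
  proof (rule dual_coneI)
    have "0 \<le> inner (z + w) r" if r: "r \<in> V" for r
    proof (cases "inner z r > 0")
      case True
      then show ?thesis
        using \<epsilon>(2)[OF w(1), of r] r by simp
    next
      case False
      then have 0: "inner z r = 0"
        using dual_coneD[OF z, of r] V(2) r by auto
      then have "r \<in> T \<inter> perp z"
        using V(2) r by (auto simp: perp_def inner_commute)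
      then show ?thesis
        using dual_coneD[OF w(2)] 0 by (simp add: inner_add_left)
    qed
    then have hull: "convex hull V \<subseteq> {t. inner (z + w) t \<ge> 0}"
      by (intro hull_minimal) (auto simp: convex_halfspace_ge)
    fix t assume "t \<in> T"
    then obtain r where "r > 0" "r *\<^sub>R t \<in> convex hull V"
      using V(3) by blast
    then show "0 \<le> inner (z + w) t"
      using hull by (force simp: zero_le_mult_iff)
  qed
  then show thesis
    using that \<epsilon>(1) by blast
qed

lemma polyhedron_local:
  fixes P :: "'a::euclidean_space set"
  assumes P: "polyhedron P" and x: "x \<in> P" and z: "z \<in> dual_cone (tangent_cone P x)"
  obtains \<epsilon> where "\<epsilon> > 0" "\<And>d. d \<in> tangent_cone P x \<Longrightarrow> norm d < \<epsilon> \<Longrightarrow> x + d \<in> P"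
    "\<And>w. norm w < \<epsilon> \<Longrightarrow> w \<in> dual_cone (tangent_cone P x \<inter> perp z) \<Longrightarrow>
       z + w \<in> dual_cone (tangent_cone P x)"
proof -
  obtain \<epsilon>1 where 1: "\<epsilon>1 > 0" "polyhedron (tangent_cone P x)"
    "\<And>d. d \<in> tangent_cone P x \<Longrightarrow> norm d < \<epsilon>1 \<Longrightarrow> x + d \<in> P"
    using polyhedron_tangent_cone[OF P x] by blast
  have "conic (tangent_cone P x)"
    using closed_convex_cone_tangent_cone[OF polyhedron_imp_convex[OF P] x]
    by (simp add: closed_convex_cone_def)
  then obtain \<epsilon>2 where 2: "\<epsilon>2 > 0"
    "\<And>w. norm w < \<epsilon>2 \<Longrightarrow> w \<in> dual_cone (tangent_cone P x \<inter> perp z) \<Longrightarrow>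
       z + w \<in> dual_cone (tangent_cone P x)"
    using dual_cone_perturbation[OF 1(2) _ z] by blast
  show thesis
    using that[of "min \<epsilon>1 \<epsilon>2"] 1 2 by simp
qed

text \<open>For small \<open>h\<close> the point \<open>x + \<Pi>\<^sub>K h\<close> is feasible by local conicity, and the normal
  \<open>- z\<close> plus the residual of \<open>\<Pi>\<^sub>K h\<close> is again normal by the stability of normals. So it is the
  projection of \<open>x - z + h\<close>.\<close>

lemma B_differentiable_closest_point_polyhedron:
  fixes P :: "'a::euclidean_space set"
  assumes P: "polyhedron P" and x: "x \<in> P" and z: "z \<in> dual_cone (tangent_cone P x)"
  shows "B_differentiable (closest_point P) (closest_point (tangent_cone P x \<inter> perp z)) (x - z)"
proof -
  let ?T = "tangent_cone P x" and ?K = "tangent_cone P x \<inter> perp z"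
  have Pc: "closed P" "convex P" "P \<noteq> {}"
    using P x by (auto intro: polyhedron_imp_closed polyhedron_imp_convex)
  have K: "closed_convex_cone ?K"
    by (intro closed_convex_cone_Int closed_convex_cone_tangent_cone closed_convex_cone_perp Pc x)
  obtain \<epsilon> where \<epsilon>: "\<epsilon> > 0" "\<And>d. d \<in> ?T \<Longrightarrow> norm d < \<epsilon> \<Longrightarrow> x + d \<in> P"
    "\<And>w. norm w < \<epsilon> \<Longrightarrow> w \<in> dual_cone ?K \<Longrightarrow> z + w \<in> dual_cone ?T"
    using polyhedron_local[OF P x z] by blast
  have loc: "closest_point P (x - z + h) = x + closest_point ?K h" if h: "norm h < \<epsilon>" for h
  proof -
    define k where "k = closest_point ?K h"
    have k: "k \<in> ?K" "k - h \<in> dual_cone ?K" "inner k (h - k) = 0"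
      using closest_point_cone[OF K, of h] k_def by blast+
    have "norm k < \<epsilon>" "norm (k - h) < \<epsilon>"
      using closest_point_cone_norm[OF K, of h] h by (auto simp: k_def norm_minus_commute)
    then have xk: "x + k \<in> P" and zw: "z + (k - h) \<in> dual_cone ?T"
      using k \<epsilon> by auto
    have zk: "inner z k = 0"
      using k(1) by (simp add: perp_def inner_commute)
    have "inner (h - z - k) (p - (x + k)) \<le> 0" if "p \<in> P" for p
    proof -
      have "0 \<le> inner (z + (k - h)) (p - x)"
        using zw dual_cone_tangent_cone_iff[OF x] that by blast
      then show ?thesis
        using zk k(3) by (simp add: inner_add_left inner_add_right inner_diff_left
            inner_diff_right inner_commute)
    qed
    then have "closest_point P ((x + k) + (h - z - k)) = x + k"
      unfolding closest_point_add_eq_iff[OF Pc] using xk by blast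
    then show ?thesis
      by (simp add: k_def algebra_simps)
  qed
  have "closest_point ?K 0 = 0"
    using closest_point_cone_norm(1)[OF K, of 0] by simp
  then have "closest_point P (x - z) = x"
    using loc[of 0] \<epsilon>(1) by simp
  then show ?thesis
    using loc by (intro B_differentiable_closest_point_conical[OF Pc K \<epsilon>(1)]) simp
qed

lemma theta_normal:
  assumes "x \<in> P" "\<And>p. p \<in> P \<Longrightarrow> 0 \<le> inner z (p - x)"
  shows "theta P z = ereal (- inner x z)"
  unfolding theta_def support_fun_def
proof (rule antisym)
  show "(SUP u\<in>P. ereal (inner u (- z))) \<le> ereal (- inner x z)"
    using assms(2) by (intro SUP_least) (simp add: inner_diff_right inner_commute)
  show "ereal (- inner x z) \<le> (SUP u\<in>P. ereal (inner u (- z)))"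
    using assms(1) by (intro SUP_upper2[of x]) auto
qed

lemma theta_ge: "p \<in> P \<Longrightarrow> ereal (- inner p z) \<le> theta P z"
  unfolding theta_def support_fun_def by (rule SUP_upper2[of p]) auto

text \<open>The difference quotients of the convex function \<^term>\<open>theta P\<close> are monotone, so that the
  limit defining the directional derivative exists in the extended reals.\<close>

lemma theta_dir_deriv_tendsto:
  fixes P :: "'a::euclidean_space set"
  assumes x: "x \<in> P" and z: "\<And>p. p \<in> P \<Longrightarrow> 0 \<le> inner z (p - x)"
  shows "((\<lambda>t. (theta P (z + t *\<^sub>R u) - theta P z) / ereal t) \<longlongrightarrow> dir_deriv (theta P) z u)
           (at_right 0)"
proof -
  define q where "q t = (theta P (z + t *\<^sub>R u) - theta P z) / ereal t" for t
  have tz: "theta P z = ereal (- inner x z)"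
    using theta_normal[OF x z] .
  have mono: "q s \<le> q t" if st: "0 < s" "s \<le> t" for s t
  proof (cases "theta P (z + t *\<^sub>R u)")
    case (real \<tau>)
    have le: "- inner p (z + t *\<^sub>R u) \<le> \<tau>" if "p \<in> P" for p
      using theta_ge[OF that, of "z + t *\<^sub>R u"] real by simp
    define \<sigma> where "\<sigma> = (s / t) * \<tau> + (1 - s / t) * (- inner x z)"
    have "theta P (z + s *\<^sub>R u) \<le> ereal \<sigma>"
      unfolding theta_def support_fun_def
    proof (rule SUP_least)
      fix p assume p: "p \<in> P"
      have "- inner p (z + s *\<^sub>R u)
          = (s / t) * (- inner p (z + t *\<^sub>R u)) + (1 - s / t) * (- inner p z)"
        using st by (simp add: inner_add_right field_simps)
      also have "\<dots> \<le> \<sigma>"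
        unfolding \<sigma>_def using st le[OF p] z[OF p]
        by (intro add_mono mult_left_mono) (auto simp: inner_diff_right inner_commute)
      finally show "ereal (inner p (- (z + s *\<^sub>R u))) \<le> ereal \<sigma>"
        by (simp only: inner_minus_right ereal_less_eq)
    qed
    then have "q s \<le> (ereal \<sigma> - theta P z) / ereal s"
      unfolding q_def using st tz by (intro ereal_divide_right_mono ereal_minus_mono) auto
    also have "\<dots> = q t"
      using st unfolding q_def real tz \<sigma>_def by (simp add: field_simps)
    finally show ?thesis .
  next
    case PInf
    then show ?thesis
      using st by (simp add: q_def tz)
  next
    case MInf
    then show ?thesis
      using theta_ge[OF x, of "z + t *\<^sub>R u"] by simp
  qed
  have "(q \<longlongrightarrow> (INF t\<in>{0<..}. q t)) (at_right 0)"
  proof (rule order_tendstoI)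
    fix a assume "a < (INF t\<in>{0<..}. q t)"
    then have "a < q t" if "t > 0" for t
      using that by (meson INF_lower greaterThan_iff order_less_le_trans)
    then show "\<forall>\<^sub>F t in at_right 0. a < q t"
      using eventually_at_right_less[of "0::real"] by (auto elim: eventually_mono)
  next
    fix b assume "(INF t\<in>{0<..}. q t) < b"
    then obtain t where t: "t > 0" "q t < b"
      by (auto simp: INF_less_iff)
    then show "\<forall>\<^sub>F s in at_right 0. q s < b"
      unfolding eventually_at_right_field using le_less_trans[OF mono t(2)]
      by (intro exI[of _ t]) auto
  qed
  then have "(q \<longlongrightarrow> Lim (at_right 0) q) (at_right 0)"
    by (metis tendsto_Lim trivial_limit_at_right_real)
  then show ?thesis
    unfolding dir_deriv_def q_def .
qed

text \<open>The set \<^term>\<open>S_set P x z\<close> is the dual of the critical cone: on directions in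
  the dual cone, \<^term>\<open>theta P\<close> is linear near \<^term>\<open>z\<close> by the perturbation lemma, and conversely
  the points of the face of \<^term>\<open>P\<close> exposed by \<^term>\<open>z\<close> bound the directional derivative
  from below.\<close>

lemma S_set_eq_dual_cone:
  fixes P :: "'a::euclidean_space set"
  assumes P: "polyhedron P" and x: "x \<in> P" and z: "z \<in> dual_cone (tangent_cone P x)"
  shows "S_set P x z = dual_cone (tangent_cone P x \<inter> perp z)"
proof -
  let ?T = "tangent_cone P x" and ?K = "tangent_cone P x \<inter> perp z"
  have zn: "\<And>p. p \<in> P \<Longrightarrow> 0 \<le> inner z (p - x)"
    using dual_cone_tangent_cone_iff[OF x] z by blast
  have tz: "theta P z = ereal (- inner x z)"
    by (rule theta_normal[OF x zn])
  have T: "closed_convex_cone ?T"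
    by (intro closed_convex_cone_tangent_cone polyhedron_imp_convex P x)
  obtain \<epsilon> where \<epsilon>: "\<epsilon> > 0" "\<And>d. d \<in> ?T \<Longrightarrow> norm d < \<epsilon> \<Longrightarrow> x + d \<in> P"
    "\<And>w. norm w < \<epsilon> \<Longrightarrow> w \<in> dual_cone ?K \<Longrightarrow> z + w \<in> dual_cone ?T"
    using polyhedron_local[OF P x z] by blast
  have small: "\<forall>\<^sub>F t in at_right 0. norm (t *\<^sub>R d) < \<epsilon>" for d :: 'a
  proof (rule order_tendstoD(2))
    show "((\<lambda>t. norm (t *\<^sub>R d)) \<longlongrightarrow> norm (0 *\<^sub>R d)) (at_right (0::real))"
      by (intro tendsto_intros)
  qed (simp add: \<epsilon>(1))
  show ?thesis
  proof (intro equalityI subsetI)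
    fix u assume u: "u \<in> dual_cone ?K"
    have "((\<lambda>t. (theta P (z + t *\<^sub>R u) - theta P z) / ereal t) \<longlongrightarrow> ereal (- inner u x)) (at_right 0)"
    proof (rule tendsto_eventually)
      show "\<forall>\<^sub>F t in at_right 0. (theta P (z + t *\<^sub>R u) - theta P z) / ereal t = ereal (- inner u x)"
        using small[of u] eventually_at_right_less[of "0::real"]
      proof eventually_elim
        case (elim t)
        have "t *\<^sub>R u \<in> dual_cone ?K"
          using elim closed_convex_cone_scale[OF closed_convex_cone_dual_cone u, of t] by simp
        then have "z + t *\<^sub>R u \<in> dual_cone ?T"
          using \<epsilon>(3) elim by blast
        then have "theta P (z + t *\<^sub>R u) = ereal (- inner x (z + t *\<^sub>R u))"
          using dual_cone_tangent_cone_iff[OF x] by (intro theta_normal[OF x]) blast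
        then show ?case
          using elim by (simp add: tz inner_add_right inner_commute field_simps)
      qed
    qed
    then have "dir_deriv (theta P) z u = ereal (- inner u x)"
      unfolding dir_deriv_def by (intro tendsto_Lim) auto
    then show "u \<in> S_set P x z"
      by (simp add: S_set_def)
  next
    fix u assume "u \<in> S_set P x z"
    then have "ereal (inner u x) + dir_deriv (theta P) z u = 0"
      by (simp add: S_set_def)
    then have dd: "dir_deriv (theta P) z u = ereal (- inner u x)"
      by (cases "dir_deriv (theta P) z u") auto
    show "u \<in> dual_cone ?K"
    proof (rule dual_coneI)
      fix k assume k: "k \<in> ?K"
      obtain r where r: "r > 0" "norm (r *\<^sub>R k) < \<epsilon>"
        using eventually_happens'[OF trivial_limit_at_right_real
            eventually_conj[OF eventually_at_right_less small[of k]]]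
        by blast
      define p where "p = x + r *\<^sub>R k"
      have p: "p \<in> P" and pz: "inner p z = inner x z"
        unfolding p_def using k r \<epsilon>(2) closed_convex_cone_scale[OF T, of k r]
        by (auto simp: inner_add_left perp_def)
      have "ereal (- inner p u) \<le> dir_deriv (theta P) z u"
      proof (rule tendsto_lowerbound[OF theta_dir_deriv_tendsto[OF x zn]])
        show "\<forall>\<^sub>F t in at_right 0. ereal (- inner p u) \<le> (theta P (z + t *\<^sub>R u) - theta P z) / ereal t"
          using eventually_at_right_less
        proof eventually_elim
          case (elim t)
          have "(ereal (- inner p (z + t *\<^sub>R u)) - theta P z) / ereal t
              \<le> (theta P (z + t *\<^sub>R u) - theta P z) / ereal t"
            using elim by (intro ereal_divide_right_mono ereal_minus_mono theta_ge p) auto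
          moreover have "(ereal (- inner p (z + t *\<^sub>R u)) - theta P z) / ereal t
              = ereal (- inner p u)"
            using elim by (simp add: tz inner_add_right pz field_simps)
          ultimately show ?case by simp
        qed
      qed auto
      then have "0 \<le> inner u (r *\<^sub>R k)"
        by (simp add: dd p_def inner_add_left inner_add_right inner_commute)
      then show "0 \<le> inner u k"
        using r(1) by (simp add: zero_le_mult_iff)
    qed
  qed
qed

text \<open>Moreau decomposition: \<^term>\<open>theta P\<close> is the conjugate of the indicator function of
  the reflected set.\<close>

lemma prox_theta:
  fixes P :: "'a::euclidean_space set"
  assumes P: "closed P" "convex P" "P \<noteq> {}"
  shows "prox (theta P) a = a + closest_point P (- a)"
proof -
  define p where "p = closest_point P (- a)"
  define f where "f z = theta P z + ereal ((norm (z - a))\<^sup>2 / 2)" for z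
  have p: "p \<in> P"
    unfolding p_def by (rule closest_point_in_set[OF P(1,3)])
  have "0 \<le> inner (a + p) (q - p)" if "q \<in> P" for q
    using closest_point_dot[OF P(2,1) that, of "- a"] unfolding p_def[symmetric]
    by (simp add: inner_diff_left inner_add_left)
  then have "theta P (a + p) = ereal (- inner p (a + p))"
    by (rule theta_normal[OF p])
  then have f0: "f (a + p) = ereal (- inner p (a + p) + (norm p)\<^sup>2 / 2)"
    by (simp add: f_def)
  have less: "f (a + p) < f z" if "z \<noteq> a + p" for z
  proof -
    have "0 < (norm (z - (a + p)))\<^sup>2"
      using that by simp
    then have "- inner p (a + p) + (norm p)\<^sup>2 / 2 < - inner p z + (norm (z - a))\<^sup>2 / 2"
      by (simp add: power2_norm_eq_inner inner_diff_left inner_diff_right inner_add_left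
          inner_add_right inner_commute field_simps)
    then have "f (a + p) < ereal (- inner p z) + ereal ((norm (z - a))\<^sup>2 / 2)"
      by (simp add: f0)
    also have "\<dots> \<le> f z"
      unfolding f_def by (intro add_right_mono theta_ge p)
    finally show ?thesis .
  qed
  have "is_arg_min f (\<lambda>_. True) z \<longleftrightarrow> z = a + p" for z
    using less unfolding is_arg_min_def by (metis less_asym)
  then have "is_arg_min f (\<lambda>_. True) = (\<lambda>z. z = a + p)"
    by (intro ext) simp
  then show ?thesis
    unfolding prox_def arg_min_def f_def[symmetric] p_def[symmetric] by simp
qed

lemma epi_theta_eq_dual_cone:
  fixes P :: "'a::euclidean_space set"
  shows "epi (theta P) = dual_cone ((\<lambda>p. (p, 1)) ` P)"
proof -
  have "theta P z \<le> ereal t \<longleftrightarrow> (\<forall>p\<in>P. 0 \<le> inner z p + t)" for z t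
    unfolding theta_def support_fun_def
    by (simp add: SUP_le_iff inner_commute) (smt (verit))
  then show ?thesis
    by (auto simp: epi_def dual_cone_def)
qed

text \<open>The critical cone of the epigraph is the graph of the linear form
  \<open>d \<mapsto> - \<langle>x, d\<rangle>\<close> over the dual of the critical cone of \<^term>\<open>P\<close>.\<close>

definition epi_critical_cone :: "'a::real_inner set \<Rightarrow> 'a \<Rightarrow> ('a \<times> real) set" where
  "epi_critical_cone K x = {(d, \<tau>). d \<in> dual_cone K \<and> \<tau> = - inner x d}"

lemma closed_convex_cone_epi_critical_cone:
  fixes K :: "'a::euclidean_space set"
  shows "closed_convex_cone (epi_critical_cone K x)"
proof -
  have "epi_critical_cone K x = dual_cone ((\<lambda>k. (k, 0)) ` K) \<inter> perp (x, 1)"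
    by (auto simp: epi_critical_cone_def dual_cone_def perp_def inner_commute)
  then show ?thesis
    by (simp add: closed_convex_cone_Int closed_convex_cone_dual_cone closed_convex_cone_perp)
qed

lemma dual_cone_epi_critical_cone:
  fixes K :: "'a::euclidean_space set"
  assumes "closed_convex_cone K"
  shows "(w, \<omega>) \<in> dual_cone (epi_critical_cone K x) \<longleftrightarrow> w - \<omega> *\<^sub>R x \<in> K"
proof -
  have "(w, \<omega>) \<in> dual_cone (epi_critical_cone K x) \<longleftrightarrow> w - \<omega> *\<^sub>R x \<in> dual_cone (dual_cone K)"
    unfolding dual_cone_def[of "epi_critical_cone K x"] dual_cone_def[of "dual_cone K"]
    by (simp add: epi_critical_cone_def inner_diff_left Ball_def)
  then show ?thesis
    by (simp add: bipolar[OF assms])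
qed

text \<open>The projection onto the epigraph is treated like the projection onto a polyhedron. The
  residual of the projection is a negative multiple of \<open>(p, 1)\<close> with a point \<open>p\<close> near \<^term>\<open>x\<close>,
  which lies in the polyhedron by local conicity. The bound \<open>\<delta>\<close> keeps the vertical component of the
  residual close to \<open>- 1\<close>, so that dividing by it is harmless.\<close>

lemma B_differentiable_closest_point_epi:
  fixes P :: "'a::euclidean_space set"
  assumes P: "polyhedron P" and x: "x \<in> P" and z: "z \<in> dual_cone (tangent_cone P x)"
  defines "K \<equiv> tangent_cone P x \<inter> perp z"
  shows "B_differentiable (closest_point (epi (theta P))) (closest_point (epi_critical_cone K x))
           ((z, - inner x z) + (- x, - 1))"
    and "closest_point (epi (theta P)) ((z, - inner x z) + (- x, - 1)) = (z, - inner x z)"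
proof -
  let ?T = "tangent_cone P x" and ?E = "epi (theta P)" and ?KE = "epi_critical_cone K x"
  let ?a = "(z, - inner x z) + (- x, - 1)"
  have E: "closed_convex_cone ?E"
    unfolding epi_theta_eq_dual_cone by (rule closed_convex_cone_dual_cone)
  have T: "closed_convex_cone ?T"
    by (intro closed_convex_cone_tangent_cone polyhedron_imp_convex P x)
  have K: "closed_convex_cone K"
    unfolding K_def by (intro closed_convex_cone_Int T closed_convex_cone_perp)
  note KE = closed_convex_cone_epi_critical_cone[of K x]
  obtain \<epsilon> where \<epsilon>: "\<epsilon> > 0" "\<And>d. d \<in> ?T \<Longrightarrow> norm d < \<epsilon> \<Longrightarrow> x + d \<in> P"
    "\<And>w. norm w < \<epsilon> \<Longrightarrow> w \<in> dual_cone K \<Longrightarrow> z + w \<in> dual_cone ?T"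
    using polyhedron_local[OF P x z] unfolding K_def by blast
  define \<delta> where "\<delta> = min (1 / 2) (min \<epsilon> (\<epsilon> / (2 * (norm x + 1))))"
  have nx: "norm x + 1 > 0"
    by (simp add: add_nonneg_pos)
  have \<delta>: "\<delta> > 0"
    using \<epsilon>(1) nx by (simp add: \<delta>_def)
  have loc: "closest_point ?E (?a + h) = (z, - inner x z) + closest_point ?KE h"
    if h: "norm h < \<delta>" for h
  proof -
    obtain d \<tau> where k: "closest_point ?KE h = (d, \<tau>)"
      by fastforce
    obtain w \<omega> where w: "h - (d, \<tau>) = (w, \<omega>)"
      by fastforce
    then have hk: "h = (d + w, \<tau> + \<omega>)"
      by (metis add_Pair add_diff_cancel_left' diff_add_cancel add.commute)
    have c: "(d, \<tau>) \<in> ?KE" "- (w, \<omega>) \<in> dual_cone ?KE" "inner (d, \<tau>) (w, \<omega>) = 0"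
      using closest_point_cone[OF KE, of h] w[symmetric] by (auto simp: k)
    have d: "d \<in> dual_cone K" and \<tau>: "\<tau> = - inner x d"
      using c(1) by (auto simp: epi_critical_cone_def)
    define k' where "k' = \<omega> *\<^sub>R x - w"
    have k'K: "k' \<in> K"
      using c(2) dual_cone_epi_critical_cone[OF K, of "- w" "- \<omega>" x] by (simp add: k'_def)
    have k'd: "inner k' d = 0"
      using c(3) by (simp add: k'_def \<tau> inner_diff_left inner_diff_right inner_commute)
    have k'z: "inner k' z = 0"
      using k'K by (simp add: K_def perp_def)
    have "norm (d, \<tau>) \<le> norm h" "norm (w, \<omega>) \<le> norm h"
      using closest_point_cone_norm[OF KE, of h] by (simp_all add: k w)
    then have n: "norm d \<le> norm h" "norm w \<le> norm h" "\<bar>\<omega>\<bar> \<le> norm h"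
      using norm_fst_le[of d \<tau>] norm_fst_le[of w \<omega>] norm_snd_le[of \<omega> w] by auto
    have \<omega>: "1 - \<omega> > 1 / 2"
      using n(3) h by (auto simp: \<delta>_def)
    define p where "p = x + (1 / (1 - \<omega>)) *\<^sub>R k'"
    have "norm k' \<le> norm h * (norm x + 1)"
    proof -
      have "norm k' \<le> \<bar>\<omega>\<bar> * norm x + norm w"
        unfolding k'_def by (metis norm_scaleR norm_triangle_ineq4)
      also have "\<dots> \<le> norm h * norm x + norm h"
        using n by (intro add_mono mult_right_mono) auto
      finally show ?thesis by (simp add: algebra_simps)
    qed
    also have "\<dots> < \<epsilon> / 2"
      using h nx by (simp add: \<delta>_def field_simps)
    finally have "norm k' < \<epsilon> / 2" .
    moreover have "1 / (1 - \<omega>) \<le> 2"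
      using \<omega> by (simp add: divide_simps)
    then have "norm ((1 / (1 - \<omega>)) *\<^sub>R k') \<le> 2 * norm k'"
      using \<omega> mult_right_mono[of "1 / (1 - \<omega>)" 2 "norm k'"] by simp
    ultimately have "norm ((1 / (1 - \<omega>)) *\<^sub>R k') < \<epsilon>"
      by linarith
    moreover have "(1 / (1 - \<omega>)) *\<^sub>R k' \<in> ?T"
      using k'K \<omega> closed_convex_cone_scale[OF T, of k' "1 / (1 - \<omega>)"] by (simp add: K_def)
    ultimately have p: "p \<in> P"
      unfolding p_def by (intro \<epsilon>(2))
    have zd: "z + d \<in> dual_cone ?T"
      using d n(1) h by (intro \<epsilon>(3)) (auto simp: \<delta>_def)
    have "theta P (z + d) = ereal (- inner x (z + d))"
      using zd dual_cone_tangent_cone_iff[OF x] by (intro theta_normal[OF x]) blast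
    then have inE: "(z + d, - inner x (z + d)) \<in> ?E"
      by (simp add: epi_def)
    have "(1 - \<omega>) *\<^sub>R p = (1 - \<omega>) *\<^sub>R x + k'"
      using \<omega> by (simp add: p_def scaleR_add_right)
    then have xw: "x - w = (1 - \<omega>) *\<^sub>R p"
      by (simp add: k'_def scaleR_diff_left)
    have normal: "(x - w, 1 - \<omega>) \<in> dual_cone ?E"
    proof (rule dual_coneI)
      fix e assume "e \<in> ?E"
      then have "0 \<le> inner (fst e) p + snd e"
        using p unfolding epi_theta_eq_dual_cone by (auto simp: dual_cone_def inner_prod_def)
      then have "0 \<le> (1 - \<omega>) * (inner (fst e) p + snd e)"
        using \<omega> by simp
      then show "0 \<le> inner (x - w, 1 - \<omega>) e"
        unfolding xw by (simp add: inner_prod_def inner_commute algebra_simps)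
    qed
    have xw': "x - w = (1 - \<omega>) *\<^sub>R x + k'"
      by (simp add: k'_def algebra_simps)
    have "inner (z + d) (x - w) = (1 - \<omega>) * inner x (z + d)"
      unfolding xw' using k'd k'z by (simp add: inner_add_left inner_add_right inner_commute algebra_simps)
    then have "inner (z + d, - inner x (z + d)) (w - x, \<omega> - 1) = 0"
      by (simp add: inner_diff_right algebra_simps)
    then have "closest_point ?E ((z + d, - inner x (z + d)) + (w - x, \<omega> - 1))
        = (z + d, - inner x (z + d))"
      unfolding closest_point_cone_iff[OF E] using inE normal by simp
    moreover have "?a + h = (z + d, - inner x (z + d)) + (w - x, \<omega> - 1)"
      by (simp add: hk \<tau> inner_add_right algebra_simps)
    moreover have "(z, - inner x z) + closest_point ?KE h = (z + d, - inner x (z + d))"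
      by (simp add: k \<tau> inner_add_right)
    ultimately show ?thesis
      by simp
  qed
  have "closest_point ?KE 0 = 0"
    using closest_point_cone_norm(1)[OF KE, of 0] by simp
  then show base: "closest_point ?E ?a = (z, - inner x z)"
    using loc[of 0] \<delta> by (simp add: zero_prod_def)
  have "closest_point ?E (?a + h) = closest_point ?E ?a + closest_point ?KE h" if "norm h < \<delta>" for h
    by (simp only: base loc[OF that])
  moreover have "closed ?E" "convex ?E" "?E \<noteq> {}"
    using E by (simp_all add: closed_convex_cone_def)
  ultimately show "B_differentiable (closest_point ?E) (closest_point ?KE) ?a"
    by (intro B_differentiable_closest_point_conical[OF _ _ _ KE \<delta>])
qed

section \<open>Positive semidefinite matrices and the pseudo-inverse\<close>

lemma inner_matrix_mult_right:
  fixes A B C :: "real^'n^'n"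
  shows "inner A (B ** C) = inner (A ** transpose C) B"
proof -
  have "inner A (B ** C) = (\<Sum>i\<in>UNIV. \<Sum>j\<in>UNIV. \<Sum>k\<in>UNIV. A$i$j * (B$i$k * C$k$j))"
    by (simp add: inner_vec_def matrix_matrix_mult_def sum_distrib_left)
  also have "\<dots> = (\<Sum>i\<in>UNIV. \<Sum>k\<in>UNIV. \<Sum>j\<in>UNIV. A$i$j * (B$i$k * C$k$j))"
    by (intro sum.cong refl sum.swap)
  also have "\<dots> = inner (A ** transpose C) B"
    by (simp add: inner_vec_def matrix_matrix_mult_def sum_distrib_left transpose_def mult_ac)
  finally show ?thesis .
qed

lemma inner_transpose:
  fixes A B :: "real^'n^'n"
  shows "inner (transpose A) (transpose B) = inner A B"
  unfolding inner_vec_def transpose_def by (simp, rule sum.swap)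

lemma inner_matrix_mult_left:
  fixes A B C :: "real^'n^'n"
  shows "inner A (B ** C) = inner (transpose B ** A) C"
  using inner_matrix_mult_right[of "transpose A" "transpose C" "transpose B"]
    inner_transpose[of A "B ** C"] inner_transpose[of "transpose B ** A" C]
  by (simp add: matrix_transpose_mul)

lemma transpose_add: "transpose (A + B) = transpose A + transpose (B :: real^'n^'m)"
  by (simp add: transpose_def vec_eq_iff)

lemma transpose_diff: "transpose (A - B) = transpose A - transpose (B :: real^'n^'m)"
  by (simp add: transpose_def vec_eq_iff)

lemma transpose_zero [simp]: "transpose 0 = (0 :: real^'n^'m)"
  by (simp add: transpose_def vec_eq_iff)

lemma matrix_diff_ldistrib: "A ** (B - C) = A ** B - A ** (C :: real^'n^'m)"
  by (simp add: matrix_matrix_mult_def vec_eq_iff sum_subtractf algebra_simps)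

lemma matrix_diff_rdistrib: "(B - C) ** A = B ** A - C ** (A :: real^'n^'m)"
  by (simp add: matrix_matrix_mult_def vec_eq_iff sum_subtractf algebra_simps)

lemma matrix_add_rdistrib': "(B + C) ** A = B ** A + C ** (A :: real^'n^'m)"
  by (simp add: matrix_matrix_mult_def vec_eq_iff sum.distrib algebra_simps)

lemma matrix_mult_zero [simp]: "A ** (0 :: real^'n^'m) = 0" "(0 :: real^'n^'m) ** B = 0"
  by (simp_all add: matrix_matrix_mult_def vec_eq_iff)

lemma matrix_mult_minus: "A ** (- B :: real^'n^'m) = - (A ** B)" "(- B :: real^'n^'m) ** C = - (B ** C)"
  by (simp_all add: matrix_matrix_mult_def vec_eq_iff sum_negf)

lemma matrix_mult_scaleR:
  "A ** (r *\<^sub>R B :: real^'n^'m) = r *\<^sub>R (A ** B)" "(r *\<^sub>R B :: real^'n^'m) ** C = r *\<^sub>R (B ** C)"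
  by (simp_all add: matrix_matrix_mult_def vec_eq_iff sum_distrib_left algebra_simps)

lemmas matrix_algebra = matrix_add_ldistrib matrix_add_rdistrib' matrix_diff_ldistrib
  matrix_diff_rdistrib matrix_mult_scaleR matrix_mult_minus matrix_mul_assoc[symmetric]

lemma matrix_mult_eq_extend: "A ** B = C \<Longrightarrow> A ** (B ** M) = C ** (M :: real^'n^'m)"
  by (simp add: matrix_mul_assoc)

lemma tendsto_matrix_mult:
  fixes f g :: "'a \<Rightarrow> real^'n^'n"
  assumes "(f \<longlongrightarrow> A) F" "(g \<longlongrightarrow> B) F"
  shows "((\<lambda>t. f t ** g t) \<longlongrightarrow> A ** B) F"
  unfolding matrix_matrix_mult_def
  by (intro vec_tendstoI) (auto intro!: tendsto_intros assms)

lemma tendsto_matrix_vector_mult: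
  fixes f :: "'a \<Rightarrow> real^'n^'n"
  assumes "(f \<longlongrightarrow> A) F"
  shows "((\<lambda>t. f t *v v) \<longlongrightarrow> A *v v) F"
  unfolding matrix_vector_mult_def
  by (intro vec_tendstoI) (auto intro!: tendsto_intros assms)

definition outer :: "real^'n \<Rightarrow> real^'n^'n" where
  "outer v = (\<chi> i j. v $ i * v $ j)"

lemma transpose_outer [simp]: "transpose (outer v) = outer v"
  by (simp add: outer_def transpose_def vec_eq_iff mult.commute)

lemma inner_outer: "inner A (outer v) = inner v (A *v v)"
  by (simp add: inner_vec_def outer_def matrix_vector_mult_def sum_distrib_left algebra_simps)

lemma outer_vector_mult: "outer v *v w = inner v w *\<^sub>R v"
  by (simp add: inner_vec_def outer_def matrix_vector_mult_def vec_eq_iff sum_distrib_left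
      algebra_simps)

lemma dot_matrix_mult:
  fixes A :: "real^'n^'n"
  shows "inner v (A *v w) = inner (transpose A *v v) w"
  using dot_lmul_matrix[of v A w] by simp

lemma outer_congruence:
  fixes B :: "real^'n^'n"
  shows "B ** outer v ** transpose B = outer (B *v v)"
proof (subst matrix_eq, rule allI)
  fix w
  show "B ** outer v ** transpose B *v w = outer (B *v v) *v w"
    using dot_matrix_mult[of v "transpose B" w]
    by (simp add: matrix_vector_mul_assoc[symmetric] outer_vector_mult
        matrix_vector_mult_scaleR)
qed

definition psd :: "real^'n^'n \<Rightarrow> bool" where
  "psd A \<longleftrightarrow> transpose A = A \<and> (\<forall>v. 0 \<le> inner v (A *v v))"

lemma psd_symmetric: "psd A \<Longrightarrow> transpose A = A"
  by (simp add: psd_def)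

lemma psd_nonneg: "psd A \<Longrightarrow> 0 \<le> inner v (A *v v)"
  by (simp add: psd_def)

lemma psd_zero: "psd 0"
  by (simp add: psd_def)

lemma psd_add: "psd A \<Longrightarrow> psd B \<Longrightarrow> psd (A + B)"
  by (simp add: psd_def transpose_add matrix_vector_mult_add_rdistrib inner_add_right)

lemma psd_scaleR:
  assumes "psd A" "0 \<le> r"
  shows "psd (r *\<^sub>R A)"
  using assms unfolding psd_def
  by (auto simp: transpose_scalar scaleR_matrix_vector_assoc[symmetric])

lemma psd_congruence:
  fixes A B :: "real^'n^'n"
  assumes "psd A"
  shows "psd (B ** A ** transpose B)"
  unfolding psd_def
proof (intro conjI allI)
  show "transpose (B ** A ** transpose B) = B ** A ** transpose B"
    using psd_symmetric[OF assms] by (simp add: matrix_transpose_mul matrix_mul_assoc)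
  fix v
  have "inner v (B ** A ** transpose B *v v) = inner (transpose B *v v) (A *v (transpose B *v v))"
    using dot_matrix_mult[of v B] by (simp only: matrix_vector_mul_assoc[symmetric])
  then show "0 \<le> inner v (B ** A ** transpose B *v v)"
    using psd_nonneg[OF assms] by metis
qed

lemma linear_coefficient_zero:
  fixes \<alpha> \<beta> :: real
  assumes "\<And>t. 0 \<le> t * \<alpha> + t\<^sup>2 * \<beta>"
  shows "\<alpha> = 0"
proof (rule ccontr)
  assume "\<alpha> \<noteq> 0"
  define d where "d = \<bar>\<beta>\<bar> + 1"
  have d: "d > 0" "\<beta> \<le> d"
    by (auto simp: d_def)
  define t where "t = - \<alpha> / (2 * d)"
  have "t * \<alpha> + t\<^sup>2 * \<beta> \<le> t * \<alpha> + t\<^sup>2 * d"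
    using d by (intro add_left_mono mult_left_mono) auto
  also have "\<dots> = - (\<alpha>\<^sup>2 / (4 * d))"
    using d(1) by (simp add: t_def power2_eq_square field_simps)
  also have "\<dots> < 0"
    using d(1) \<open>\<alpha> \<noteq> 0\<close> by simp
  finally show False
    using assms[of t] by simp
qed

lemma psd_form_zero:
  assumes A: "psd A" and v: "inner v (A *v v) = 0"
  shows "A *v v = 0"
proof -
  define w where "w = A *v v"
  have sym: "inner w (A *v v) = inner v (A *v w)"
    using dot_matrix_mult[of v A w] psd_symmetric[OF A] by (simp add: inner_commute)
  have "0 \<le> t * (2 * inner w (A *v v)) + t\<^sup>2 * inner w (A *v w)" for t
    using psd_nonneg[OF A, of "v + t *\<^sub>R w"] v sym
    by (simp add: matrix_vector_right_distrib matrix_vector_mult_scaleR inner_add_left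
        inner_add_right power2_eq_square algebra_simps)
  from linear_coefficient_zero[OF this] show ?thesis
    by (simp add: w_def)
qed

text \<open>Self-duality of the semidefinite cone, without the spectral theorem: subtracting the rank-one
  matrix \<open>w w\<^sup>T / c\<close> with \<open>w = A e\<close> and \<open>c = e\<^sup>T A e\<close> from a semidefinite matrix \<open>A\<close> leaves a
  semidefinite matrix that annihilates \<open>e\<close> and everything that \<open>A\<close> annihilates. After all
  coordinate vectors have been treated nothing is left.\<close>

lemma psd_inner_nonneg:
  fixes A S :: "real^'n^'n"
  assumes A: "psd A" and S: "psd S"
  shows "0 \<le> inner S A"
proof -
  have "0 \<le> inner S A" if "finite J" "psd A" "\<And>j. j \<notin> J \<Longrightarrow> A *v axis j 1 = 0" for J :: "'n set" and A
    using that
  proof (induction J arbitrary: A rule: finite_induct)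
    case empty
    have "A = 0"
    proof (rule vec_eq_iff[THEN iffD2], rule allI, rule vec_eq_iff[THEN iffD2], rule allI)
      fix i j
      have "column j A = 0"
        using empty(2)[of j] by (simp add: matrix_vector_mult_basis)
      then show "A $ i $ j = 0 $ i $ j"
        by (simp add: column_def vec_eq_iff)
    qed
    then show ?case by simp
  next
    case (insert k J)
    define w where "w = A *v axis k 1"
    define c where "c = inner (axis k 1) w"
    have c0: "c \<ge> 0"
      using psd_nonneg[OF insert.prems(1)] by (simp add: c_def w_def)
    show ?case
    proof (cases "c = 0")
      case True
      then have "A *v axis k 1 = 0"
        using psd_form_zero[OF insert.prems(1)] by (simp add: c_def w_def)
      then show ?thesis
        using insert.prems by (intro insert.IH) (metis insert_iff)+
    next
      case False
      then have c: "c > 0"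
        using c0 by simp
      define A' where "A' = A - (1 / c) *\<^sub>R outer w"
      have sym: "inner w u = inner (axis k 1) (A *v u)" for u
        using dot_matrix_mult[of "axis k 1" A u] psd_symmetric[OF insert.prems(1)]
        by (simp add: w_def)
      have A'v: "A' *v u = A *v u - (inner w u / c) *\<^sub>R w" for u
        by (simp add: A'_def matrix_vector_mult_diff_rdistrib scaleR_matrix_vector_assoc[symmetric]
            outer_vector_mult)
      have "psd A'"
        unfolding psd_def
      proof (intro conjI allI)
        show "transpose A' = A'"
          using psd_symmetric[OF insert.prems(1)]
          by (simp add: A'_def transpose_diff transpose_scalar)
        fix u
        let ?r = "inner w u / c"
        \<comment> \<open>Cauchy-Schwarz for the form of \<^term>\<open>A\<close>, by completing the square in the direction of
          the coordinate vector.\<close>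
        have "0 \<le> inner (u - ?r *\<^sub>R axis k 1) (A *v (u - ?r *\<^sub>R axis k 1))"
          by (rule psd_nonneg[OF insert.prems(1)])
        also have "A *v (u - ?r *\<^sub>R axis k 1) = A *v u - ?r *\<^sub>R w"
          by (simp add: w_def matrix_vector_mult_diff_distrib matrix_vector_mult_scaleR)
        also have "inner (u - ?r *\<^sub>R axis k 1) (A *v u - ?r *\<^sub>R w)
            = inner u (A *v u) - ?r * inner w u - ?r * inner w u + ?r * ?r * c"
          by (simp add: inner_diff_left inner_diff_right sym[symmetric] c_def inner_commute
              algebra_simps)
        also have "\<dots> = inner u (A' *v u)"
          using c by (simp add: A'v inner_diff_right inner_commute)
        finally show "0 \<le> inner u (A' *v u)" .
      qed
      moreover have "A' *v axis j 1 = 0" if "j \<notin> J" for j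
      proof (cases "j = k")
        case True
        have "inner w (axis k 1) = c"
          by (simp add: c_def inner_commute)
        then show ?thesis
          using c True by (simp add: A'v w_def[symmetric])
      next
        case False
        then have "A *v axis j 1 = 0"
          using insert.prems(2)[of j] that by simp
        then show ?thesis
          by (simp add: A'v sym)
      qed
      ultimately have "0 \<le> inner S A'"
        by (rule insert.IH)
      moreover have "inner S A = inner S A' + (1 / c) * inner w (S *v w)"
        by (simp add: A'_def inner_diff_right inner_outer)
      ultimately show ?thesis
        using c psd_nonneg[OF S, of w] by simp
    qed
  qed
  from this[of UNIV A] show ?thesis
    using A by simp
qed

text \<open>Complementarity in the trace inner product is complementarity of the product. Along
  \<open>(I + t C) B (I + t C)\<^sup>T\<close> the inner product with \<^term>\<open>A\<close> is nonnegative and vanishes at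
  \<open>t = 0\<close>, so its derivative there vanishes for every \<open>C\<close>.\<close>

lemma psd_inner_zero:
  fixes A B :: "real^'n^'n"
  assumes A: "psd A" and B: "psd B" and 0: "inner A B = 0"
  shows "A ** B = 0"
proof -
  define C where "C = A ** B"
  have eq: "inner A (B ** transpose C) = inner A (C ** B)"
    using inner_transpose[of A "C ** B"] psd_symmetric[OF A] psd_symmetric[OF B]
    by (simp add: matrix_transpose_mul)
  have "0 \<le> t * (2 * inner A (C ** B)) + t\<^sup>2 * inner A (C ** B ** transpose C)" for t
  proof -
    let ?M = "mat 1 + t *\<^sub>R C"
    have "0 \<le> inner A (?M ** B ** transpose ?M)"
      by (intro psd_inner_nonneg psd_congruence A B)
    also have "?M ** B ** transpose ?M = B + t *\<^sub>R (C ** B) + t *\<^sub>R (B ** transpose C)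
        + t\<^sup>2 *\<^sub>R (C ** B ** transpose C)"
      by (simp add: transpose_add transpose_scalar matrix_algebra power2_eq_square
          scaleR_add_right)
    finally show ?thesis
      using 0 eq by (simp add: inner_add_right)
  qed
  then have "inner A (C ** B) = 0"
    using linear_coefficient_zero by fastforce
  then have "inner C C = 0"
    by (simp add: inner_matrix_mult_right psd_symmetric[OF B] C_def)
  then show ?thesis
    by (simp add: C_def)
qed

text \<open>Adding the orthogonal projector onto the kernel makes a symmetric matrix invertible; removing
  the projector from the inverse gives the pseudo-inverse.\<close>

lemma symmetric_kernel_projector:
  fixes A :: "real^'n^'n"
  obtains E :: "real^'n^'n" where "transpose E = E" "A ** E = 0" "\<And>v. A *v v = 0 \<Longrightarrow> E *v v = v"
proof -
  have "subspace {v. A *v v = 0}"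
    by (auto simp: subspace_def matrix_vector_right_distrib matrix_vector_mult_scaleR)
  then obtain B where B: "B \<subseteq> {v. A *v v = 0}" "pairwise orthogonal B"
    "\<And>b. b \<in> B \<Longrightarrow> norm b = 1" "independent B" "span B = {v. A *v v = 0}"
    by (rule orthonormal_basis_subspace) blast
  have fin: "finite B"
    using B(4) independent_imp_finite by blast
  define E where "E = (\<Sum>b\<in>B. outer b)"
  have Ev: "E *v v = (\<Sum>b\<in>B. inner b v *\<^sub>R b)" for v
    unfolding E_def using fin
    by (induction B rule: finite_induct)
      (simp_all add: matrix_vector_mult_add_rdistrib outer_vector_mult)
  have "transpose E = E"
    unfolding E_def using fin by (induction B rule: finite_induct) (simp_all add: transpose_add)
  moreover have "A ** E = 0"
  proof (subst matrix_eq, rule allI)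
    fix v
    have "E *v v \<in> span B"
      unfolding Ev by (intro span_sum span_scale span_base)
    then show "A ** E *v v = 0 *v v"
      using B(5) by (simp add: matrix_vector_mul_assoc[symmetric])
  qed
  moreover have "E *v v = v" if "A *v v = 0" for v
  proof (rule linear_eq_on_span[of "(*v) E" "\<lambda>v. v" B])
    show "v \<in> span B"
      using that B(5) by simp
    fix b assume b: "b \<in> B"
    have "inner c b = 0" if "c \<in> B - {b}" for c
      using B(2) b that by (auto simp: pairwise_def orthogonal_def)
    then show "E *v b = b"
      unfolding Ev sum.remove[OF fin b] using B(3)[OF b] by (simp add: norm_eq_1)
  qed (auto simp: linear_ident)
  ultimately show thesis
    by (rule that)
qed

lemma penrose_unique:
  fixes A :: "real^'n^'m" and X Y :: "real^'m^'n"
  assumes X: "A ** X ** A = A" "X ** A ** X = X" "transpose (A ** X) = A ** X"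
      "transpose (X ** A) = X ** A"
    and Y: "A ** Y ** A = A" "Y ** A ** Y = Y" "transpose (A ** Y) = A ** Y"
      "transpose (Y ** A) = Y ** A"
  shows "X = Y"
proof -
  have "A ** X = (A ** Y) ** (A ** X)"
    using Y(1) by (simp add: matrix_mul_assoc)
  also have "\<dots> = transpose ((A ** X) ** (A ** Y))"
    by (simp only: matrix_transpose_mul[of "A ** X"] X(3) Y(3))
  also have "\<dots> = A ** Y"
    using X(1) Y(3) by (simp add: matrix_mul_assoc)
  finally have AX: "A ** X = A ** Y" .
  have "X ** A = (X ** A) ** (Y ** A)"
    using Y(1) by (simp add: matrix_mul_assoc[symmetric])
  also have "\<dots> = transpose ((Y ** A) ** (X ** A))"
    by (simp only: matrix_transpose_mul[of "Y ** A"] X(4) Y(4))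
  also have "\<dots> = Y ** A"
    using X(1) Y(4) by (simp add: matrix_mul_assoc[symmetric])
  finally have XA: "X ** A = Y ** A" .
  have "X = X ** (A ** X)"
    using X(2) by (simp add: matrix_mul_assoc)
  also have "\<dots> = Y ** A ** Y"
    unfolding AX by (simp add: matrix_mul_assoc XA)
  finally show ?thesis
    using Y(2) by simp
qed

lemma pinv_eqI:
  assumes "A ** X ** A = A" "X ** A ** X = X" "transpose (A ** X) = A ** X"
    "transpose (X ** A) = X ** A"
  shows "pinv A = X"
  unfolding pinv_def using assms penrose_unique[where A = A] by (intro the_equality) blast+

lemma pinv_symmetric:
  fixes A :: "real^'n^'n"
  assumes sym: "transpose A = A"
  shows "A ** pinv A ** A = A" "pinv A ** A ** pinv A = pinv A"
    "transpose (pinv A) = pinv A" "pinv A ** A = A ** pinv A"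
proof -
  obtain E :: "real^'n^'n" where E: "transpose E = E" "A ** E = 0" "\<And>v. A *v v = 0 \<Longrightarrow> E *v v = v"
    by (rule symmetric_kernel_projector[of A]) blast
  have EA: "E ** A = 0"
    using arg_cong[OF E(2), of transpose] by (simp add: matrix_transpose_mul E(1) sym)
  have EE: "E ** E = E"
  proof (subst matrix_eq, rule allI)
    fix v
    have "A *v (E *v v) = 0"
      by (simp add: matrix_vector_mul_assoc E(2))
    then show "E ** E *v v = E *v v"
      using E(3)[of "E *v v"] by (simp add: matrix_vector_mul_assoc)
  qed
  let ?M = "A + E"
  have "v = 0" if v: "?M *v v = 0" for v
  proof -
    have "E ** ?M = E"
      by (simp add: matrix_add_ldistrib EA EE)
    then have Ev: "E *v v = 0"
      using v by (metis matrix_vector_mul_assoc matrix_vector_mult_0_right)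
    then have "A *v v = 0"
      using v by (simp add: matrix_vector_mult_add_rdistrib)
    then show ?thesis
      using E(3) Ev by metis
  qed
  then obtain N where N: "N ** ?M = mat 1"
    using matrix_left_invertible_ker[of ?M] by blast
  then have N': "?M ** N = mat 1"
    by (simp add: matrix_left_right_inverse)
  have EM: "E ** ?M = E" "?M ** E = E"
    by (simp_all add: matrix_add_ldistrib matrix_add_rdistrib' EA EE E(2))
  have EN: "E ** N = E"
    using EM(1) N' by (metis matrix_mul_assoc matrix_mul_rid)
  have NE: "N ** E = E"
    using EM(2) N by (metis matrix_mul_assoc matrix_mul_lid)
  have AN: "A ** N = mat 1 - E"
    using N' EN by (simp add: matrix_add_rdistrib' algebra_simps)
  have NA: "N ** A = mat 1 - E"
    using N NE by (simp add: matrix_add_ldistrib algebra_simps)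
  define X where "X = N - E"
  have AX: "A ** X = mat 1 - E" and XA: "X ** A = mat 1 - E"
    by (simp_all add: X_def matrix_diff_ldistrib matrix_diff_rdistrib AN NA EA E(2))
  have 1: "A ** X ** A = A"
    by (simp add: AX matrix_diff_rdistrib EA)
  have 2: "X ** A ** X = X"
    unfolding XA by (simp add: X_def matrix_diff_rdistrib matrix_diff_ldistrib EN EE)
  have 3: "transpose (mat 1 - E) = mat 1 - E"
    by (simp add: transpose_diff E(1))
  have pX: "pinv A = X"
    using 1 2 3 AX XA by (intro pinv_eqI) simp_all
  have "pinv A = transpose X"
  proof (rule pinv_eqI)
    have AX': "A ** transpose X = mat 1 - E" and XA': "transpose X ** A = mat 1 - E"
      using arg_cong[OF XA, of transpose] arg_cong[OF AX, of transpose]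
      by (simp_all add: matrix_transpose_mul sym 3)
    show "A ** transpose X ** A = A"
      unfolding AX' by (simp add: matrix_diff_rdistrib EA)
    show "transpose X ** A ** transpose X = transpose X"
      using arg_cong[OF 2, of transpose] by (simp add: matrix_transpose_mul sym matrix_mul_assoc)
    show "transpose (A ** transpose X) = A ** transpose X"
      "transpose (transpose X ** A) = transpose X ** A"
      by (simp_all only: AX' XA' 3)
  qed
  then show "transpose (pinv A) = pinv A"
    using pX by simp
  show "A ** pinv A ** A = A" "pinv A ** A ** pinv A = pinv A" "pinv A ** A = A ** pinv A"
    using 1 2 AX XA by (simp_all add: pX)
qed

lemma psd_pinv:
  assumes "psd A"
  shows "psd (pinv A)"
  using psd_congruence[OF assms, of "pinv A"] pinv_symmetric[OF psd_symmetric[OF assms]] by simp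

section \<open>Linearised complementarity of semidefinite matrices\<close>

definition range_proj :: "real^'n^'n \<Rightarrow> real^'n^'n" where
  "range_proj A = A ** pinv A"

text \<open>For complementary matrices \<^term>\<open>x\<close> and \<^term>\<open>s\<close> this is the projector onto the
  intersection of the two kernels, the degenerate block of the pair.\<close>

definition null_proj :: "real^'n^'n \<Rightarrow> real^'n^'n \<Rightarrow> real^'n^'n" where
  "null_proj x s = mat 1 - range_proj x - range_proj s"

text \<open>The directions \<open>(p, q)\<close> tangent at \<open>(x, s)\<close> to the set of pairs of semidefinite matrices with
  product zero: the product rule governs all blocks except the degenerate one, which is itself a
  complementary pair.\<close>

definition lin_compl :: "real^'n^'n \<Rightarrow> real^'n^'n \<Rightarrow> real^'n^'n \<Rightarrow> real^'n^'n \<Rightarrow> bool" where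
  "lin_compl x s p q \<longleftrightarrow> x ** q + p ** s = 0 \<and>
     psd (null_proj x s ** p ** null_proj x s) \<and> psd (null_proj x s ** q ** null_proj x s) \<and>
     (null_proj x s ** p ** null_proj x s) ** (null_proj x s ** q ** null_proj x s) = 0"

text \<open>The directions described by \<^term>\<open>critical_dir x s d\<close> turn out to form the critical cone of
  the semidefinite cone at \<^term>\<open>x\<close> with respect to \<^term>\<open>s\<close>. In an eigenbasis adapted to the
  pair, with index sets \<open>\<alpha>\<close>, \<open>\<beta>\<close>, \<open>\<gamma>\<close> for the range of \<^term>\<open>x\<close>, the degenerate block and
  the range of \<^term>\<open>s\<close>, the blocks \<open>\<beta>\<gamma>\<close> and \<open>\<gamma>\<gamma>\<close> of \<^term>\<open>d\<close> vanish and the block \<open>\<beta>\<beta>\<close>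
  is semidefinite.\<close>

definition critical_dir :: "real^'n^'n \<Rightarrow> real^'n^'n \<Rightarrow> real^'n^'n \<Rightarrow> bool" where
  "critical_dir x s d \<longleftrightarrow> (mat 1 - range_proj x) ** d ** range_proj s = 0 \<and>
     psd (null_proj x s ** d ** null_proj x s)"

locale complementary_pair =
  fixes x s :: "real^'n^'n"
  assumes psd_x: "psd x" and psd_s: "psd s" and compl: "x ** s = 0"
begin

abbreviation "\<alpha> \<equiv> range_proj x"
abbreviation "\<gamma> \<equiv> range_proj s"
abbreviation "\<beta> \<equiv> null_proj x s"
abbreviation "X \<equiv> pinv x"
abbreviation "Y \<equiv> pinv s"

lemma swap: "complementary_pair s x"
proof
  show "s ** x = 0"
    using arg_cong[OF compl, of transpose] psd_x psd_s
    by (simp add: matrix_transpose_mul psd_symmetric)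
qed (fact psd_x psd_s)+

lemma transpose_blocks:
  "transpose x = x" "transpose s = s" "transpose X = X" "transpose Y = Y"
  "transpose \<alpha> = \<alpha>" "transpose \<gamma> = \<gamma>" "transpose \<beta> = \<beta>"
proof -
  note px = pinv_symmetric[OF psd_symmetric[OF psd_x]]
  note ps = pinv_symmetric[OF psd_symmetric[OF psd_s]]
  show 1: "transpose x = x" "transpose s = s" "transpose X = X" "transpose Y = Y"
    using psd_x psd_s px ps by (auto simp: psd_symmetric)
  show 2: "transpose \<alpha> = \<alpha>" "transpose \<gamma> = \<gamma>"
    using px ps 1 by (simp_all add: range_proj_def matrix_transpose_mul)
  show "transpose \<beta> = \<beta>"
    using 2 by (simp add: null_proj_def transpose_diff)
qed

lemma block_products_x:
  "\<alpha> ** x = x" "x ** \<alpha> = x" "X ** x = \<alpha>" "x ** X = \<alpha>" "\<alpha> ** \<alpha> = \<alpha>" "X ** \<alpha> = X" "\<alpha> ** X = X"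
proof -
  note px = pinv_symmetric[OF psd_symmetric[OF psd_x]]
  show 1: "\<alpha> ** x = x" "X ** x = \<alpha>" "x ** X = \<alpha>"
    using px by (simp_all add: range_proj_def)
  show 2: "x ** \<alpha> = x" "X ** \<alpha> = X" "\<alpha> ** X = X"
    using px unfolding range_proj_def by (metis matrix_mul_assoc)+
  show "\<alpha> ** \<alpha> = \<alpha>"
    using 1 by (metis matrix_mul_assoc)
qed

lemmas block_products_s = complementary_pair.block_products_x[OF swap]

lemma block_products_0:
  "x ** s = 0" "s ** x = 0" "\<alpha> ** s = 0" "s ** \<alpha> = 0" "\<gamma> ** x = 0" "x ** \<gamma> = 0"
  "\<alpha> ** \<gamma> = 0" "\<gamma> ** \<alpha> = 0"
proof -
  show 1: "x ** s = 0" "s ** x = 0"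
    using compl complementary_pair.compl[OF swap] by auto
  show 2: "\<alpha> ** s = 0" "s ** \<alpha> = 0" "\<gamma> ** x = 0" "x ** \<gamma> = 0"
    using 1 block_products_x block_products_s
    by (metis matrix_mul_assoc matrix_mult_zero)+
  show "\<alpha> ** \<gamma> = 0" "\<gamma> ** \<alpha> = 0"
    using 2 block_products_x block_products_s
    by (metis matrix_mul_assoc matrix_mult_zero)+
qed

lemma block_products_null:
  "\<beta> ** x = 0" "x ** \<beta> = 0" "\<beta> ** s = 0" "s ** \<beta> = 0" "\<beta> ** \<alpha> = 0" "\<alpha> ** \<beta> = 0"
  "\<beta> ** \<gamma> = 0" "\<gamma> ** \<beta> = 0" "\<beta> ** \<beta> = \<beta>"
  by (simp_all add: null_proj_def matrix_algebra block_products_x block_products_s block_products_0)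

lemmas block_products = block_products_x block_products_s block_products_0 block_products_null

text \<open>The second copy of each product rule carries one more factor, because products are normalised by
  associating them to the right.\<close>

lemmas block_rules = matrix_algebra block_products block_products[THEN matrix_mult_eq_extend]

lemma blocks_sum: "mat 1 - \<alpha> = \<beta> + \<gamma>"
  by (simp add: null_proj_def)

lemma null_proj_swap: "null_proj s x = \<beta>"
  by (simp add: null_proj_def)

lemma lin_compl_swap:
  assumes "transpose p = p" "transpose q = q"
  shows "lin_compl x s p q \<longleftrightarrow> lin_compl s x q p"
proof -
  have "s ** p + q ** x = transpose (x ** q + p ** s)"
    using assms by (simp add: transpose_add matrix_transpose_mul transpose_blocks)
  then have 1: "s ** p + q ** x = 0 \<longleftrightarrow> x ** q + p ** s = 0"
    by (metis transpose_transpose transpose_zero)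
  have "(\<beta> ** q ** \<beta>) ** (\<beta> ** p ** \<beta>) = transpose ((\<beta> ** p ** \<beta>) ** (\<beta> ** q ** \<beta>))"
    using assms by (simp add: matrix_transpose_mul transpose_blocks matrix_mul_assoc)
  then have 2: "(\<beta> ** q ** \<beta>) ** (\<beta> ** p ** \<beta>) = 0 \<longleftrightarrow> (\<beta> ** p ** \<beta>) ** (\<beta> ** q ** \<beta>) = 0"
    by (metis transpose_transpose transpose_zero)
  show ?thesis
    unfolding lin_compl_def null_proj_swap using 1 2 by blast
qed

text \<open>Multiplying \<open>x q + p s = 0\<close> by the pseudo-inverses reads off all blocks but \<open>\<beta>\<beta>\<close>.\<close>

lemma lin_compl_blocks:
  assumes "lin_compl x s p q"
  shows "\<alpha> ** q = - (X ** p ** s)" "p ** \<gamma> = - (x ** q ** Y)"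
proof -
  have 0: "x ** q + p ** s = 0"
    using assms by (simp add: lin_compl_def)
  have "X ** (x ** q + p ** s) = \<alpha> ** q + X ** p ** s"
    by (simp add: block_rules)
  then show "\<alpha> ** q = - (X ** p ** s)"
    by (simp add: 0 eq_neg_iff_add_eq_0)
  have "(x ** q + p ** s) ** Y = p ** \<gamma> + x ** q ** Y"
    by (simp add: block_rules add.commute)
  then show "p ** \<gamma> = - (x ** q ** Y)"
    by (simp add: 0 eq_neg_iff_add_eq_0)
qed

lemma lin_compl_critical_dir: "lin_compl x s p q \<Longrightarrow> critical_dir x s p"
  using lin_compl_blocks(2)[of p q]
  by (simp add: critical_dir_def lin_compl_def matrix_mul_assoc[symmetric])
    (simp add: block_rules)

text \<open>The complement of \<open>\<alpha>\<close> is \<open>\<beta> + \<gamma>\<close>, and the blocks \<open>\<beta>\<gamma>\<close>, \<open>\<gamma>\<gamma>\<close> and, by symmetry, \<open>\<gamma>\<beta>\<close> of a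
  critical direction vanish.\<close>

lemma critical_dir_compress:
  assumes d: "critical_dir x s d" and sym: "transpose d = d"
  shows "(mat 1 - \<alpha>) ** d ** (mat 1 - \<alpha>) = \<beta> ** d ** \<beta>" "\<gamma> ** d ** \<gamma> = 0"
proof -
  have 0: "(\<beta> + \<gamma>) ** d ** \<gamma> = 0"
    using d by (simp add: critical_dir_def blocks_sum)
  have "\<gamma> ** ((\<beta> + \<gamma>) ** d ** \<gamma>) = \<gamma> ** d ** \<gamma>" "\<beta> ** ((\<beta> + \<gamma>) ** d ** \<gamma>) = \<beta> ** d ** \<gamma>"
    by (simp_all add: block_rules)
  then have gg: "\<gamma> ** d ** \<gamma> = 0" and bg: "\<beta> ** d ** \<gamma> = 0"
    by (simp_all add: 0)
  have gb: "\<gamma> ** d ** \<beta> = 0"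
    using arg_cong[OF bg, of transpose]
    by (simp add: matrix_transpose_mul transpose_blocks sym matrix_mul_assoc)
  show "\<gamma> ** d ** \<gamma> = 0" by (fact gg)
  show "(mat 1 - \<alpha>) ** d ** (mat 1 - \<alpha>) = \<beta> ** d ** \<beta>"
    unfolding blocks_sum using gg bg gb by (simp add: matrix_add_ldistrib matrix_add_rdistrib')
qed

lemma inner_congruence:
  fixes E d h :: "real^'n^'n"
  assumes "transpose E = E"
  shows "inner (E ** d ** E) h = inner d (E ** h ** E)"
proof -
  have "inner h (E ** d ** E) = inner (h ** E) (E ** d)"
    using inner_matrix_mult_right[of h "E ** d" E] assms by simp
  also have "\<dots> = inner (E ** (h ** E)) d"
    using inner_matrix_mult_left[of "h ** E" E d] assms by simp
  finally show ?thesis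
    by (simp add: inner_commute matrix_mul_assoc)
qed

lemma critical_dir_orthogonal:
  assumes d: "critical_dir x s d" and sym: "transpose d = d"
  shows "inner d s = 0"
proof -
  have "inner (\<gamma> ** d ** \<gamma>) s = inner d (\<gamma> ** s ** \<gamma>)"
    by (rule inner_congruence[OF transpose_blocks(6)])
  also have "\<gamma> ** s ** \<gamma> = s"
    by (simp add: block_rules)
  finally show ?thesis
    by (simp add: critical_dir_compress(2)[OF d sym])
qed

text \<open>The bilinear identity behind all kernel arguments: on tangent pairs the inner product is
  minus twice the curvature of the semidefinite cone.\<close>

lemma lin_compl_inner:
  assumes D: "lin_compl x s p q" and sym: "transpose p = p" "transpose q = q"
  shows "inner p q = - 2 * inner s (p ** X ** p)"
proof -
  have aq: "\<alpha> ** q = - (X ** p ** s)"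
    by (rule lin_compl_blocks(1)[OF D])
  then have "(\<alpha> ** q) ** \<alpha> = 0"
    by (simp add: block_rules)
  then have aqa: "\<alpha> ** q ** \<alpha> = 0" .
  have split: "q = \<alpha> ** q + transpose (\<alpha> ** q) + (mat 1 - \<alpha>) ** q ** (mat 1 - \<alpha>)"
    using aqa by (simp add: matrix_transpose_mul transpose_blocks sym matrix_algebra)
  have t1: "inner p (\<alpha> ** q) = - inner s (p ** X ** p)"
  proof -
    have "inner p (X ** p ** s) = inner (p ** X ** p) s"
      using inner_matrix_mult_left[of p "X ** p" s]
      by (simp add: matrix_transpose_mul transpose_blocks sym)
    then show ?thesis
      by (simp add: aq inner_commute)
  qed
  have t2: "inner p (transpose (\<alpha> ** q)) = inner p (\<alpha> ** q)"
    using inner_transpose[of p "\<alpha> ** q"] by (simp add: sym)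
  have "inner p ((mat 1 - \<alpha>) ** q ** (mat 1 - \<alpha>)) = inner ((mat 1 - \<alpha>) ** p ** (mat 1 - \<alpha>)) q"
    by (rule inner_congruence[symmetric]) (simp add: transpose_diff transpose_blocks)
  also have "\<dots> = inner (\<beta> ** p ** \<beta>) q"
    by (simp add: critical_dir_compress[OF lin_compl_critical_dir[OF D] sym(1)])
  also have "\<dots> = inner (\<beta> ** (\<beta> ** p ** \<beta>) ** \<beta>) q"
    by (simp add: block_rules)
  also have "\<dots> = inner (\<beta> ** p ** \<beta>) (\<beta> ** q ** \<beta>)"
    by (rule inner_congruence[OF transpose_blocks(7)])
  also have "\<dots> = inner (mat 1) ((\<beta> ** p ** \<beta>) ** (\<beta> ** q ** \<beta>))"
    using inner_matrix_mult_left[of "mat 1" "\<beta> ** p ** \<beta>" "\<beta> ** q ** \<beta>"]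
    by (simp add: matrix_transpose_mul transpose_blocks sym matrix_mul_assoc)
  also have "\<dots> = 0"
    using D by (simp add: lin_compl_def)
  finally have t3: "inner p ((mat 1 - \<alpha>) ** q ** (mat 1 - \<alpha>)) = 0" .
  show ?thesis
    by (subst split) (simp add: inner_add_right t1 t2 t3)
qed

lemma curvature_nonneg:
  assumes "transpose d = d"
  shows "0 \<le> inner s (d ** X ** d)"
  using psd_inner_nonneg[OF psd_congruence[OF psd_pinv[OF psd_x], of d] psd_s] assms by simp

lemma curvature_zero_iff:
  assumes d: "critical_dir x s d" and sym: "transpose d = d"
  shows "inner s (d ** X ** d) = 0 \<longleftrightarrow> lin_compl x s d 0"
proof
  assume 0: "inner s (d ** X ** d) = 0"
  have "psd (d ** X ** d)"
    using psd_congruence[OF psd_pinv[OF psd_x], of d] sym by simp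
  then have "s ** (d ** X ** d) = 0"
    using psd_inner_zero[OF psd_s _ 0] by blast
  then have 1: "(s ** d) ** X ** transpose (s ** d) = 0"
    by (simp add: matrix_transpose_mul sym transpose_blocks) (metis matrix_mul_assoc matrix_mult_zero(2))
  have "X ** (d ** s) = 0"
  proof (subst matrix_eq, rule allI)
    fix v
    have "inner (d ** s *v v) (X *v (d ** s *v v)) = inner v ((s ** d) ** X ** transpose (s ** d) *v v)"
      using dot_matrix_mult[of v "s ** d" "X *v (d ** s *v v)"]
      by (simp only: matrix_transpose_mul sym transpose_blocks matrix_vector_mul_assoc matrix_mul_assoc)
    then have "X *v (d ** s *v v) = 0"
      by (intro psd_form_zero[OF psd_pinv[OF psd_x]]) (simp add: 1)
    then show "X ** (d ** s) *v v = 0 *v v"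
      by (simp add: matrix_vector_mul_assoc)
  qed
  then have "x ** (X ** (d ** s)) = 0"
    by simp
  then have "\<alpha> ** (d ** s) = 0"
    by (simp add: block_rules)
  moreover have "(mat 1 - \<alpha>) ** d ** \<gamma> ** s = 0"
    using d by (simp add: critical_dir_def)
  then have "(mat 1 - \<alpha>) ** (d ** s) = 0"
    by (simp add: block_rules)
  ultimately have "d ** s = 0"
    by (simp add: matrix_diff_rdistrib)
  then show "lin_compl x s d 0"
    using d by (simp add: lin_compl_def critical_dir_def psd_zero)
next
  assume "lin_compl x s d 0"
  then have "inner d 0 = - 2 * inner s (d ** X ** d)"
    by (intro lin_compl_inner sym) auto
  then show "inner s (d ** X ** d) = 0"
    by simp
qed

text \<open>Uniqueness of the tangent pair with a given difference. If two pairs have the same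
  difference, both components differ by the same matrix \<open>\<delta>\<close> with \<open>x \<delta> + \<delta> s = 0\<close>; taking traces
  with \<open>\<delta>\<close> shows that \<open>\<delta>\<close> lives in the degenerate block, where monotonicity of complementarity
  forces it to vanish.\<close>

lemma lin_compl_unique:
  assumes D: "lin_compl x s p q" "lin_compl x s p' q'" and diff: "p - q = p' - q'"
    and sym: "transpose p = p" "transpose p' = p'" "transpose q = q" "transpose q' = q'"
  shows "p = p'"
proof -
  define \<delta> where "\<delta> = p - p'"
  have q\<delta>: "q - q' = \<delta>"
    using diff by (simp add: \<delta>_def algebra_simps)
  have sym\<delta>: "transpose \<delta> = \<delta>"
    by (simp add: \<delta>_def transpose_diff sym)
  have "x ** \<delta> = x ** q - x ** q'" "\<delta> ** s = p ** s - p' ** s"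
    using matrix_diff_ldistrib[of x q q'] matrix_diff_rdistrib[of p p' s] by (simp_all add: q\<delta> \<delta>_def)
  then have "x ** \<delta> + \<delta> ** s = (x ** q + p ** s) - (x ** q' + p' ** s)"
    by simp
  then have 0: "x ** \<delta> + \<delta> ** s = 0"
    using D by (simp add: lin_compl_def)
  have "inner \<delta> (x ** \<delta>) + inner \<delta> (\<delta> ** s) = 0"
    using arg_cong[OF 0, of "inner \<delta>"] by (simp add: inner_add_right)
  moreover have "inner \<delta> (x ** \<delta>) = inner x (\<delta> ** mat 1 ** \<delta>)"
    using inner_matrix_mult_right[of x \<delta> \<delta>] by (simp add: sym\<delta> inner_commute[of \<delta> "x ** \<delta>"])
  moreover have "inner \<delta> (\<delta> ** s) = inner s (\<delta> ** mat 1 ** \<delta>)"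
    using inner_matrix_mult_left[of s \<delta> \<delta>] by (simp add: sym\<delta> inner_commute[of \<delta> "\<delta> ** s"])
  moreover have dd: "psd (\<delta> ** mat 1 ** \<delta>)"
    using psd_congruence[of "mat 1" \<delta>] by (simp add: sym\<delta> psd_def)
  moreover have "0 \<le> inner x (\<delta> ** mat 1 ** \<delta>)" "0 \<le> inner s (\<delta> ** mat 1 ** \<delta>)"
    using psd_inner_nonneg[OF dd] psd_x psd_s by blast+
  ultimately have "inner x (\<delta> ** mat 1 ** \<delta>) = 0" "inner s (\<delta> ** mat 1 ** \<delta>) = 0"
    by linarith+
  then have "x ** (\<delta> ** mat 1 ** \<delta>) = 0" "s ** (\<delta> ** mat 1 ** \<delta>) = 0"
    using psd_inner_zero dd psd_x psd_s by blast+
  then have "inner (x ** \<delta>) (x ** \<delta>) = 0" "inner (s ** \<delta>) (s ** \<delta>) = 0"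
    by (simp_all add: inner_matrix_mult_right sym\<delta> matrix_mul_assoc[symmetric])
  then have x\<delta>: "x ** \<delta> = 0" and s\<delta>: "s ** \<delta> = 0"
    by simp_all
  have "X ** (x ** \<delta>) = 0" "Y ** (s ** \<delta>) = 0"
    by (simp_all add: x\<delta> s\<delta>)
  then have "\<alpha> ** \<delta> = 0" "\<gamma> ** \<delta> = 0"
    by (simp_all add: block_rules)
  then have b\<delta>: "\<beta> ** \<delta> = \<delta>"
    by (simp add: null_proj_def matrix_diff_rdistrib)
  have "transpose (\<beta> ** \<delta>) = \<delta>"
    by (simp only: b\<delta> sym\<delta>)
  then have \<delta>b: "\<delta> ** \<beta> = \<delta>"
    by (simp add: matrix_transpose_mul sym\<delta> transpose_blocks)
  let ?P = "\<beta> ** p ** \<beta>" and ?P' = "\<beta> ** p' ** \<beta>" and ?Q = "\<beta> ** q ** \<beta>" and ?Q' = "\<beta> ** q' ** \<beta>"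
  have \<delta>P: "\<delta> = ?P - ?P'"
    using b\<delta> \<delta>b unfolding \<delta>_def by (metis matrix_diff_ldistrib matrix_diff_rdistrib)
  have \<delta>Q: "\<delta> = ?Q - ?Q'"
    using b\<delta> \<delta>b unfolding q\<delta>[symmetric] by (metis matrix_diff_ldistrib matrix_diff_rdistrib)
  have psds: "psd ?P" "psd ?P'" "psd ?Q" "psd ?Q'"
    using D by (simp_all add: lin_compl_def)
  have i0: "inner ?P ?Q = 0" "inner ?P' ?Q' = 0"
    using D inner_matrix_mult_left[of "mat 1" ?P ?Q] inner_matrix_mult_left[of "mat 1" ?P' ?Q']
    by (simp_all add: lin_compl_def matrix_transpose_mul transpose_blocks sym matrix_mul_assoc[symmetric])
  have "0 \<le> inner ?P ?Q'" "0 \<le> inner ?P' ?Q"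
    using psds by (auto intro: psd_inner_nonneg)
  then have "inner (?P - ?P') (?Q - ?Q') \<le> 0"
    using i0 by (simp add: inner_diff_left inner_diff_right)
  then have "inner \<delta> \<delta> \<le> 0"
    using \<delta>P \<delta>Q by simp
  then have "\<delta> = 0"
    using inner_ge_zero[of \<delta>] inner_eq_zero_iff[of \<delta>] by linarith
  then show ?thesis
    by (simp add: \<delta>_def)
qed

text \<open>Difference quotients of complementary pairs accumulate at solutions of the linearised system:
  the product condition gives its first-order part after division by the step, and its
  second-order part after compression to the degenerate block, on which \<^term>\<open>x\<close> and \<^term>\<open>s\<close>
  vanish.\<close>

lemma lin_compl_limit:
  fixes p q :: "nat \<Rightarrow> real^'n^'n"
  assumes t: "\<And>n. t n > 0" "t \<longlonglongrightarrow> 0" and p: "p \<longlonglongrightarrow> p0" and q: "q \<longlonglongrightarrow> q0"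
    and psd: "\<And>n. psd (x + t n *\<^sub>R p n)" "\<And>n. psd (s + t n *\<^sub>R q n)"
    and 0: "\<And>n. (x + t n *\<^sub>R p n) ** (s + t n *\<^sub>R q n) = 0"
    and sym: "transpose p0 = p0" "transpose q0 = q0"
  shows "lin_compl x s p0 q0"
proof -
  have nonneg: "0 \<le> inner v (d0 *v v)"
    if u: "\<beta> *v v = v" "A ** \<beta> = 0" "\<And>n. psd (A + t n *\<^sub>R d n)" and d: "d \<longlonglongrightarrow> d0"
    for v A d0 and d :: "nat \<Rightarrow> real^'n^'n"
  proof (rule tendsto_lowerbound)
    show "(\<lambda>n. inner v (d n *v v)) \<longlonglongrightarrow> inner v (d0 *v v)"
      by (intro tendsto_intros tendsto_matrix_vector_mult d)
    have "A *v v = 0"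
      using u(1,2) by (metis matrix_vector_mul_assoc matrix_vector_mult_0)
    then have "inner v ((A + t n *\<^sub>R d n) *v v) = t n * inner v (d n *v v)" for n
      by (simp add: matrix_vector_mult_add_rdistrib scaleR_matrix_vector_assoc[symmetric])
    then have "0 \<le> t n * inner v (d n *v v)" for n
      using psd_nonneg[OF u(3), of v n] by simp
    then have "0 \<le> inner v (d n *v v)" for n
      using t(1)[of n] by (metis zero_le_mult_iff not_less order_less_imp_le)
    then show "\<forall>\<^sub>F n in sequentially. 0 \<le> inner v (d n *v v)"
      by simp
  qed auto
  have compress: "psd (\<beta> ** d0 ** \<beta>)"
    if "A ** \<beta> = 0" "\<And>n. psd (A + t n *\<^sub>R d n)" "d \<longlonglongrightarrow> d0" "transpose d0 = d0"
    for A d0 and d :: "nat \<Rightarrow> real^'n^'n"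
    unfolding psd_def
  proof (intro conjI allI)
    show "transpose (\<beta> ** d0 ** \<beta>) = \<beta> ** d0 ** \<beta>"
      by (simp add: matrix_transpose_mul transpose_blocks that(4) matrix_mul_assoc)
    fix v
    have "inner v (\<beta> ** d0 ** \<beta> *v v) = inner (\<beta> *v v) (d0 *v (\<beta> *v v))"
      using dot_matrix_mult[of v \<beta> "d0 *v (\<beta> *v v)"]
      by (simp only: transpose_blocks matrix_vector_mul_assoc matrix_mul_assoc)
    then show "0 \<le> inner v (\<beta> ** d0 ** \<beta> *v v)"
      using nonneg[of "\<beta> *v v", OF _ that(1,2,3)]
      by (simp add: matrix_vector_mul_assoc block_products)
  qed
  have expand: "t n *\<^sub>R (x ** q n + p n ** s + t n *\<^sub>R (p n ** q n)) = 0" for n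
    using 0[of n] by (simp add: matrix_algebra compl scaleR_add_right algebra_simps)
  have first: "x ** q n + p n ** s + t n *\<^sub>R (p n ** q n) = 0" for n
    using expand[of n] t(1)[of n] by simp
  have "(\<lambda>n. x ** q n + p n ** s + t n *\<^sub>R (p n ** q n)) \<longlonglongrightarrow> x ** q0 + p0 ** s + 0 *\<^sub>R (p0 ** q0)"
    by (intro tendsto_intros tendsto_matrix_mult p q t)
  then have lin: "x ** q0 + p0 ** s = 0"
    unfolding first by (simp add: LIMSEQ_const_iff)
  have "\<beta> ** (p n ** q n) ** \<beta> = 0" for n
  proof -
    have "t n *\<^sub>R (\<beta> ** (p n ** q n) ** \<beta>) = \<beta> ** (x ** q n + p n ** s + t n *\<^sub>R (p n ** q n)) ** \<beta>"
      by (simp add: block_rules)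
    then show ?thesis
      using t(1)[of n] by (simp add: first)
  qed
  moreover have "(\<lambda>n. \<beta> ** (p n ** q n) ** \<beta>) \<longlonglongrightarrow> \<beta> ** (p0 ** q0) ** \<beta>"
    by (intro tendsto_intros tendsto_matrix_mult p q)
  ultimately have second: "\<beta> ** (p0 ** q0) ** \<beta> = 0"
    by (simp add: LIMSEQ_const_iff)
  have "X ** (x ** q0 + p0 ** s) ** \<beta> = \<alpha> ** q0 ** \<beta>" "\<beta> ** (x ** q0 + p0 ** s) ** Y = \<beta> ** p0 ** \<gamma>"
    by (simp_all add: block_rules)
  then have "\<alpha> ** q0 ** \<beta> = 0" "\<beta> ** p0 ** \<gamma> = 0"
    by (simp_all add: lin)
  moreover have "(\<beta> ** p0 ** \<beta>) ** (\<beta> ** q0 ** \<beta>)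
      = \<beta> ** (p0 ** q0) ** \<beta> - \<beta> ** p0 ** (\<alpha> ** q0 ** \<beta>) - (\<beta> ** p0 ** \<gamma>) ** q0 ** \<beta>"
  proof -
    have "(\<beta> ** p0 ** \<beta>) ** (\<beta> ** q0 ** \<beta>) = \<beta> ** p0 ** (mat 1 - \<alpha> - \<gamma>) ** q0 ** \<beta>"
      by (simp add: block_rules null_proj_def[symmetric])
    also have "\<dots> = \<beta> ** (p0 ** q0) ** \<beta> - \<beta> ** p0 ** (\<alpha> ** q0 ** \<beta>) - (\<beta> ** p0 ** \<gamma>) ** q0 ** \<beta>"
      by (simp add: matrix_algebra)
    finally show ?thesis .
  qed
  ultimately have "(\<beta> ** p0 ** \<beta>) ** (\<beta> ** q0 ** \<beta>) = 0"
    by (simp add: second)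
  then show ?thesis
    unfolding lin_compl_def
    using lin compress[OF block_products_null(2) psd(1) p sym(1)]
      compress[OF block_products_null(4) psd(2) q sym(2)] by blast
qed

end

section \<open>The cone of positive semidefinite matrices\<close>

lemma mat_of_sym_sym_of_mat: "transpose A = A \<Longrightarrow> mat_of_sym (sym_of_mat A) = A"
  by (rule sym_of_mat_inverse) simp

lemmas mat_of_sym_simps =
  zero_symmat.rep_eq plus_symmat.rep_eq minus_symmat.rep_eq uminus_symmat.rep_eq scaleR_symmat.rep_eq

lemma norm_mat_of_sym: "norm (mat_of_sym A) = norm A"
  by (simp add: norm_eq_sqrt_inner inner_symmat_eq)

lemma bounded_linear_mat_of_sym: "bounded_linear mat_of_sym"
  by (rule bounded_linear_intro[where K = 1]) (simp_all add: mat_of_sym_simps norm_mat_of_sym)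

lemma inner_sym_outer: "inner X (sym_of_mat (outer v)) = inner v (mat_of_sym X *v v)"
  by (simp add: inner_symmat_eq mat_of_sym_sym_of_mat inner_outer)

lemma psd_cone_iff: "X \<in> psd_cone \<longleftrightarrow> psd (mat_of_sym X)"
  by (simp add: psd_cone_def psd_def)

lemma psd_cone_eq_dual_cone: "psd_cone = dual_cone (range (\<lambda>v. sym_of_mat (outer v)))"
  by (auto simp: psd_cone_def dual_cone_def inner_sym_outer)

lemma closed_convex_cone_psd_cone: "closed_convex_cone psd_cone"
  unfolding psd_cone_eq_dual_cone by (rule closed_convex_cone_dual_cone)

lemma psd_outer: "psd (outer v)"
  by (simp add: psd_def outer_vector_mult inner_commute)

lemma dual_cone_psd_cone: "dual_cone psd_cone = (psd_cone :: 'n::finite symmat set)"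
proof
  show "dual_cone psd_cone \<subseteq> (psd_cone :: 'n symmat set)"
  proof
    fix h :: "'n symmat" assume h: "h \<in> dual_cone psd_cone"
    have "0 \<le> inner h (sym_of_mat (outer v))" for v
      by (rule dual_coneD[OF h]) (simp add: psd_cone_iff mat_of_sym_sym_of_mat psd_outer)
    then show "h \<in> psd_cone"
      by (simp add: psd_cone_def inner_sym_outer)
  qed
  show "(psd_cone :: 'n symmat set) \<subseteq> dual_cone psd_cone"
    by (auto simp: dual_cone_def psd_cone_iff inner_symmat_eq intro: psd_inner_nonneg)
qed

lemma closest_point_nsd_cone: "closest_point nsd_cone a = - closest_point psd_cone (- a)"
proof -
  let ?p = "closest_point psd_cone (- a)"
  have psd: "closed psd_cone" "convex psd_cone" "psd_cone \<noteq> {}"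
    using closed_convex_cone_psd_cone by (auto simp: closed_convex_cone_def)
  have nsd: "closed nsd_cone" "convex nsd_cone" "nsd_cone \<noteq> {}"
    using closed_negations[OF psd(1)] convex_negations[OF psd(2)] psd(3) by simp_all
  have "inner (a + ?p) (q - (- ?p)) \<le> 0" if q: "q \<in> nsd_cone" for q
  proof -
    obtain q' where "q' \<in> psd_cone" "q = - q'"
      using q by blast
    then show ?thesis
      using closest_point_dot[OF psd(2,1), of q' "- a"]
      by (simp add: inner_diff_left inner_diff_right inner_add_left inner_add_right)
  qed
  then have "closest_point nsd_cone (- ?p + (a + ?p)) = - ?p"
    unfolding closest_point_add_eq_iff[OF nsd] using closest_point_in_set[OF psd(1,3)] by blast
  then show ?thesis by simp
qed

lemma closest_point_psd_cone_iff:
  "closest_point psd_cone (x - s) = x \<longleftrightarrow> complementary_pair (mat_of_sym x) (mat_of_sym s)"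
proof -
  have "inner x s = 0 \<longleftrightarrow> mat_of_sym x ** mat_of_sym s = 0" if "psd (mat_of_sym x)" "psd (mat_of_sym s)"
    using psd_inner_zero[OF that] by (auto simp: inner_symmat_eq[symmetric])
      (simp add: inner_symmat_def trace_def)
  then show ?thesis
    using closest_point_cone_iff[OF closed_convex_cone_psd_cone, of x "- s"]
    by (auto simp: dual_cone_psd_cone psd_cone_iff complementary_pair_def)
qed

definition psd_critical_cone :: "'n::finite symmat \<Rightarrow> 'n symmat \<Rightarrow> 'n symmat set" where
  "psd_critical_cone x s = tangent_cone psd_cone x \<inter> perp s"

definition tangent_pair :: "'n::finite symmat \<Rightarrow> 'n symmat \<Rightarrow> 'n symmat \<Rightarrow> 'n symmat \<Rightarrow> bool" where
  "tangent_pair x s p q \<longleftrightarrow>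
     lin_compl (mat_of_sym x) (mat_of_sym s) (mat_of_sym p) (mat_of_sym q)"

locale complementary_symmat =
  fixes x s :: "'n::finite symmat"
  assumes complementary: "complementary_pair (mat_of_sym x) (mat_of_sym s)"
begin

sublocale complementary_pair "mat_of_sym x" "mat_of_sym s"
  by (rule complementary)

lemma swap_symmat: "complementary_symmat s x"
  by (rule complementary_symmat.intro[OF swap])

lemma x_psd: "x \<in> psd_cone"
  using psd_x by (simp add: psd_cone_iff)

lemma closed_convex_cone_psd_critical: "closed_convex_cone (psd_critical_cone x s)"
  unfolding psd_critical_cone_def using closed_convex_cone_psd_cone x_psd
  by (intro closed_convex_cone_Int closed_convex_cone_tangent_cone closed_convex_cone_perp)
    (auto simp: closed_convex_cone_def)

text \<open>For the inclusion of the critical directions in the tangent cone, the arc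
  \<open>(I + t B) x (I + t B)\<^sup>T + t \<beta> d \<beta>\<close> with \<open>B = (I - \<alpha> / 2) d X\<close> stays in the semidefinite
  cone and has velocity \<^term>\<open>d\<close>.\<close>

lemma psd_critical_cone_iff:
  "d \<in> psd_critical_cone x s \<longleftrightarrow> critical_dir (mat_of_sym x) (mat_of_sym s) (mat_of_sym d)"
proof
  let ?x = "mat_of_sym x" and ?s = "mat_of_sym s" and ?d = "mat_of_sym d"
  assume d: "d \<in> psd_critical_cone x s"
  let ?N = "(\<lambda>v. sym_of_mat (outer v)) ` {v. ?x *v v = 0}"
  have "tangent_cone psd_cone x \<subseteq> dual_cone ?N"
  proof (rule tangent_cone_subsetI)
    show "p - x \<in> dual_cone ?N" if "p \<in> psd_cone" for p
      using that by (auto intro!: dual_coneI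
          simp: inner_sym_outer psd_cone_def mat_of_sym_simps matrix_vector_mult_diff_rdistrib)
  qed (use closed_convex_cone_dual_cone[of ?N] in \<open>auto simp: closed_convex_cone_def\<close>)
  then have "d \<in> dual_cone ?N"
    using d by (auto simp: psd_critical_cone_def)
  then have ker: "0 \<le> inner v (?d *v v)" if "?x *v v = 0" for v
    using dual_coneD[of d ?N "sym_of_mat (outer v)"] that by (auto simp: inner_sym_outer)
  have comp: "psd (E ** ?d ** E)" if E: "transpose E = E" "?x ** E = 0" for E
    unfolding psd_def
  proof (intro conjI allI)
    show "transpose (E ** ?d ** E) = E ** ?d ** E"
      by (simp add: matrix_transpose_mul E matrix_mul_assoc)
    fix v
    have "inner v (E ** ?d ** E *v v) = inner (E *v v) (?d *v (E *v v))"
      using dot_matrix_mult[of v E "?d *v (E *v v)"] E(1)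
      by (simp only: matrix_vector_mul_assoc matrix_mul_assoc)
    moreover have "?x *v (E *v v) = 0"
      by (simp add: matrix_vector_mul_assoc E(2))
    ultimately show "0 \<le> inner v (E ** ?d ** E *v v)"
      using ker by simp
  qed
  let ?E = "mat 1 - \<alpha>"
  have E: "transpose ?E = ?E" "?x ** ?E = 0"
    by (simp_all add: transpose_diff transpose_blocks block_rules)
  have "inner (?E ** ?d ** ?E) ?s = inner ?d (?E ** ?s ** ?E)"
    by (rule inner_congruence[OF E(1)])
  also have "?E ** ?s ** ?E = ?s"
    by (simp add: block_rules)
  also have "inner ?d ?s = 0"
    using d by (simp add: psd_critical_cone_def perp_def inner_symmat_eq)
  finally have "?E ** ?d ** ?E ** ?s = 0"
    by (intro psd_inner_zero comp E psd_s)
  then have "?E ** ?d ** ?E ** ?s ** Y = 0"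
    by simp
  then have "?E ** ?d ** \<gamma> = 0"
    by (simp add: block_rules)
  then show "critical_dir ?x ?s ?d"
    unfolding critical_dir_def using comp[OF transpose_blocks(7) block_products_null(2)] by blast
next
  let ?x = "mat_of_sym x" and ?s = "mat_of_sym s" and ?d = "mat_of_sym d"
  assume cd: "critical_dir ?x ?s ?d"
  define B where "B = (mat 1 - (1/2) *\<^sub>R \<alpha>) ** ?d ** X"
  define C where "C = sym_of_mat (B ** ?x ** transpose B)"
  have C: "mat_of_sym C = B ** ?x ** transpose B"
    unfolding C_def by (intro mat_of_sym_sym_of_mat psd_symmetric psd_congruence psd_x)
  have Bx: "B ** ?x = ?d ** \<alpha> - (1/2) *\<^sub>R (\<alpha> ** ?d ** \<alpha>)"
    by (simp add: B_def block_rules)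
  have xB: "?x ** transpose B = \<alpha> ** ?d - (1/2) *\<^sub>R (\<alpha> ** ?d ** \<alpha>)"
    using arg_cong[OF Bx, of transpose]
    by (simp add: matrix_transpose_mul transpose_blocks transpose_diff transpose_scalar
        matrix_mul_assoc)
  have "\<beta> ** ?d ** \<beta> = (mat 1 - \<alpha>) ** ?d ** (mat 1 - \<alpha>)"
    using critical_dir_compress(1)[OF cd] by simp
  also have "\<dots> = ?d - ?d ** \<alpha> - \<alpha> ** ?d + \<alpha> ** ?d ** \<alpha>"
    by (simp add: matrix_algebra)
  finally have bdb: "\<beta> ** ?d ** \<beta> = ?d - ?d ** \<alpha> - \<alpha> ** ?d + \<alpha> ** ?d ** \<alpha>" .
  have feas: "x + (t *\<^sub>R (d + t *\<^sub>R C)) \<in> psd_cone" if t: "t > 0" for t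
  proof -
    let ?M = "mat 1 + t *\<^sub>R B"
    have "?M ** ?x ** transpose ?M + t *\<^sub>R (\<beta> ** ?d ** \<beta>)
        = ?x + t *\<^sub>R (B ** ?x + ?x ** transpose B + \<beta> ** ?d ** \<beta>) + (t * t) *\<^sub>R (B ** ?x ** transpose B)"
      by (simp add: transpose_add transpose_scalar matrix_algebra scaleR_add_right)
    also have "B ** ?x + ?x ** transpose B + \<beta> ** ?d ** \<beta> = ?d"
      unfolding Bx xB bdb by (simp add: algebra_simps scaleR_2[symmetric]
          scaleR_half_double[of "\<alpha> ** ?d ** \<alpha>"])
    finally have "mat_of_sym (x + (t *\<^sub>R (d + t *\<^sub>R C)))
        = ?M ** ?x ** transpose ?M + t *\<^sub>R (\<beta> ** ?d ** \<beta>)"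
      by (simp add: mat_of_sym_simps C scaleR_add_right add.assoc)
    moreover have "psd (?M ** ?x ** transpose ?M + t *\<^sub>R (\<beta> ** ?d ** \<beta>))"
      using t cd unfolding critical_dir_def by (intro psd_add psd_scaleR psd_congruence psd_x) auto
    ultimately show ?thesis
      by (simp add: psd_cone_iff)
  qed
  have "d \<in> tangent_cone psd_cone x"
  proof (rule Lim_in_closed_set)
    show "closed (tangent_cone psd_cone x)"
      using closed_convex_cone_tangent_cone[OF _ x_psd] closed_convex_cone_psd_cone
      by (auto simp: closed_convex_cone_def)
    show "((\<lambda>t. d + t *\<^sub>R C) \<longlongrightarrow> d) (at_right 0)"
      by (rule tendsto_eq_intros refl | simp)+
    show "\<forall>\<^sub>F t in at_right 0. d + t *\<^sub>R C \<in> tangent_cone psd_cone x"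
      using eventually_at_right_less[of "0::real"]
    proof eventually_elim
      case (elim t)
      have "(1 / t) *\<^sub>R (t *\<^sub>R (d + t *\<^sub>R C)) \<in> tangent_cone psd_cone x"
        using elim by (intro tangent_cone_feasible_direction x_psd feas) auto
      then show ?case
        using elim by simp
    qed
  qed auto
  then show "d \<in> psd_critical_cone x s"
    using critical_dir_orthogonal[OF cd] by (simp add: psd_critical_cone_def perp_def inner_symmat_eq)
qed

lemma tangent_pair_swap: "tangent_pair x s p q \<longleftrightarrow> tangent_pair s x q p"
  unfolding tangent_pair_def by (rule lin_compl_swap) simp_all

lemma tangent_pair_critical: "tangent_pair x s p q \<Longrightarrow> p \<in> psd_critical_cone x s"
  unfolding psd_critical_cone_iff tangent_pair_def by (rule lin_compl_critical_dir)

lemma curv_form_eq: "curv_form s x d = inner (mat_of_sym s) (mat_of_sym d ** X ** mat_of_sym d)"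
  unfolding curv_form_def
  using trace_matrix_mult_transpose[of "mat_of_sym s"] by simp

lemma tangent_pair_inner: "tangent_pair x s p q \<Longrightarrow> inner p q = - 2 * curv_form s x p"
  unfolding tangent_pair_def curv_form_eq inner_symmat_eq by (rule lin_compl_inner) simp_all

lemma curv_form_nonneg: "0 \<le> curv_form s x d"
  unfolding curv_form_eq by (rule curvature_nonneg) simp

lemma curv_form_zero_iff:
  "d \<in> psd_critical_cone x s \<Longrightarrow> curv_form s x d = 0 \<longleftrightarrow> tangent_pair x s d 0"
  unfolding curv_form_eq psd_critical_cone_iff tangent_pair_def
  by (simp add: curvature_zero_iff mat_of_sym_simps)

text \<open>Tangent pairs with one component zero are exactly what polarity sees of the opposite critical
  cone. Testing with \<open>\<gamma> B + B\<^sup>T \<gamma>\<close> for arbitrary \<open>B\<close> annihilates the range of \<^term>\<open>s\<close>, and testing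
  with squares in the degenerate block gives semidefiniteness there.\<close>

lemma tangent_pair_zero_iff: "tangent_pair x s p 0 \<longleftrightarrow> p \<in> dual_cone (psd_critical_cone s x)"
proof
  interpret sw: complementary_symmat s x
    by (rule swap_symmat)
  let ?x = "mat_of_sym x" and ?s = "mat_of_sym s" and ?p = "mat_of_sym p"
  {
    assume D: "tangent_pair x s p 0"
    then have ps: "?p ** ?s = 0" and psd: "psd (\<beta> ** ?p ** \<beta>)"
      by (simp_all add: tangent_pair_def lin_compl_def mat_of_sym_simps)
    have "?p ** ?s ** Y = 0"
      by (simp add: ps)
    then have pg: "?p ** \<gamma> = 0"
      by (simp add: block_rules)
    have "transpose (?p ** \<gamma>) = 0"
      by (simp add: pg)
    then have gp: "\<gamma> ** ?p = 0"
      by (simp add: matrix_transpose_mul transpose_blocks)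
    show "p \<in> dual_cone (psd_critical_cone s x)"
    proof (rule dual_coneI)
      fix d assume "d \<in> psd_critical_cone s x"
      then have cd: "critical_dir ?s ?x (mat_of_sym d)"
        by (simp add: sw.psd_critical_cone_iff)
      let ?d = "mat_of_sym d"
      have "inner ?p ?d = inner ((mat 1 - \<gamma>) ** ?p ** (mat 1 - \<gamma>)) ?d"
        by (simp add: matrix_algebra pg gp)
      also have "\<dots> = inner ?p ((mat 1 - \<gamma>) ** ?d ** (mat 1 - \<gamma>))"
        by (rule inner_congruence) (simp add: transpose_diff transpose_blocks)
      also have "\<dots> = inner ?p (\<beta> ** ?d ** \<beta>)"
        using sw.critical_dir_compress(1)[OF cd] by (simp add: null_proj_swap)
      also have "\<dots> = inner ?p (\<beta> ** (\<beta> ** ?d ** \<beta>) ** \<beta>)"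
        by (simp add: block_rules)
      also have "\<dots> = inner (\<beta> ** ?p ** \<beta>) (\<beta> ** ?d ** \<beta>)"
        by (rule inner_congruence[OF transpose_blocks(7), symmetric])
      also have "\<dots> \<ge> 0"
        using psd_inner_nonneg[OF _ psd] cd by (simp add: critical_dir_def null_proj_swap)
      finally show "0 \<le> inner p d"
        by (simp add: inner_symmat_eq)
    qed
  next
    assume p: "p \<in> dual_cone (psd_critical_cone s x)"
    have test: "0 \<le> inner ?p D" if "transpose D = D" "critical_dir ?s ?x D" for D
      using dual_coneD[OF p, of "sym_of_mat D"] that
      by (simp add: sw.psd_critical_cone_iff inner_symmat_eq mat_of_sym_sym_of_mat)
    have zero: "inner (\<gamma> ** ?p) B = 0" for B
    proof -
      have crit: "critical_dir ?s ?x (\<gamma> ** E + transpose E ** \<gamma>)" for E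
        unfolding critical_dir_def null_proj_swap by (simp add: block_rules psd_zero)
      have pos: "0 \<le> inner ?p (\<gamma> ** E + transpose E ** \<gamma>)" for E
        by (rule test[OF _ crit])
          (simp add: transpose_add matrix_transpose_mul transpose_blocks add.commute)
      have tr: "inner ?p (\<gamma> ** E + transpose E ** \<gamma>) = 2 * inner (\<gamma> ** ?p) E" for E
        using inner_transpose[of ?p "\<gamma> ** E"]
        by (simp add: inner_add_right matrix_transpose_mul transpose_blocks)
          (simp add: inner_matrix_mult_left transpose_blocks)
      show ?thesis
        using pos[of B] pos[of "- B"] unfolding tr by simp
    qed
    then have gp: "\<gamma> ** ?p = 0"
      by (metis inner_eq_zero_iff)
    have "transpose (\<gamma> ** ?p) = 0"
      by (simp add: gp)
    then have pg: "?p ** \<gamma> = 0"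
      by (simp add: matrix_transpose_mul transpose_blocks)
    then have "?p ** \<gamma> ** ?s = 0"
      by simp
    then have ps: "?p ** ?s = 0"
      by (simp add: block_rules)
    have "psd (\<beta> ** ?p ** \<beta>)"
      unfolding psd_def
    proof (intro conjI allI)
      show "transpose (\<beta> ** ?p ** \<beta>) = \<beta> ** ?p ** \<beta>"
        by (simp add: matrix_transpose_mul transpose_blocks matrix_mul_assoc)
      fix v
      have o: "outer (\<beta> *v v) = \<beta> ** outer v ** \<beta>"
        using outer_congruence[of \<beta> v] by (simp add: transpose_blocks)
      have "critical_dir ?s ?x (outer (\<beta> *v v))"
        unfolding critical_dir_def null_proj_swap
        using psd_congruence[OF psd_outer[of "\<beta> *v v"], of \<beta>]
        by (simp add: o block_rules transpose_blocks)
      then have "0 \<le> inner ?p (outer (\<beta> *v v))"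
        by (intro test) simp
      then have "0 \<le> inner (\<beta> ** ?p ** \<beta>) (outer v)"
        unfolding o inner_congruence[OF transpose_blocks(7)] .
      then show "0 \<le> inner v (\<beta> ** ?p ** \<beta> *v v)"
        by (simp add: inner_outer)
    qed
    then show "tangent_pair x s p 0"
      by (simp add: tangent_pair_def lin_compl_def mat_of_sym_simps ps psd_zero)
  }
qed

lemma tangent_pair_unique:
  assumes "tangent_pair x s p q" "tangent_pair x s p' q'" "p - q = p' - q'"
  shows "p = p'"
proof -
  have "mat_of_sym p - mat_of_sym q = mat_of_sym p' - mat_of_sym q'"
    using arg_cong[OF assms(3), of mat_of_sym] by (simp add: mat_of_sym_simps)
  then have "mat_of_sym p = mat_of_sym p'"
    by (rule lin_compl_unique[OF assms(1,2)[unfolded tangent_pair_def]]) simp_all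
  then show ?thesis
    by (simp add: mat_of_sym_inject)
qed

text \<open>The projection onto the semidefinite cone is directionally differentiable: all accumulation
  points of its bounded difference quotients solve the linearised complementarity system, whose
  solution is unique. No perturbation theory of eigenvalues enters.\<close>

lemma B_differentiable_closest_point_psd_cone:
  obtains f' where "B_differentiable (closest_point psd_cone) f' (x - s)"
    "\<And>p q. f' (p - q) = p \<longleftrightarrow> tangent_pair x s p q"
proof -
  define u where
    "u H t = (closest_point psd_cone (x - s + t *\<^sub>R H) - closest_point psd_cone (x - s)) /\<^sub>R t" for H t
  have base: "closest_point psd_cone (x - s) = x"
    using closest_point_psd_cone_iff complementary by blast
  have C: "closed psd_cone" "convex psd_cone" "psd_cone \<noteq> {}"
    using closed_convex_cone_psd_cone by (auto simp: closed_convex_cone_def)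
  have bound: "u H t \<in> cball 0 (norm H)" if "t > 0" for H t
    using closest_point_lipschitz_norm[OF C, of "x - s + t *\<^sub>R H" "x - s"] that
    by (simp add: u_def divide_simps mult.commute)
  have cluster: "tangent_pair x s l (l - H)"
    if t: "\<And>n. t n > 0" "t \<longlonglongrightarrow> 0" and l: "(\<lambda>n. u H (t n)) \<longlonglongrightarrow> l" for t :: "nat \<Rightarrow> real" and H l
  proof -
    have x': "closest_point psd_cone (x - s + t n *\<^sub>R H) = x + t n *\<^sub>R u H (t n)" for n
      using t(1)[of n] by (simp add: u_def base)
    have "closest_point psd_cone ((x + t n *\<^sub>R u H (t n)) - (s + t n *\<^sub>R (u H (t n) - H)))
        = x + t n *\<^sub>R u H (t n)" for n
      using x'[of n] by (simp add: algebra_simps)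
    then have cp: "complementary_pair (mat_of_sym x + t n *\<^sub>R mat_of_sym (u H (t n)))
        (mat_of_sym s + t n *\<^sub>R mat_of_sym (u H (t n) - H))" for n
      unfolding closest_point_psd_cone_iff by (simp add: mat_of_sym_simps)
    have "(\<lambda>n. mat_of_sym (u H (t n))) \<longlonglongrightarrow> mat_of_sym l"
      "(\<lambda>n. mat_of_sym (u H (t n) - H)) \<longlonglongrightarrow> mat_of_sym (l - H)"
      by (intro bounded_linear.tendsto[OF bounded_linear_mat_of_sym] tendsto_intros l)+
    then show ?thesis
      unfolding tangent_pair_def using cp
      by (intro lin_compl_limit[of t] t) (auto simp: complementary_pair_def)
  qed
  define f' where "f' H = (SOME l. tangent_pair x s l (l - H))" for H
  have subseq: "\<exists>l r. strict_mono r \<and> (\<lambda>n. u H (t (r n))) \<longlonglongrightarrow> l \<and> tangent_pair x s l (l - H)"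
    if t: "\<And>n. t n > 0" "t \<longlonglongrightarrow> 0" for t :: "nat \<Rightarrow> real" and H
  proof -
    have "\<forall>n. u H (t n) \<in> cball 0 (norm H)"
      using bound t(1) by blast
    then obtain l r where r: "strict_mono r" "((\<lambda>n. u H (t n)) \<circ> r) \<longlonglongrightarrow> l"
      using compact_cball[of "0::'n symmat" "norm H"] unfolding compact_def by metis
    then have "tangent_pair x s l (l - H)"
      using LIMSEQ_subseq_LIMSEQ[OF t(2) r(1)] t(1)
      by (intro cluster[of "t \<circ> r"]) (auto simp: o_def)
    then show ?thesis
      using r by (auto simp: o_def)
  qed
  have f': "tangent_pair x s (f' H) (f' H - H)" for H
  proof -
    have "(\<lambda>n. inverse (real (Suc n))) \<longlonglongrightarrow> 0"
      by (rule LIMSEQ_inverse_real_of_nat)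
    then have "\<exists>l. tangent_pair x s l (l - H)"
      using subseq[of "\<lambda>n. inverse (real (Suc n))" H] by auto
    then show ?thesis
      unfolding f'_def by (rule someI_ex)
  qed
  have iff: "f' (p - q) = p \<longleftrightarrow> tangent_pair x s p q" for p q
  proof
    assume "f' (p - q) = p"
    then show "tangent_pair x s p q"
      using f'[of "p - q"] by simp
  next
    assume "tangent_pair x s p q"
    then show "f' (p - q) = p"
      by (rule tangent_pair_unique[OF f']) simp
  qed
  have "(u H \<longlongrightarrow> f' H) (at_right 0)" for H
  proof (rule tendstoI, rule ccontr)
    fix e :: real assume e: "e > 0" "\<not> (\<forall>\<^sub>F t in at_right 0. dist (u H t) (f' H) < e)"
    have "\<forall>b>0. \<exists>t>0. t < b \<and> e \<le> dist (u H t) (f' H)"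
      using e(2) unfolding eventually_at_right_field not_less[symmetric] by blast
    then have "\<exists>t. 0 < t \<and> t < 1 / real (Suc n) \<and> e \<le> dist (u H t) (f' H)" for n
      by simp
    then obtain t where t: "\<And>n. 0 < t n" "\<And>n. t n < 1 / real (Suc n)"
      "\<And>n. e \<le> dist (u H (t n)) (f' H)"
      by metis
    have "t \<longlonglongrightarrow> 0"
      by (rule tendsto_sandwich[OF _ _ tendsto_const LIMSEQ_inverse_real_of_nat])
        (use t in \<open>auto intro!: always_eventually less_imp_le simp: inverse_eq_divide\<close>)
    then obtain l r where l: "(\<lambda>n. u H (t (r n))) \<longlonglongrightarrow> l" "tangent_pair x s l (l - H)"
      using subseq[of t H, OF t(1)] by blast
    have "l = f' H"
      using iff[of l "l - H"] l(2) by simp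
    then have "(\<lambda>n. dist (u H (t (r n))) (f' H)) \<longlonglongrightarrow> dist (f' H) (f' H)"
      using l(1) by (intro tendsto_intros) simp
    then have "e \<le> dist (f' H) (f' H)"
      using t(3) by (intro tendsto_lowerbound) auto
    then show False
      using e(1) by simp
  qed
  then have "B_differentiable (closest_point psd_cone) f' (x - s)"
    unfolding B_differentiable_def u_def using closest_point_lipschitz_norm[OF C]
    by (intro conjI exI[of _ "1::real"]) auto
  then show thesis
    using that iff by blast
qed

end

section \<open>The linearised optimality system\<close>

lemma B_differentiable_add_const:
  "B_differentiable f f' a \<Longrightarrow> B_differentiable (\<lambda>p. f p + k) f' a"
  using B_differentiable_add[OF _ B_differentiable_const, of f f' a k] by simp

lemma B_differentiable_diff_const:
  "B_differentiable f f' a \<Longrightarrow> B_differentiable (\<lambda>p. f p - k) f' a"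
  using B_differentiable_add_const[of f f' a "- k"] by simp

lemma B_differentiable_compose_at:
  "B_differentiable f f' k \<Longrightarrow> g a = k \<Longrightarrow> B_differentiable g g' a \<Longrightarrow>
     B_differentiable (\<lambda>p. f (g p)) (\<lambda>h. f' (g' h)) a"
  using B_differentiable_compose by blast

lemma neg_add_eq_zero_iff: "- u + v = 0 \<longleftrightarrow> v = (u :: 'a::ab_group_add)"
  by (simp add: add_eq_0_iff)

text \<open>A vanishing quadratic form of a positive semidefinite operator has a vanishing derivative.\<close>

lemma psd_operator_zero:
  fixes Q :: "'a::real_inner \<Rightarrow> 'a"
  assumes lin: "linear Q" and sym: "\<And>x y. inner (Q x) y = inner x (Q y)"
    and pos: "\<And>x. 0 \<le> inner x (Q x)" and 0: "inner (Q d) d = 0"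
  shows "Q d = 0"
proof -
  have "0 \<le> t * (2 * inner (Q d) (Q d)) + t\<^sup>2 * inner (Q d) (Q (Q d))" for t
    using pos[of "d + t *\<^sub>R Q d"] 0 sym[of d "Q d"]
    by (simp add: linear_add[OF lin] linear_scale[OF lin] inner_add_left inner_add_right
        inner_commute power2_eq_square algebra_simps)
  from linear_coefficient_zero[OF this] show ?thesis
    by simp
qed

locale kkt_point = complementary_symmat x s
  for x s :: "'p::finite symmat" +
  fixes Q :: "'p symmat \<Rightarrow> 'p symmat" and A :: "'p symmat \<Rightarrow> real^'m::finite"
    and P :: "'p symmat set" and z :: "'p symmat"
  assumes Q: "linear Q" and Q_sym: "\<And>x y. inner (Q x) y = inner x (Q y)"
    and Q_pos: "\<And>x. 0 \<le> inner x (Q x)"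
    and A: "linear A"
    and P: "polyhedron P" and xP: "x \<in> P"
    and normal: "z \<in> dual_cone (tangent_cone P x)"
begin

definition K :: "'p symmat set" where
  "K = tangent_cone P x \<inter> perp z"

lemma closed_convex_cone_critical: "closed_convex_cone (psd_critical_cone s x)"
  by (rule complementary_symmat.closed_convex_cone_psd_critical[OF swap_symmat])

lemma closed_convex_cone_K: "closed_convex_cone K"
  unfolding K_def
  by (intro closed_convex_cone_Int closed_convex_cone_tangent_cone closed_convex_cone_perp
      polyhedron_imp_convex P xP)

lemma S_set_eq: "S_set P x z = dual_cone K"
  unfolding K_def by (rule S_set_eq_dual_cone[OF P xP normal])

lemma inner_adjoint: "inner (adjoint A y) d = inner y (A d)"
  using adjoint_works[OF A, of d y] by (simp add: inner_commute)

lemma linear_adjoint: "linear (adjoint A)"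
  by (rule adjoint_linear[OF A])

lemma tangent_pair_zero_left_iff: "tangent_pair x s 0 h \<longleftrightarrow> h \<in> dual_cone (psd_critical_cone x s)"
  using complementary_symmat.tangent_pair_zero_iff[OF swap_symmat, of h] tangent_pair_swap[of 0 h] by simp

text \<open>A failing second-order condition yields a direction along which both nonnegative terms, the
  quadratic form and the curvature, vanish separately. The next two conditions exclude such
  directions for the primal and for the dual problem.\<close>

definition primal_nondegenerate :: bool where
  "primal_nondegenerate \<longleftrightarrow>
     (\<forall>d. d \<in> K \<longrightarrow> d \<in> dual_cone (psd_critical_cone s x) \<longrightarrow> A d = 0 \<longrightarrow> Q d = 0 \<longrightarrow> d = 0)"

definition dual_nondegenerate :: bool where
  "dual_nondegenerate \<longleftrightarrow>
     (\<forall>y d. d \<in> dual_cone K \<longrightarrow> - (adjoint A y + d) \<in> dual_cone (psd_critical_cone x s) \<longrightarrow>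
        y = 0 \<and> d = 0)"

text \<open>The linearised optimality system, in the variables common to all four mappings, has only the
  zero solution. The last premise encodes the complementarity of \<open>dx \<in> K\<close> and \<open>dz \<in> K\<^sup>*\<close>.\<close>

definition trivial_kernel :: bool where
  "trivial_kernel \<longleftrightarrow>
     (\<forall>dx ds dy dz. Q dx - adjoint A dy - dz - ds = 0 \<longrightarrow> A dx = 0 \<longrightarrow> tangent_pair x s dx ds \<longrightarrow>
        closest_point K (dx - dz) = dx \<longrightarrow> dx = 0 \<and> ds = 0 \<and> dy = 0 \<and> dz = 0)"

lemma closest_point_K_iff:
  "closest_point K (dx - dz) = dx \<longleftrightarrow> dx \<in> K \<and> dz \<in> dual_cone K \<and> inner dx dz = 0"
  using closest_point_cone_iff[OF closed_convex_cone_K, of dx "- dz"] by simp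

text \<open>A primal degenerate direction is a kernel element with all multiplier components zero, a dual
  degenerate direction one with \<open>dx = 0\<close>. Conversely, pairing the stationarity equation with \<open>dx\<close>
  equates a nonnegative number with a nonpositive one.\<close>

lemma trivial_kernel_iff: "trivial_kernel \<longleftrightarrow> primal_nondegenerate \<and> dual_nondegenerate"
proof
  assume ker: trivial_kernel
  have Q0: "Q 0 = 0" and A0: "A 0 = 0" and adj0: "adjoint A 0 = 0"
    by (simp_all add: linear_0 Q A linear_adjoint)
  have K0: "0 \<in> K" and dK0: "0 \<in> dual_cone K"
    by (simp_all add: closed_convex_cone_zero closed_convex_cone_K closed_convex_cone_dual_cone)
  have primal_nondegenerate
    unfolding primal_nondegenerate_def
  proof (intro allI impI)
    fix d assume "d \<in> K" "d \<in> dual_cone (psd_critical_cone s x)" "A d = 0" "Q d = 0"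
    then show "d = 0"
      using ker[unfolded trivial_kernel_def, rule_format, of d 0 0 0] dK0
      unfolding closest_point_K_iff by (simp add: tangent_pair_zero_iff adj0)
  qed
  moreover have dual_nondegenerate
    unfolding dual_nondegenerate_def
  proof (intro allI impI)
    fix y d assume "d \<in> dual_cone K" "- (adjoint A y + d) \<in> dual_cone (psd_critical_cone x s)"
    then show "y = 0 \<and> d = 0"
      using ker[unfolded trivial_kernel_def, rule_format, of 0 y d "- (adjoint A y + d)"] K0
      unfolding closest_point_K_iff by (simp add: tangent_pair_zero_left_iff Q0 A0)
  qed
  ultimately show "primal_nondegenerate \<and> dual_nondegenerate" ..
next
  assume nd: "primal_nondegenerate \<and> dual_nondegenerate"
  show trivial_kernel
    unfolding trivial_kernel_def closest_point_K_iff
  proof (intro allI impI)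
    fix dx ds dy dz
    assume eq: "Q dx - adjoint A dy - dz - ds = 0" and Adx: "A dx = 0" and D: "tangent_pair x s dx ds"
      and dxz: "dx \<in> K \<and> dz \<in> dual_cone K \<and> inner dx dz = 0"
    have crit: "dx \<in> psd_critical_cone x s"
      by (rule tangent_pair_critical[OF D])
    have "Q dx = adjoint A dy + dz + ds"
      using eq by (simp add: algebra_simps)
    then have "inner (Q dx) dx = inner (adjoint A dy) dx + inner dz dx + inner ds dx"
      by (simp add: inner_add_left)
    also have "\<dots> = - 2 * curv_form s x dx"
      using dxz tangent_pair_inner[OF D] inner_commute[of dz dx] inner_commute[of ds dx]
      by (simp add: inner_adjoint Adx)
    finally have "inner (Q dx) dx = - 2 * curv_form s x dx" .
    then have "inner (Q dx) dx = 0" "curv_form s x dx = 0"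
      using Q_pos[of dx] curv_form_nonneg[of dx] by (simp_all add: inner_commute)
    then have Qdx: "Q dx = 0" and "tangent_pair x s dx 0"
      using psd_operator_zero[OF Q Q_sym Q_pos] curv_form_zero_iff[OF crit] by auto
    then have dx: "dx = 0"
      using nd Adx dxz by (auto simp: primal_nondegenerate_def tangent_pair_zero_iff)
    have ds: "ds = - (adjoint A dy + dz)"
      using eq Qdx by (simp add: algebra_simps)
    have "tangent_pair x s 0 (- (adjoint A dy + dz))"
      using D unfolding dx ds .
    then have "dy = 0 \<and> dz = 0"
      using nd dxz unfolding dual_nondegenerate_def tangent_pair_zero_left_iff by blast
    then show "dx = 0 \<and> ds = 0 \<and> dy = 0 \<and> dz = 0"
      using dx ds by (simp add: linear_0 linear_adjoint)
  qed
qed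

text \<open>On feasible tangent directions the two contributions \<open>\<langle>s, d\<rangle>\<close> and \<open>\<langle>z, d\<rangle>\<close> to the linear
  term are nonnegative, so the primal critical cone splits into the two critical cones.\<close>

lemma crit_P_eq:
  assumes kkt: "Q x - adjoint A y - z - s + c = 0"
  shows "crit_P Q A c P x x = {(d, d) | d. A d = 0 \<and> d \<in> psd_critical_cone x s \<and> d \<in> K}"
proof -
  have grad: "Q x + c = adjoint A y + z + s"
    using kkt by (simp add: algebra_simps)
  have s_normal: "s \<in> dual_cone (tangent_cone psd_cone x)"
  proof -
    have "closest_point psd_cone (x + (- s)) = x"
      using closest_point_psd_cone_iff[of x s] complementary by simp
    then have "s \<in> dual_cone psd_cone" "inner x s = 0"
      unfolding closest_point_cone_iff[OF closed_convex_cone_psd_cone] by simp_all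
    then show ?thesis
      unfolding dual_cone_tangent_cone_iff[OF x_psd]
      by (auto simp: dual_cone_def inner_diff_right inner_commute)
  qed
  have "inner (Q x + c) d = 0 \<longleftrightarrow> inner d s = 0 \<and> inner d z = 0"
    if "A d = 0" "d \<in> tangent_cone psd_cone x" "d \<in> tangent_cone P x" for d
    using dual_coneD[OF s_normal that(2)] dual_coneD[OF normal that(3)] that(1)
    unfolding grad by (auto simp: inner_add_left inner_adjoint inner_commute[of d])
  then show ?thesis
    unfolding crit_P_def psd_critical_cone_def K_def perp_def by auto
qed

lemma SOSC_P_iff:
  assumes kkt: "Q x - adjoint A y - z - s + c = 0"
  shows "SOSC_P Q A c P x x s \<longleftrightarrow> primal_nondegenerate"
proof
  assume sosc: "SOSC_P Q A c P x x s"
  show primal_nondegenerate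
    unfolding primal_nondegenerate_def
  proof (intro allI impI)
    fix d assume d: "d \<in> K" "d \<in> dual_cone (psd_critical_cone s x)" "A d = 0" "Q d = 0"
    then have D: "tangent_pair x s d 0"
      by (simp add: tangent_pair_zero_iff)
    note crit = tangent_pair_critical[OF D]
    have "(d, d) \<in> crit_P Q A c P x x"
      using d crit by (simp add: crit_P_eq[OF kkt])
    moreover have "\<not> inner (Q d) d + 2 * curv_form s x d > 0"
      using d(4) curv_form_zero_iff[OF crit] D by simp
    ultimately show "d = 0"
      using sosc unfolding SOSC_P_def by (auto simp: zero_prod_def)
  qed
next
  assume nd: primal_nondegenerate
  show "SOSC_P Q A c P x x s"
    unfolding SOSC_P_def crit_P_eq[OF kkt]
  proof (clarify, rule ccontr)
    fix d assume d: "(d, d) \<noteq> 0" "A d = 0" "d \<in> psd_critical_cone x s" "d \<in> K"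
      and "\<not> 0 < inner (Q d) d + 2 * curv_form s x d"
    then have "inner (Q d) d = 0" "curv_form s x d = 0"
      using Q_pos[of d] curv_form_nonneg[of d] by (simp_all add: inner_commute)
    then have "Q d = 0" "d \<in> dual_cone (psd_critical_cone s x)"
      using psd_operator_zero[OF Q Q_sym Q_pos] curv_form_zero_iff[OF d(3)] tangent_pair_zero_iff
      by auto
    then have "d = 0"
      using nd d unfolding primal_nondegenerate_def by blast
    then show False
      using d(1) by (simp add: zero_prod_def)
  qed
qed

lemma Q_inj_on_range: "w \<in> range Q \<Longrightarrow> Q w = 0 \<Longrightarrow> w = 0"
proof -
  assume "w \<in> range Q" "Q w = 0"
  then obtain e where "w = Q e" by blast
  then have "inner w w = 0"
    using Q_sym[of e w] \<open>Q w = 0\<close> by simp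
  then show "w = 0" by simp
qed

lemma SOSC_D_iff: "SOSC_D Q A P (range Q) x s z \<longleftrightarrow> dual_nondegenerate"
proof -
  interpret sw: complementary_symmat s x
    by (rule swap_symmat)
  have crit_iff: "(ds, dy, dw, dz) \<in> crit_D Q A P (range Q) x s z \<longleftrightarrow>
      dw \<in> range Q \<and> ds + adjoint A dy - Q dw + dz = 0 \<and> ds \<in> psd_critical_cone s x \<and>
      dz \<in> dual_cone K" for ds dy dw dz
    by (simp add: crit_D_def psd_critical_cone_def S_set_eq)
  have Q0: "Q 0 = 0"
    by (simp add: linear_0 Q)
  show ?thesis
  proof
    assume sosc: "SOSC_D Q A P (range Q) x s z"
    show dual_nondegenerate
      unfolding dual_nondegenerate_def
    proof (intro allI impI)
      fix y d assume d: "d \<in> dual_cone K" "- (adjoint A y + d) \<in> dual_cone (psd_critical_cone x s)"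
      let ?h = "- (adjoint A y + d)"
      have D: "tangent_pair s x ?h 0"
        using d(2) by (simp add: sw.tangent_pair_zero_iff)
      note crit = sw.tangent_pair_critical[OF D]
      have "0 \<in> range Q"
        using Q0 by (metis rangeI)
      then have mem: "(?h, y, 0, d) \<in> crit_D Q A P (range Q) x s z"
        unfolding crit_iff using crit d(1) by (simp add: Q0)
      have "inner (Q 0) 0 + 2 * curv_form x s ?h = 0"
        using sw.curv_form_zero_iff[OF crit] D by simp
      then have "(?h, y, 0 :: 'p symmat, d) = 0"
        using sosc[unfolded SOSC_D_def, rule_format, OF mem] by auto
      then show "y = 0 \<and> d = 0"
        by (simp add: zero_prod_def)
    qed
  next
    assume nd: dual_nondegenerate
    have "inner (Q dw) dw + 2 * curv_form x s ds > 0"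
      if mem: "(ds, dy, dw, dz) \<in> crit_D Q A P (range Q) x s z" and nz: "(ds, dy, dw, dz) \<noteq> 0"
      for ds dy dw dz
    proof (rule ccontr)
      note m = mem[unfolded crit_iff]
      assume "\<not> ?thesis"
      then have "inner (Q dw) dw = 0" "curv_form x s ds = 0"
        using Q_pos[of dw] sw.curv_form_nonneg[of ds] by (simp_all add: inner_commute)
      then have Qdw: "Q dw = 0" and D: "ds \<in> dual_cone (psd_critical_cone x s)"
        using psd_operator_zero[OF Q Q_sym Q_pos] m sw.curv_form_zero_iff[of ds]
          sw.tangent_pair_zero_iff[of ds] by auto
      have dw: "dw = 0"
        using m Qdw Q_inj_on_range by blast
      have ds: "ds = - (adjoint A dy + dz)"
        using m Qdw by (simp add: algebra_simps eq_neg_iff_add_eq_0)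
      then have "dy = 0 \<and> dz = 0"
        using nd m D unfolding dual_nondegenerate_def by blast
      moreover from this have "ds = 0"
        using ds by (simp add: linear_0 linear_adjoint)
      ultimately show False
        using nz dw by (simp add: zero_prod_def)
    qed
    then show "SOSC_D Q A P (range Q) x s z"
      unfolding SOSC_D_def by blast
  qed
qed

text \<open>A normal to the cone in the primal strict Robinson condition is, up to sign, a multiplier
  direction \<open>(y, d)\<close> as in the dual nondegeneracy condition.\<close>

lemma SRCQ_P_iff: "SRCQ_P A P x s z \<longleftrightarrow> dual_nondegenerate"
proof -
  let ?C = "psd_critical_cone x s"
  let ?M = "{(A d, d) - (0, e) | d e. d \<in> ?C \<and> e \<in> K}"
  note C = closed_convex_cone_psd_critical and K = closed_convex_cone_K
  have mem: "(\<eta>, \<zeta>) \<in> dual_cone ?M \<longleftrightarrow>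
      - \<zeta> \<in> dual_cone K \<and> adjoint A \<eta> + \<zeta> \<in> dual_cone ?C" for \<eta> \<zeta>
  proof
    assume h: "(\<eta>, \<zeta>) \<in> dual_cone ?M"
    have 1: "0 \<le> inner \<eta> (A d) + inner \<zeta> (d - e)" if "d \<in> ?C" "e \<in> K" for d e
    proof -
      have "(A d, d) - (0, e) \<in> ?M"
        using that by blast
      from dual_coneD[OF h this] show ?thesis
        by simp
    qed
    have "0 \<le> inner (- \<zeta>) e" if "e \<in> K" for e
      using 1[OF closed_convex_cone_zero[OF C] that] by (simp add: linear_0 A)
    moreover have "0 \<le> inner (adjoint A \<eta> + \<zeta>) d" if "d \<in> ?C" for d
      using 1[OF that closed_convex_cone_zero[OF K]] by (simp add: inner_add_left inner_adjoint)
    ultimately show "- \<zeta> \<in> dual_cone K \<and> adjoint A \<eta> + \<zeta> \<in> dual_cone ?C"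
      by (auto simp: dual_cone_def)
  next
    assume h: "- \<zeta> \<in> dual_cone K \<and> adjoint A \<eta> + \<zeta> \<in> dual_cone ?C"
    show "(\<eta>, \<zeta>) \<in> dual_cone ?M"
    proof (rule dual_coneI)
      fix m assume "m \<in> ?M"
      then obtain d e where m: "m = (A d, d) - (0, e)" "d \<in> ?C" "e \<in> K"
        by blast
      have "0 \<le> inner (- \<zeta>) e" "0 \<le> inner (adjoint A \<eta> + \<zeta>) d"
        using h m(2,3) dual_coneD by blast+
      then show "0 \<le> inner (\<eta>, \<zeta>) m"
        by (simp add: m(1) inner_add_left inner_adjoint inner_diff_right)
    qed
  qed
  have "?M = UNIV \<longleftrightarrow> (\<forall>h\<in>dual_cone ?M. h = 0)"
  proof (rule convex_cone_UNIV_iff)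
    show "0 \<in> ?M"
      using closed_convex_cone_zero[OF C] closed_convex_cone_zero[OF K]
      by (force simp: zero_prod_def linear_0 A)
    show "m + n \<in> ?M" if mn: "m \<in> ?M" "n \<in> ?M" for m n
    proof -
      obtain d e d' e' where de: "m = (A d, d) - (0, e)" "n = (A d', d') - (0, e')"
        "d \<in> ?C" "e \<in> K" "d' \<in> ?C" "e' \<in> K"
        using mn by blast
      have "m + n = (A (d + d'), d + d') - (0, e + e')"
        by (simp add: de linear_add[OF A])
      then show ?thesis
        using closed_convex_cone_add[OF C de(3,5)] closed_convex_cone_add[OF K de(4,6)] by blast
    qed
    show "r *\<^sub>R m \<in> ?M" if rm: "0 \<le> r" "m \<in> ?M" for r m
    proof -
      obtain d e where de: "m = (A d, d) - (0, e)" "d \<in> ?C" "e \<in> K"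
        using rm by blast
      have "r *\<^sub>R m = (A (r *\<^sub>R d), r *\<^sub>R d) - (0, r *\<^sub>R e)"
        by (simp add: de linear_scale[OF A] scaleR_diff_right)
      then show ?thesis
        using closed_convex_cone_scale[OF C de(2) rm(1)] closed_convex_cone_scale[OF K de(3) rm(1)]
        by blast
    qed
  qed
  also have "\<dots> \<longleftrightarrow> (\<forall>\<eta> \<zeta>. - \<zeta> \<in> dual_cone K \<longrightarrow> adjoint A \<eta> + \<zeta> \<in> dual_cone ?C \<longrightarrow> \<eta> = 0 \<and> \<zeta> = 0)"
    using mem by (auto simp: zero_prod_def)
  also have "\<dots> \<longleftrightarrow> dual_nondegenerate"
    unfolding dual_nondegenerate_def
  proof (intro iffI allI impI)
    fix y d
    assume *: "\<forall>\<eta> \<zeta>. - \<zeta> \<in> dual_cone K \<longrightarrow> adjoint A \<eta> + \<zeta> \<in> dual_cone ?C \<longrightarrow> \<eta> = 0 \<and> \<zeta> = 0"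
      and "d \<in> dual_cone K" "- (adjoint A y + d) \<in> dual_cone ?C"
    then show "y = 0 \<and> d = 0"
      using *[rule_format, of "- d" "- y"] by (simp add: linear_neg[OF linear_adjoint])
  next
    fix \<eta> \<zeta>
    assume *: "\<forall>y d. d \<in> dual_cone K \<longrightarrow> - (adjoint A y + d) \<in> dual_cone ?C \<longrightarrow> y = 0 \<and> d = 0"
      and "- \<zeta> \<in> dual_cone K" "adjoint A \<eta> + \<zeta> \<in> dual_cone ?C"
    then show "\<eta> = 0 \<and> \<zeta> = 0"
      using *[rule_format, of "- \<zeta>" "- \<eta>"]
      by (simp add: linear_neg[OF linear_adjoint] add.commute)
  qed
  finally show ?thesis
    by (simp add: SRCQ_P_def psd_critical_cone_def K_def)
qed

text \<open>Here the summand \<open>K\<^sup>*\<close> returns \<open>K\<close> by the bipolar theorem, the subspace \<open>A\<^sup>* \<real>\<^sup>m\<close> forces \<open>A h = 0\<close>,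
  and testing with \<open>w = Q h\<close> forces \<open>Q h = 0\<close>.\<close>

lemma SRCQ_D_iff: "SRCQ_D Q A P (range Q) x s z \<longleftrightarrow> primal_nondegenerate"
proof -
  let ?C = "psd_critical_cone s x"
  let ?M = "{ds + dz + adjoint A y - Q w | ds dz y w. ds \<in> ?C \<and> dz \<in> dual_cone K \<and> w \<in> range Q}"
  note C = closed_convex_cone_critical
  note K = closed_convex_cone_dual_cone[of K]
  have 0: "Q 0 = 0" "adjoint A 0 = 0"
    by (simp_all add: linear_0 Q linear_adjoint)
  have R: "subspace (range Q)"
    using linear_subspace_image[OF Q subspace_UNIV] .
  have mem: "h \<in> dual_cone ?M \<longleftrightarrow> h \<in> K \<and> h \<in> dual_cone ?C \<and> A h = 0 \<and> Q h = 0" for h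
  proof
    assume h: "h \<in> dual_cone ?M"
    have 1: "0 \<le> inner h (ds + dz + adjoint A y - Q w)"
      if "ds \<in> ?C" "dz \<in> dual_cone K" "w \<in> range Q" for ds dz y w
      using that by (intro dual_coneD[OF h]) blast
    note C0 = closed_convex_cone_zero[OF C] and K0 = closed_convex_cone_zero[OF K]
    note R0 = subspace_0[OF R]
    have "h \<in> dual_cone ?C"
      using 1[OF _ K0 R0, of _ 0] by (auto intro!: dual_coneI simp: 0)
    moreover have "h \<in> dual_cone (dual_cone K)"
      using 1[OF C0 _ R0, of _ 0] by (auto intro!: dual_coneI simp: 0)
    then have "h \<in> K"
      by (simp add: bipolar[OF closed_convex_cone_K])
    moreover have "0 \<le> inner h (adjoint A (- A h))"
      using 1[OF C0 K0 R0, of "- A h"] by (simp add: 0)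
    then have "inner (A h) (A h) \<le> 0"
      using inner_adjoint[of "- A h" h] by (simp add: inner_commute[of h])
    then have "A h = 0"
      using inner_ge_zero[of "A h"] inner_eq_zero_iff[of "A h"] by linarith
    moreover have "0 \<le> inner h (- Q (Q h))"
      using 1[OF C0 K0 rangeI, of 0 h] by (simp add: 0)
    then have "inner (Q h) (Q h) \<le> 0"
      using Q_sym[of h "Q h"] by simp
    then have "Q h = 0"
      using inner_ge_zero[of "Q h"] inner_eq_zero_iff[of "Q h"] by linarith
    ultimately show "h \<in> K \<and> h \<in> dual_cone ?C \<and> A h = 0 \<and> Q h = 0"
      by blast
  next
    assume h: "h \<in> K \<and> h \<in> dual_cone ?C \<and> A h = 0 \<and> Q h = 0"
    show "h \<in> dual_cone ?M"
    proof (rule dual_coneI)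
      fix m assume "m \<in> ?M"
      then obtain ds dz y w where m: "m = ds + dz + adjoint A y - Q w" "ds \<in> ?C" "dz \<in> dual_cone K"
        by blast
      have "0 \<le> inner h ds"
        using h m(2) dual_coneD by blast
      moreover have "0 \<le> inner h dz"
        using dual_coneD[OF m(3), of h] h by (simp add: inner_commute)
      moreover have "inner h (adjoint A y) = 0"
        using inner_adjoint[of y h] h by (simp add: inner_commute)
      moreover have "inner h (Q w) = 0"
        using Q_sym[of h w] h by simp
      ultimately show "0 \<le> inner h m"
        by (simp add: m(1) inner_add_right inner_diff_right)
    qed
  qed
  have "?M = UNIV \<longleftrightarrow> (\<forall>h\<in>dual_cone ?M. h = 0)"
  proof (rule convex_cone_UNIV_iff)
    have "0 + 0 + adjoint A 0 - Q 0 \<in> ?M"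
      using closed_convex_cone_zero[OF C] closed_convex_cone_zero[OF K] subspace_0[OF R] by blast
    then show "0 \<in> ?M"
      by (simp add: 0)
    show "m + n \<in> ?M" if mn: "m \<in> ?M" "n \<in> ?M" for m n
    proof -
      obtain ds dz y w ds' dz' y' w' where *: "m = ds + dz + adjoint A y - Q w"
        "n = ds' + dz' + adjoint A y' - Q w'" "ds \<in> ?C" "dz \<in> dual_cone K" "w \<in> range Q"
        "ds' \<in> ?C" "dz' \<in> dual_cone K" "w' \<in> range Q"
        using mn by blast
      have "m + n = (ds + ds') + (dz + dz') + adjoint A (y + y') - Q (w + w')"
        by (simp add: * linear_add[OF Q] linear_add[OF linear_adjoint])
      then show ?thesis
        using closed_convex_cone_add[OF C *(3,6)] closed_convex_cone_add[OF K *(4,7)]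
          subspace_add[OF R *(5,8)] by blast
    qed
    show "r *\<^sub>R m \<in> ?M" if rm: "0 \<le> r" "m \<in> ?M" for r m
    proof -
      obtain ds dz y w where *: "m = ds + dz + adjoint A y - Q w"
        "ds \<in> ?C" "dz \<in> dual_cone K" "w \<in> range Q"
        using rm by blast
      have "r *\<^sub>R m = r *\<^sub>R ds + r *\<^sub>R dz + adjoint A (r *\<^sub>R y) - Q (r *\<^sub>R w)"
        by (simp add: * linear_scale[OF Q] linear_scale[OF linear_adjoint] scaleR_add_right
            scaleR_diff_right)
      then show ?thesis
        using closed_convex_cone_scale[OF C *(2) rm(1)] closed_convex_cone_scale[OF K *(3) rm(1)]
          subspace_scale[OF R *(4)] by blast
    qed
  qed
  also have "\<dots> \<longleftrightarrow> primal_nondegenerate"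
    unfolding primal_nondegenerate_def using mem by blast
  finally show ?thesis
    by (simp add: SRCQ_D_def psd_critical_cone_def S_set_eq)
qed

section \<open>Isolated calmness of the solution mappings\<close>

lemmas B_differentiable_intros =
  B_differentiable_Pair B_differentiable_diff_const B_differentiable_add_const
  B_differentiable_add B_differentiable_diff B_differentiable_minus
  B_differentiable_linear[OF Q] B_differentiable_linear[OF A] B_differentiable_linear[OF linear_adjoint]
  B_differentiable_fst B_differentiable_snd B_differentiable_id

lemma B_differentiable_proj_P: "B_differentiable (closest_point P) (closest_point K) (x - z)"
  unfolding K_def by (rule B_differentiable_closest_point_polyhedron[OF P xP normal])

lemma projections:
  "closest_point psd_cone (x - s) = x" "closest_point psd_cone (s - x) = s" "closest_point P (x - z) = x"
proof -
  show "closest_point psd_cone (x - s) = x" "closest_point psd_cone (s - x) = s"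
    using closest_point_psd_cone_iff complementary swap by blast+
  have "closed P" "convex P" "P \<noteq> {}"
    using P xP by (auto intro: polyhedron_imp_closed polyhedron_imp_convex)
  from closest_point_add_eq_iff[OF this, of x "- z"] show "closest_point P (x - z) = x"
    using xP normal dual_cone_tangent_cone_iff[OF xP] by auto
qed

text \<open>In the proofs below each mapping is rewritten with component selectors instead of tuple patterns
  and with the projection onto the semidefinite cone, so that its derivative \<open>G'\<close> is read off
  componentwise. The kernel of \<open>G'\<close> then consists of solutions of the linearised optimality system
  together with components that they determine, here \<open>du = dx\<close> and \<open>dv = - dz\<close>.\<close>

lemma isolated_calm_G_P_iff:
  assumes kkt: "Q x - adjoint A y - z - s + c = 0" and feas: "A x = b"
  shows "isolated_calm (inverse_map UNIV (G_P Q A c b P)) 0 (x, x, s, y, z, - z) \<longleftrightarrow> trivial_kernel"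
proof -
  obtain f' where f': "B_differentiable (closest_point psd_cone) f' (x - s)"
    "\<And>p q. f' (p - q) = p \<longleftrightarrow> tangent_pair x s p q"
    using B_differentiable_closest_point_psd_cone by blast
  define G where "G = (\<lambda>p :: 'p symmat \<times> 'p symmat \<times> 'p symmat \<times> (real^'m) \<times> 'p symmat \<times> 'p symmat.
    (Q (fst p) - adjoint A (fst (snd (snd (snd p)))) - fst (snd (snd (snd (snd p)))) - fst (snd (snd p)) + c,
     fst (snd (snd (snd (snd p)))) + snd (snd (snd (snd (snd p)))),
     fst p - closest_point psd_cone (fst p - fst (snd (snd p))),
     A (fst p) - b,
     fst p - fst (snd p),
     - fst (snd p) + closest_point P (fst (snd p) + snd (snd (snd (snd (snd p)))))))"
  define G' where "G' = (\<lambda>p :: 'p symmat \<times> 'p symmat \<times> 'p symmat \<times> (real^'m) \<times> 'p symmat \<times> 'p symmat.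
    (Q (fst p) - adjoint A (fst (snd (snd (snd p)))) - fst (snd (snd (snd (snd p)))) - fst (snd (snd p)),
     fst (snd (snd (snd (snd p)))) + snd (snd (snd (snd (snd p)))),
     fst p - f' (fst p - fst (snd (snd p))),
     A (fst p),
     fst p - fst (snd p),
     - fst (snd p) + closest_point K (fst (snd p) + snd (snd (snd (snd (snd p)))))))"
  let ?a = "(x, x, s, y, z, - z)"
  have G: "G_P Q A c b P = G"
    by (auto simp: G_P_def G_def fun_eq_iff closest_point_nsd_cone)
  have dG: "B_differentiable G G' ?a"
    unfolding G_def G'_def
    by (intro B_differentiable_intros B_differentiable_compose_at[OF f'(1)]
        B_differentiable_compose_at[OF B_differentiable_proj_P]) simp_all
  have G0: "G ?a = 0"
    by (simp add: G_def projections kkt feas zero_prod_def)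
  have "(\<forall>h. G' h = 0 \<longrightarrow> h = 0) \<longleftrightarrow> trivial_kernel"
  proof
    assume *: "\<forall>h. G' h = 0 \<longrightarrow> h = 0"
    show trivial_kernel
      unfolding trivial_kernel_def
    proof (intro allI impI)
      fix dx ds dy dz
      assume "Q dx - adjoint A dy - dz - ds = 0" "A dx = 0" "tangent_pair x s dx ds"
        "closest_point K (dx - dz) = dx"
      then have "G' (dx, dx, ds, dy, dz, - dz) = 0"
        using f'(2)[of dx ds] by (simp add: G'_def zero_prod_def)
      then have "(dx, dx, ds, dy, dz, - dz) = 0"
        using * by blast
      then show "dx = 0 \<and> ds = 0 \<and> dy = 0 \<and> dz = 0"
        by (simp add: zero_prod_def)
    qed
  next
    assume ker: trivial_kernel
    show "\<forall>h. G' h = 0 \<longrightarrow> h = 0"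
    proof (intro allI impI)
      fix h assume "G' h = 0"
      moreover obtain dx du ds dy dz dv where h: "h = (dx, du, ds, dy, dz, dv)"
        by (cases h) auto
      ultimately have 1: "Q dx - adjoint A dy - dz - ds = 0" "dz + dv = 0" "dx - f' (dx - ds) = 0"
        "A dx = 0" "dx - du = 0" "- du + closest_point K (du + dv) = 0"
        unfolding G'_def by (simp_all only: fst_conv snd_conv zero_prod_def prod.inject)
      then have dv: "dv = - dz"
        by (simp add: eq_neg_iff_add_eq_0 add.commute)
      have du: "du = dx"
        using 1(5) by simp
      have "tangent_pair x s dx ds"
        using 1(3) f'(2)[of dx ds] by simp
      moreover have "closest_point K (dx - dz) = dx"
        using 1(6) by (simp add: du dv neg_add_eq_zero_iff)
      ultimately have "dx = 0 \<and> ds = 0 \<and> dy = 0 \<and> dz = 0"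
        using 1(1,4) by (intro ker[unfolded trivial_kernel_def, rule_format])
      then show "h = 0"
        using du dv by (simp add: h zero_prod_def)
    qed
  qed
  then show ?thesis
    using isolated_calm_inverse_map_iff[OF dG subspace_UNIV UNIV_I G0] by (simp add: G)
qed

text \<open>Here \<open>ds\<close> is eliminated by the stationarity equation.\<close>

lemma isolated_calm_F_P_iff:
  assumes kkt: "Q x - adjoint A y - z - s + c = 0" and feas: "A x = b"
  shows "isolated_calm (inverse_map UNIV (F_P Q A c b P)) 0 (x, x, y, z) \<longleftrightarrow> trivial_kernel"
proof -
  obtain f' where f': "B_differentiable (closest_point psd_cone) f' (x - s)"
    "\<And>p q. f' (p - q) = p \<longleftrightarrow> tangent_pair x s p q"
    using B_differentiable_closest_point_psd_cone by blast
  define G where "G = (\<lambda>p :: 'p symmat \<times> 'p symmat \<times> (real^'m) \<times> 'p symmat.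
    (fst p - closest_point psd_cone
       (fst p - (Q (fst p) - adjoint A (fst (snd (snd p))) - snd (snd (snd p)) + c)),
     - fst (snd p) + closest_point P (fst (snd p) - snd (snd (snd p))),
     A (fst p) - b,
     fst p - fst (snd p)))"
  define G' where "G' = (\<lambda>p :: 'p symmat \<times> 'p symmat \<times> (real^'m) \<times> 'p symmat.
    (fst p - f' (fst p - (Q (fst p) - adjoint A (fst (snd (snd p))) - snd (snd (snd p)))),
     - fst (snd p) + closest_point K (fst (snd p) - snd (snd (snd p))),
     A (fst p),
     fst p - fst (snd p)))"
  let ?a = "(x, x, y, z)"
  have s: "Q x - adjoint A y - z + c = s"
    using kkt by (simp add: algebra_simps)
  have G: "F_P Q A c b P = G"
    by (auto simp: F_P_def G_def fun_eq_iff closest_point_nsd_cone algebra_simps)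
  have dG: "B_differentiable G G' ?a"
    unfolding G_def G'_def
    by (intro B_differentiable_intros B_differentiable_compose_at[OF f'(1)]
        B_differentiable_compose_at[OF B_differentiable_proj_P]) (simp_all add: s)
  have G0: "G ?a = 0"
    by (simp add: G_def projections s feas zero_prod_def)
  have "(\<forall>h. G' h = 0 \<longrightarrow> h = 0) \<longleftrightarrow> trivial_kernel"
  proof
    assume *: "\<forall>h. G' h = 0 \<longrightarrow> h = 0"
    show trivial_kernel
      unfolding trivial_kernel_def
    proof (intro allI impI)
      fix dx ds dy dz
      assume 1: "Q dx - adjoint A dy - dz - ds = 0" "A dx = 0" "tangent_pair x s dx ds"
        "closest_point K (dx - dz) = dx"
      then have ds: "Q dx - adjoint A dy - dz = ds"
        by simp
      have "G' (dx, dx, dy, dz) = 0"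
        using 1 f'(2)[of dx ds] by (simp add: G'_def ds zero_prod_def)
      then have "(dx, dx, dy, dz) = 0"
        using * by blast
      then show "dx = 0 \<and> ds = 0 \<and> dy = 0 \<and> dz = 0"
        using ds by (simp add: zero_prod_def linear_0 Q linear_adjoint)
    qed
  next
    assume ker: trivial_kernel
    show "\<forall>h. G' h = 0 \<longrightarrow> h = 0"
    proof (intro allI impI)
      fix h assume "G' h = 0"
      moreover obtain dx du dy dz where h: "h = (dx, du, dy, dz)"
        by (cases h) auto
      ultimately have 1: "dx - f' (dx - (Q dx - adjoint A dy - dz)) = 0"
        "A dx = 0" "dx - du = 0" "- du + closest_point K (du - dz) = 0"
        unfolding G'_def by (simp_all only: fst_conv snd_conv zero_prod_def prod.inject)
      have du: "du = dx"
        using 1(3) by simp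
      have "tangent_pair x s dx (Q dx - adjoint A dy - dz)"
        using 1(1) f'(2)[of dx "Q dx - adjoint A dy - dz"] by simp
      moreover have "closest_point K (dx - dz) = dx"
        using 1(4) by (simp add: du neg_add_eq_zero_iff)
      ultimately have "dx = 0 \<and> Q dx - adjoint A dy - dz = 0 \<and> dy = 0 \<and> dz = 0"
        using 1(2) by (intro ker[unfolded trivial_kernel_def, rule_format]) simp_all
      then show "h = 0"
        using du by (simp add: h zero_prod_def)
    qed
  qed
  then show ?thesis
    using isolated_calm_inverse_map_iff[OF dG subspace_UNIV UNIV_I G0] by (simp add: G)
qed

text \<open>In the dual mappings the variable \<open>w\<close> is determined by \<open>Q w = Q x\<close> within the range of
  \<^term>\<open>Q\<close>, which \<^term>\<open>Q\<close> maps onto itself injectively.\<close>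

lemma Q_range_preimage: "\<exists>w\<in>range Q. Q w = Q d"
proof -
  obtain p r where "p \<in> span (range Q)" "\<And>v. v \<in> span (range Q) \<Longrightarrow> orthogonal r v" "d = p + r"
    using orthogonal_subspace_decomp_exists[of "range Q" d] by metis
  moreover have "span (range Q) = range Q"
    using linear_subspace_image[OF Q subspace_UNIV] by (simp add: span_eq_iff)
  ultimately have "p \<in> range Q" "d = p + r" "inner r (Q (Q r)) = 0"
    by (auto simp: orthogonal_def)
  moreover from this have "Q r = 0"
    using Q_sym[of r "Q r"] by simp
  ultimately show ?thesis
    by (auto simp: linear_add[OF Q] intro!: bexI[of _ p])
qed

lemma isolated_calm_F_D_iff:
  assumes kkt: "Q x - adjoint A y - z - s + c = 0" and feas: "A x = b"
    and w: "w \<in> range Q" "Q x = Q w"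
  shows "isolated_calm (inverse_map (dom_F_D (range Q)) (F_D Q A c b P)) 0 (s, y, w, z, x)
    \<longleftrightarrow> trivial_kernel"
proof -
  obtain f' where f': "B_differentiable (closest_point psd_cone) f' (s - x)"
    "\<And>p q. f' (q - p) = q \<longleftrightarrow> tangent_pair x s p q"
    using complementary_symmat.B_differentiable_closest_point_psd_cone[OF swap_symmat] tangent_pair_swap
    by metis
  define G where "G = (\<lambda>p :: 'p symmat \<times> (real^'m) \<times> 'p symmat \<times> 'p symmat \<times> 'p symmat.
    (A (snd (snd (snd (snd p)))) - b,
     Q (fst (snd (snd p))) - Q (snd (snd (snd (snd p)))),
     - fst p - adjoint A (fst (snd p)) + Q (fst (snd (snd p))) - fst (snd (snd (snd p))) + c,
     fst p - closest_point psd_cone (fst p - snd (snd (snd (snd p)))),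
     - snd (snd (snd (snd p))) + closest_point P (snd (snd (snd (snd p))) - fst (snd (snd (snd p))))))"
  define G' where "G' = (\<lambda>p :: 'p symmat \<times> (real^'m) \<times> 'p symmat \<times> 'p symmat \<times> 'p symmat.
    (A (snd (snd (snd (snd p)))),
     Q (fst (snd (snd p))) - Q (snd (snd (snd (snd p)))),
     - fst p - adjoint A (fst (snd p)) + Q (fst (snd (snd p))) - fst (snd (snd (snd p))),
     fst p - f' (fst p - snd (snd (snd (snd p)))),
     - snd (snd (snd (snd p))) + closest_point K (snd (snd (snd (snd p))) - fst (snd (snd (snd p))))))"
  let ?a = "(s, y, w, z, x)"
  have Pc: "closed P" "convex P" "P \<noteq> {}"
    using P xP by (auto intro: polyhedron_imp_closed polyhedron_imp_convex)
  have G: "F_D Q A c b P = G"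
    by (auto simp: F_D_def G_def fun_eq_iff closest_point_nsd_cone prox_theta[OF Pc])
  have dG: "B_differentiable G G' ?a"
    unfolding G_def G'_def
    by (intro B_differentiable_intros B_differentiable_compose_at[OF f'(1)]
        B_differentiable_compose_at[OF B_differentiable_proj_P]) simp_all
  have eq: "- s - adjoint A y + Q w - z + c = 0"
    using kkt w(2) by (simp add: algebra_simps)
  have G0: "G ?a = 0"
    by (simp add: G_def projections feas w(2) eq zero_prod_def)
  have aD: "?a \<in> dom_F_D (range Q)"
    using w(1) by (simp add: dom_F_D_def)
  have D: "subspace (dom_F_D (range Q) :: ('p symmat \<times> (real^'m) \<times> 'p symmat \<times> 'p symmat \<times> 'p symmat) set)"
    using linear_subspace_image[OF Q subspace_UNIV]
    by (auto simp: subspace_def dom_F_D_def zero_prod_def)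
  have "(\<forall>h\<in>dom_F_D (range Q). G' h = 0 \<longrightarrow> h = 0) \<longleftrightarrow> trivial_kernel"
  proof
    assume *: "\<forall>h\<in>dom_F_D (range Q). G' h = 0 \<longrightarrow> h = 0"
    show trivial_kernel
      unfolding trivial_kernel_def
    proof (intro allI impI)
      fix dx ds dy dz
      assume 1: "Q dx - adjoint A dy - dz - ds = 0" "A dx = 0" "tangent_pair x s dx ds"
        "closest_point K (dx - dz) = dx"
      obtain dw where dw: "dw \<in> range Q" "Q dw = Q dx"
        using Q_range_preimage by blast
      have "- ds - adjoint A dy + Q dx - dz = 0"
        using 1(1) by (simp add: algebra_simps)
      then have "G' (ds, dy, dw, dz, dx) = 0"
        using 1 f'(2)[of ds dx] by (simp add: G'_def dw zero_prod_def)
      moreover have "(ds, dy, dw, dz, dx) \<in> dom_F_D (range Q)"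
        using dw by (simp add: dom_F_D_def)
      ultimately have "(ds, dy, dw, dz, dx) = 0"
        using * by blast
      then show "dx = 0 \<and> ds = 0 \<and> dy = 0 \<and> dz = 0"
        by (simp add: zero_prod_def)
    qed
  next
    assume ker: trivial_kernel
    show "\<forall>h\<in>dom_F_D (range Q). G' h = 0 \<longrightarrow> h = 0"
    proof (intro ballI impI)
      fix h :: "'p symmat \<times> (real^'m) \<times> 'p symmat \<times> 'p symmat \<times> 'p symmat"
      assume hD: "h \<in> dom_F_D (range Q)" and "G' h = 0"
      moreover obtain ds dy dw dz dx where h: "h = (ds, dy, dw, dz, dx)"
        by (cases h) auto
      ultimately have 1: "A dx = 0" "Q dw - Q dx = 0" "- ds - adjoint A dy + Q dw - dz = 0"
        "ds - f' (ds - dx) = 0" "- dx + closest_point K (dx - dz) = 0"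
        unfolding G'_def by (simp_all only: fst_conv snd_conv zero_prod_def prod.inject)
      have Qdw: "Q dw = Q dx"
        using 1(2) by simp
      have "Q dx - adjoint A dy - dz - ds = 0"
        using 1(3) by (simp add: Qdw algebra_simps)
      moreover have "tangent_pair x s dx ds"
        using 1(4) f'(2)[of ds dx] by simp
      moreover have "closest_point K (dx - dz) = dx"
        using 1(5) by (simp add: neg_add_eq_zero_iff)
      ultimately have 0: "dx = 0 \<and> ds = 0 \<and> dy = 0 \<and> dz = 0"
        using 1(1) by (intro ker[unfolded trivial_kernel_def, rule_format])
      have "dw \<in> range Q" "Q dw = 0"
        using hD Qdw 0 linear_0[OF Q] by (simp_all add: h dom_F_D_def)
      then have "dw = 0"
        by (rule Q_inj_on_range)
      then show "h = 0"
        using 0 by (simp add: h zero_prod_def)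
    qed
  qed
  then show ?thesis
    using isolated_calm_inverse_map_iff[OF dG D aD G0] by (simp add: G)
qed

lemma theta_z: "theta P z = ereal (- inner x z)"
  using normal dual_cone_tangent_cone_iff[OF xP] by (intro theta_normal[OF xP]) blast

lemma isolated_calm_G_D_iff:
  assumes kkt: "Q x - adjoint A y - z - s + c = 0" and feas: "A x = b"
    and w: "w \<in> range Q" "Q x = Q w"
  shows "isolated_calm (inverse_map (dom_G_D (range Q)) (G_D Q A c b P)) 0
      (s, y, w, (z, real_of_ereal (theta P z)), x, x, (- x, - 1)) \<longleftrightarrow> trivial_kernel"
proof -
  obtain f' where f': "B_differentiable (closest_point psd_cone) f' (s - x)"
    "\<And>p q. f' (q - p) = q \<longleftrightarrow> tangent_pair x s p q"
    using complementary_symmat.B_differentiable_closest_point_psd_cone[OF swap_symmat] tangent_pair_swap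
    by metis
  let ?E = "epi (theta P)" and ?KE = "epi_critical_cone K x"
  note KE = closed_convex_cone_epi_critical_cone[of K x]
  define G where "G = (\<lambda>p :: 'p symmat \<times> (real^'m) \<times> 'p symmat \<times> ('p symmat \<times> real) \<times> 'p symmat \<times>
      'p symmat \<times> ('p symmat \<times> real).
    (fst (snd (snd (snd (snd p)))) - fst (snd (snd (snd (snd (snd p))))),
     A (fst (snd (snd (snd (snd p))))) - b,
     Q (fst (snd (snd p))) - Q (fst (snd (snd (snd (snd p))))),
     (fst (snd (snd (snd (snd p)))), 0) + snd (snd (snd (snd (snd (snd p))))) + (0, 1),
     - fst p - adjoint A (fst (snd p)) + Q (fst (snd (snd p))) - fst (fst (snd (snd (snd p)))) + c,
     fst p - closest_point psd_cone (fst p - fst (snd (snd (snd (snd (snd p)))))),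
     - fst (snd (snd (snd p))) +
       closest_point ?E (fst (snd (snd (snd p))) + snd (snd (snd (snd (snd (snd p))))))))"
  define G' where "G' = (\<lambda>p :: 'p symmat \<times> (real^'m) \<times> 'p symmat \<times> ('p symmat \<times> real) \<times> 'p symmat \<times>
      'p symmat \<times> ('p symmat \<times> real).
    (fst (snd (snd (snd (snd p)))) - fst (snd (snd (snd (snd (snd p))))),
     A (fst (snd (snd (snd (snd p))))),
     Q (fst (snd (snd p))) - Q (fst (snd (snd (snd (snd p))))),
     (fst (snd (snd (snd (snd p)))), 0 :: real) + snd (snd (snd (snd (snd (snd p))))),
     - fst p - adjoint A (fst (snd p)) + Q (fst (snd (snd p))) - fst (fst (snd (snd (snd p)))),
     fst p - f' (fst p - fst (snd (snd (snd (snd (snd p)))))),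
     - fst (snd (snd (snd p))) +
       closest_point ?KE (fst (snd (snd (snd p))) + snd (snd (snd (snd (snd (snd p))))))))"
  let ?a = "(s, y, w, (z, - inner x z), x, x, (- x, - 1))"
  have G: "G_D Q A c b P = G"
    by (auto simp: G_D_def G_def fun_eq_iff closest_point_nsd_cone add.commute)
  have dE: "B_differentiable (closest_point ?E) (closest_point ?KE) ((z, - inner x z) + (- x, - 1))"
    and E0: "closest_point ?E ((z, - inner x z) + (- x, - 1)) = (z, - inner x z)"
    using B_differentiable_closest_point_epi[OF P xP normal] unfolding K_def by blast+
  have dG: "B_differentiable G G' ?a"
    unfolding G_def G'_def
    by (intro B_differentiable_intros B_differentiable_const B_differentiable_compose_at[OF f'(1)]
        B_differentiable_compose_at[OF dE]) simp_all
  have eq: "- s - adjoint A y + Q w - z + c = 0"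
    using kkt w(2) by (simp add: algebra_simps)
  have G0: "G ?a = 0"
    using E0 by (simp add: G_def projections feas w(2) eq zero_prod_def)
  have aD: "?a \<in> dom_G_D (range Q)"
    using w(1) by (simp add: dom_G_D_def)
  have D: "subspace (dom_G_D (range Q) :: ('p symmat \<times> (real^'m) \<times> 'p symmat \<times> ('p symmat \<times> real) \<times>
      'p symmat \<times> 'p symmat \<times> ('p symmat \<times> real)) set)"
    using linear_subspace_image[OF Q subspace_UNIV]
    by (auto simp: subspace_def dom_G_D_def zero_prod_def)
  \<comment> \<open>The vertical component of the epigraph variable is slaved to \<open>dz\<close>; what remains is the
    complementarity of \<open>dx\<close> and \<open>dz\<close>, with the roles of a cone and its dual exchanged.\<close>
  have epi: "closest_point ?KE ((dz, dt) + (- dx, 0)) = (dz, dt) \<longleftrightarrow>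
      dt = - inner x dz \<and> closest_point K (dx - dz) = dx" for dx dz and dt :: real
    unfolding closest_point_cone_iff[OF KE] closest_point_K_iff
    using dual_cone_epi_critical_cone[OF closed_convex_cone_K, of dx 0 x]
    by (auto simp: epi_critical_cone_def inner_commute)
  have "(\<forall>h\<in>dom_G_D (range Q). G' h = 0 \<longrightarrow> h = 0) \<longleftrightarrow> trivial_kernel"
  proof
    assume *: "\<forall>h\<in>dom_G_D (range Q). G' h = 0 \<longrightarrow> h = 0"
    show trivial_kernel
      unfolding trivial_kernel_def
    proof (intro allI impI)
      fix dx ds dy dz
      assume 1: "Q dx - adjoint A dy - dz - ds = 0" "A dx = 0" "tangent_pair x s dx ds"
        "closest_point K (dx - dz) = dx"
      obtain dw where dw: "dw \<in> range Q" "Q dw = Q dx"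
        using Q_range_preimage by blast
      have "- ds - adjoint A dy + Q dx - dz = 0"
        using 1(1) by (simp add: algebra_simps)
      moreover have "closest_point ?KE ((dz, - inner x dz) + (- dx, 0)) = (dz, - inner x dz)"
        using 1(4) epi by blast
      ultimately have "G' (ds, dy, dw, (dz, - inner x dz), dx, dx, (- dx, 0)) = 0"
        using 1 f'(2)[of ds dx] by (simp add: G'_def dw zero_prod_def)
      moreover have "(ds, dy, dw, (dz, - inner x dz), dx, dx, (- dx, 0 :: real)) \<in> dom_G_D (range Q)"
        using dw by (simp add: dom_G_D_def)
      ultimately have "(ds, dy, dw, (dz, - inner x dz), dx, dx, (- dx, 0 :: real)) = 0"
        using * by blast
      then show "dx = 0 \<and> ds = 0 \<and> dy = 0 \<and> dz = 0"
        by (simp add: zero_prod_def)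
    qed
  next
    assume ker: trivial_kernel
    show "\<forall>h\<in>dom_G_D (range Q). G' h = 0 \<longrightarrow> h = 0"
    proof (intro ballI impI)
      fix h :: "'p symmat \<times> (real^'m) \<times> 'p symmat \<times> ('p symmat \<times> real) \<times> 'p symmat \<times>
        'p symmat \<times> ('p symmat \<times> real)"
      assume hD: "h \<in> dom_G_D (range Q)" and G'h: "G' h = 0"
      obtain ds dy dw dz dt dx du dv d\<zeta> where h: "h = (ds, dy, dw, (dz, dt), dx, du, (dv, d\<zeta>))"
        by (cases h) auto
      have 1: "dx - du = 0" "A dx = 0" "Q dw - Q dx = 0" "(dx, 0 :: real) + (dv, d\<zeta>) = 0"
        "- ds - adjoint A dy + Q dw - dz = 0" "ds - f' (ds - du) = 0"
        "- (dz, dt) + closest_point ?KE ((dz, dt) + (dv, d\<zeta>)) = 0"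
        using G'h unfolding G'_def h
        by (simp_all only: fst_conv snd_conv zero_prod_def prod.inject)
      have du: "du = dx" and Qdw: "Q dw = Q dx" and dv: "dv = - dx" and d\<zeta>: "d\<zeta> = 0"
        using 1(1,3,4) by (simp_all add: zero_prod_def eq_neg_iff_add_eq_0 add.commute)
      have "closest_point ?KE ((dz, dt) + (- dx, 0)) = (dz, dt)"
        using 1(7) unfolding dv d\<zeta> neg_add_eq_zero_iff .
      then have dt: "dt = - inner x dz" and cp: "closest_point K (dx - dz) = dx"
        using epi by blast+
      have "Q dx - adjoint A dy - dz - ds = 0"
        using 1(5) by (simp add: Qdw algebra_simps)
      moreover have "tangent_pair x s dx ds"
        using 1(6) f'(2)[of ds dx] by (simp add: du)
      ultimately have 0: "dx = 0 \<and> ds = 0 \<and> dy = 0 \<and> dz = 0"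
        using 1(2) cp by (intro ker[unfolded trivial_kernel_def, rule_format])
      have "dw \<in> range Q" "Q dw = 0"
        using hD Qdw 0 linear_0[OF Q] by (simp_all add: h dom_G_D_def)
      then have "dw = 0"
        by (rule Q_inj_on_range)
      then show "h = 0"
        using 0 du d\<zeta> dv dt by (simp add: h zero_prod_def)
    qed
  qed
  then show ?thesis
    using isolated_calm_inverse_map_iff[OF dG D aD G0] by (simp add: G theta_z)
qed

end

theorem theorem5p1:
  fixes Q :: "'p::finite symmat \<Rightarrow> 'p symmat"
    and A :: "'p symmat \<Rightarrow> real^'m::finite"
    and c :: "'p symmat" and b :: "real^'m"
    and P W :: "'p symmat set"
    and xbar ubar sbar zbar vbar wbar :: "'p symmat" and ybar :: "real^'m"
  assumes "linear Q" and "\<And>x y. inner (Q x) y = inner x (Q y)" and "\<And>x. 0 \<le> inner x (Q x)"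
    and "linear A"
    and "polyhedron P" and "P \<noteq> {}"
    and "W = range Q"
    and "G_P Q A c b P (xbar, ubar, sbar, ybar, zbar, vbar) = 0"
    and "wbar \<in> W" and "Q xbar = Q wbar"
  shows "let
      i = SOSC_P Q A c P xbar ubar sbar \<and> SOSC_D Q A P W xbar sbar zbar;
      ii = SRCQ_P A P xbar sbar zbar \<and> SRCQ_D Q A P W xbar sbar zbar;
      iii = isolated_calm (inverse_map UNIV (G_P Q A c b P)) 0
              (xbar, ubar, sbar, ybar, zbar, vbar);
      iv = isolated_calm (inverse_map (dom_G_D W) (G_D Q A c b P)) 0
              (sbar, ybar, wbar, (zbar, real_of_ereal (theta P zbar)), xbar, ubar, (- xbar, -1));
      v = isolated_calm (inverse_map UNIV (F_P Q A c b P)) 0 (xbar, ubar, ybar, zbar);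
      vi = isolated_calm (inverse_map (dom_F_D W) (F_D Q A c b P)) 0
              (sbar, ybar, wbar, zbar, xbar);
      vii = SOSC_P Q A c P xbar ubar sbar \<and> SRCQ_P A P xbar sbar zbar;
      viii = SOSC_D Q A P W xbar sbar zbar \<and> SRCQ_D Q A P W xbar sbar zbar
    in (i \<longleftrightarrow> ii) \<and> (i \<longleftrightarrow> iii) \<and> (i \<longleftrightarrow> iv) \<and> (i \<longleftrightarrow> v) \<and> (i \<longleftrightarrow> vi) \<and>
       (i \<longleftrightarrow> vii) \<and> (i \<longleftrightarrow> viii)"
proof -
  have kkt: "Q xbar - adjoint A ybar - zbar - sbar + c = 0" and "zbar + vbar = 0"
    and psd: "xbar + closest_point nsd_cone (- xbar + sbar) = 0" and "A xbar - b = 0"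
    and "xbar - ubar = 0" and projP: "- ubar + closest_point P (ubar + vbar) = 0"
    using assms(8) by (simp_all only: G_P_def case_prod_conv zero_prod_def prod.inject)
  then have u: "ubar = xbar" and feas: "A xbar = b"
    by simp_all
  have v: "vbar = - zbar"
    using \<open>zbar + vbar = 0\<close> by (simp add: eq_neg_iff_add_eq_0 add.commute)
  have "closest_point psd_cone (xbar - sbar) = xbar"
    using psd by (simp add: closest_point_nsd_cone)
  then have cp: "complementary_pair (mat_of_sym xbar) (mat_of_sym sbar)"
    by (simp add: closest_point_psd_cone_iff)
  have Pc: "closed P" "convex P" "P \<noteq> {}"
    using assms(5,6) by (auto intro: polyhedron_imp_closed polyhedron_imp_convex)
  have "closest_point P (xbar + (- zbar)) = xbar"
    using projP by (simp add: u v)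
  then have xP: "xbar \<in> P" and "\<forall>p\<in>P. inner (- zbar) (p - xbar) \<le> 0"
    unfolding closest_point_add_eq_iff[OF Pc] by blast+
  then have normal: "zbar \<in> dual_cone (tangent_cone P xbar)"
    unfolding dual_cone_tangent_cone_iff[OF xP] by simp
  interpret kkt_point xbar sbar Q A P zbar
    using cp assms(1-5) xP normal
    by (intro kkt_point.intro complementary_symmat.intro kkt_point_axioms.intro)
  have w: "wbar \<in> range Q"
    using assms(7,9) by simp
  note iffs = SOSC_P_iff[OF kkt] SOSC_D_iff SRCQ_P_iff SRCQ_D_iff
    isolated_calm_G_P_iff[OF kkt feas] isolated_calm_F_P_iff[OF kkt feas]
    isolated_calm_F_D_iff[OF kkt feas w assms(10)] isolated_calm_G_D_iff[OF kkt feas w assms(10)]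
  show ?thesis
    unfolding Let_def u v assms(7) iffs trivial_kernel_iff by blast
qed

end
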